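(* If a $Z$-viable semigroup $X$ is ideally $\mathsf{T_{\!z}S}$-closed, then its center $Z(X)$ is projectively $\mathsf{T_{\!1}S}$-closed.
   Context: A topological semigroup is a topological space with a continuous associative operation. $\mathsf{T_{\!1}S}$: $T_1$ topological semigroups; $\mathsf{T_{\!z}S}$: Tychonoff zero-dimensional topological semigroups. For a class $\mathcal C$, a semigroup $S$ (with the discrete topology) is $\mathcal C$-closed if for every isomorphic topological embedding $h:S\to Y$ into $Y\in\mathcal C$, $h[S]$ is closed in $Y$; projectively $\mathcal C$-closed if every quotient semigroup $S/_\approx$ by a congruence is $\mathcal C$-closed; ideally $\mathcal C$-closed if for every ideal $I$ of $S$ (including $\emptyset$) the Rees quotient $S/I$ is $\mathcal C$-closed. $Z(X)$ is the center of $X$. For an idempotent $e$, $H_e$ is the maximal subgroup containing $e$; $e$ is viable if $X\setminus\{x\in X:xe=ex\in H_e\}$ is an ideal of $X$. $X$ is $Z$-viable if every idempotent in $Z(X)$ is viable. *)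

theory Defs
  imports "HOL-Analysis.Analysis"
begin

definition semigroup_on :: "'a set \<Rightarrow> ('a \<Rightarrow> 'a \<Rightarrow> 'a) \<Rightarrow> bool" where
  "semigroup_on A f \<longleftrightarrow> (\<forall>x\<in>A. \<forall>y\<in>A. f x y \<in> A) \<and>
     (\<forall>x\<in>A. \<forall>y\<in>A. \<forall>z\<in>A. f (f x y) z = f x (f y z))"

definition topsemigroup :: "'b topology \<Rightarrow> ('b \<Rightarrow> 'b \<Rightarrow> 'b) \<Rightarrow> bool" where
  "topsemigroup T g \<longleftrightarrow> semigroup_on (topspace T) g \<and>
     continuous_map (prod_topology T T) T (\<lambda>p. g (fst p) (snd p))"

definition zero_dimensional :: "'b topology \<Rightarrow> bool" where
  "zero_dimensional T \<longleftrightarrow> (\<forall>U x. openin T U \<and> x \<in> U \<longrightarrow>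
     (\<exists>V. openin T V \<and> closedin T V \<and> x \<in> V \<and> V \<subseteq> U))"

definition T1S :: "'b topology \<Rightarrow> ('b \<Rightarrow> 'b \<Rightarrow> 'b) \<Rightarrow> bool" where
  "T1S T g \<longleftrightarrow> topsemigroup T g \<and> t1_space T"

definition TzS :: "'b topology \<Rightarrow> ('b \<Rightarrow> 'b \<Rightarrow> 'b) \<Rightarrow> bool" where
  "TzS T g \<longleftrightarrow> topsemigroup T g \<and> t1_space T \<and> completely_regular_space T \<and>
     zero_dimensional T"

text \<open>A semigroup (A,f) with the discrete topology is C-closed if for every
  isomorphic topological embedding h into a topological semigroup (T,g) of class C
  the image h[A] is closed in T.  The class C is given by a predicate; its carrier
  type is fixed by the type of C.\<close>
definition C_closed ::
  "('b topology \<Rightarrow> ('b \<Rightarrow> 'b \<Rightarrow> 'b) \<Rightarrow> bool) \<Rightarrow> 'a set \<Rightarrow> ('a \<Rightarrow> 'a \<Rightarrow> 'a) \<Rightarrow> bool" where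
  "C_closed C A f \<longleftrightarrow> (\<forall>T g h. C T g \<and> embedding_map (discrete_topology A) T h \<and>
      (\<forall>x\<in>A. \<forall>y\<in>A. h (f x y) = g (h x) (h y)) \<longrightarrow> closedin T (h ` A))"

definition congruence_on :: "'a set \<Rightarrow> ('a \<Rightarrow> 'a \<Rightarrow> 'a) \<Rightarrow> ('a \<times> 'a) set \<Rightarrow> bool" where
  "congruence_on A f r \<longleftrightarrow> equiv A r \<and>
     (\<forall>x\<in>A. \<forall>y\<in>A. \<forall>z\<in>A. (x, y) \<in> r \<longrightarrow> (f x z, f y z) \<in> r \<and> (f z x, f z y) \<in> r)"

definition quot_mult :: "('a \<times> 'a) set \<Rightarrow> ('a \<Rightarrow> 'a \<Rightarrow> 'a) \<Rightarrow> 'a set \<Rightarrow> 'a set \<Rightarrow> 'a set" where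
  "quot_mult r f P Q = r `` {f (SOME x. x \<in> P) (SOME y. y \<in> Q)}"

definition projectively_closed ::
  "('b topology \<Rightarrow> ('b \<Rightarrow> 'b \<Rightarrow> 'b) \<Rightarrow> bool) \<Rightarrow> 'a set \<Rightarrow> ('a \<Rightarrow> 'a \<Rightarrow> 'a) \<Rightarrow> bool" where
  "projectively_closed C A f \<longleftrightarrow>
     (\<forall>r. congruence_on A f r \<longrightarrow> C_closed C (A // r) (quot_mult r f))"

definition ideal_of :: "'a set \<Rightarrow> ('a \<Rightarrow> 'a \<Rightarrow> 'a) \<Rightarrow> 'a set \<Rightarrow> bool" where
  "ideal_of A f I \<longleftrightarrow> I \<subseteq> A \<and> (\<forall>x\<in>I. \<forall>a\<in>A. f x a \<in> I \<and> f a x \<in> I)"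

text \<open>Rees quotient A/I: elements of A - I are represented by Some x, the
  zero (the collapsed ideal, present only if I is nonempty) by None.\<close>
definition rees_carrier :: "'a set \<Rightarrow> 'a set \<Rightarrow> 'a option set" where
  "rees_carrier A I = (if I = {} then Some ` A else insert None (Some ` (A - I)))"

fun rees_mult :: "'a set \<Rightarrow> ('a \<Rightarrow> 'a \<Rightarrow> 'a) \<Rightarrow> 'a option \<Rightarrow> 'a option \<Rightarrow> 'a option" where
  "rees_mult I f (Some x) (Some y) = (if f x y \<in> I then None else Some (f x y))"
| "rees_mult I f _ _ = None"

definition ideally_closed ::
  "('b topology \<Rightarrow> ('b \<Rightarrow> 'b \<Rightarrow> 'b) \<Rightarrow> bool) \<Rightarrow> 'a set \<Rightarrow> ('a \<Rightarrow> 'a \<Rightarrow> 'a) \<Rightarrow> bool" where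
  "ideally_closed C A f \<longleftrightarrow>
     (\<forall>I. ideal_of A f I \<longrightarrow> C_closed C (rees_carrier A I) (rees_mult I f))"

definition center :: "'a set \<Rightarrow> ('a \<Rightarrow> 'a \<Rightarrow> 'a) \<Rightarrow> 'a set" where
  "center A f = {z \<in> A. \<forall>x\<in>A. f z x = f x z}"

definition subgroup_of :: "'a set \<Rightarrow> ('a \<Rightarrow> 'a \<Rightarrow> 'a) \<Rightarrow> 'a set \<Rightarrow> bool" where
  "subgroup_of A f G \<longleftrightarrow> G \<subseteq> A \<and> (\<forall>x\<in>G. \<forall>y\<in>G. f x y \<in> G) \<and>
     (\<exists>u\<in>G. \<forall>g\<in>G. f u g = g \<and> f g u = g \<and> (\<exists>k\<in>G. f g k = u \<and> f k g = u))"

definition max_subgroup :: "'a set \<Rightarrow> ('a \<Rightarrow> 'a \<Rightarrow> 'a) \<Rightarrow> 'a \<Rightarrow> 'a set" where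
  "max_subgroup A f e = \<Union>{G. subgroup_of A f G \<and> e \<in> G}"

definition viable :: "'a set \<Rightarrow> ('a \<Rightarrow> 'a \<Rightarrow> 'a) \<Rightarrow> 'a \<Rightarrow> bool" where
  "viable A f e \<longleftrightarrow>
     ideal_of A f (A - {x \<in> A. f x e = f e x \<and> f x e \<in> max_subgroup A f e})"

definition Z_viable :: "'a set \<Rightarrow> ('a \<Rightarrow> 'a \<Rightarrow> 'a) \<Rightarrow> bool" where
  "Z_viable A f \<longleftrightarrow> (\<forall>e\<in>center A f. f e e = e \<longrightarrow> viable A f e)"

end

theory Submission
  imports Defs "HOL-Library.Ramsey"
begin

text \<open>
  The center \<open>Z\<close> of \<open>X\<close> turns out to be periodic, its chains of idempotents are finite, each of its
  maximal subgroups has finite exponent, and all but finitely many of its elements lie in subgroups.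
  These properties pass to quotients. They make a discrete subsemigroup \<open>S\<close> closed in every \<open>T\<^sub>1\<close>
  topological semigroup: multiplying a limit point \<open>y\<close> outside the Clifford part \<open>C\<close> by a minimal
  idempotent \<open>p\<close> with \<open>p y \<notin> C\<close>, one may assume that either \<open>y\<close> is a limit of a single subgroup or
  \<open>x y \<in> C\<close> for the elements \<open>x\<close> near \<open>y\<close>; discreteness then makes \<open>x x'\<close> locally constant in \<open>x'\<close>,
  and the finite exponents lead to a contradiction.

  Each of the four properties of \<open>Z\<close> is obtained by adjoining to a Rees quotient \<open>X/I\<close> the
  translates \<open>x F\<close> of a filter \<open>F\<close> on its center as new points. A free ultrafilter on
  an infinite chain of idempotents, or on an infinite set \<open>A\<close> with \<open>A A \<subseteq> I\<close>, excludes both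
  of these; the tails of \<open>(z\<^sup>n)\<close> exclude non-periodic \<open>z\<close>; and in a central subgroup of infinite
  exponent one takes the elements \<open>x a\<^sub>m\<^sup>c\<close> with \<open>m\<close> large and \<open>c > 0\<close> small against
  \<open>2\<^sup>m\<close>, where \<open>a\<^sub>m\<close> has order greater than \<open>2\<^sup>m\<close> modulo the elements of exponent \<open>s\<^sub>m\<close>.
  Viability is what makes the complement of \<open>{x. x e \<in> H\<^sub>e}\<close> available as the ideal \<open>I\<close> there.
\<close>

section \<open>Commutative semigroups with finiteness conditions\<close>

text \<open>The obstacle is to adjoin filters and still have a topological semigroup: translates of
  \<open>F\<close> must be equal or separated by sets that all of them decide, products of two must
  refine a third, and \<open>F\<close> must not be concentrated at a point. An ultrafilter decides
  every set, but its square is under control only where products are factors or constant; hence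
  chains and sets with \<open>A A \<subseteq> I\<close>. Elements that are merely nilpotent modulo
  an ideal are reduced to such sets by enlarging or changing the ideal. In a group one would try the
  complements of the subgroups of exponent \<open>s\<^sub>m\<close>, but these contain inverse
  pairs, whose product is the unit. Positive exponents remove the inverses, and a bound that halves
  at each step leaves room for the sum of two exponents. Outside \<open>I\<close> the element
  \<open>x e\<close> is invertible in \<open>H\<^sub>e\<close>, so \<open>x u = c\<close> determines
  \<open>u\<close> in the group, and the translate by \<open>x\<close> is free.

  The carrier type \<open>'a option option list\<close> comes from coding: a Rees quotient lives on
  \<open>'a option\<close>, and each point or translate is named by a short list over
  \<open>'a option option\<close>.\<close>

text \<open>The power \<open>x\<^sup>n\<close> for \<open>n > 0\<close>; the junk value at \<open>n = 0\<close> is \<open>x\<close>.\<close>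

definition pw :: "('a \<Rightarrow> 'a \<Rightarrow> 'a) \<Rightarrow> 'a \<Rightarrow> nat \<Rightarrow> 'a" where
  "pw f x n = (f x ^^ (n - 1)) x"

lemma pw_1 [simp]: "pw f x (Suc 0) = x"
  by (simp add: pw_def)

lemma pw_Suc: "n > 0 \<Longrightarrow> pw f x (Suc n) = f x (pw f x n)"
  by (cases n) (simp_all add: pw_def)

definition idems :: "'a set \<Rightarrow> ('a \<Rightarrow> 'a \<Rightarrow> 'a) \<Rightarrow> 'a set" where
  "idems A f = {e \<in> A. f e e = e}"

definition periodic_on :: "'a set \<Rightarrow> ('a \<Rightarrow> 'a \<Rightarrow> 'a) \<Rightarrow> bool" where
  "periodic_on A f \<longleftrightarrow> (\<forall>x\<in>A. \<exists>n>0. pw f x n \<in> idems A f)"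

definition chain_finite_on :: "'a set \<Rightarrow> ('a \<Rightarrow> 'a \<Rightarrow> 'a) \<Rightarrow> bool" where
  "chain_finite_on A f \<longleftrightarrow>
     (\<forall>E\<subseteq>idems A f. (\<forall>u\<in>E. \<forall>v\<in>E. f u v \<in> {u, v}) \<longrightarrow> finite E)"

text \<open>In a periodic commutative semigroup this is the maximal subgroup with unit \<open>e\<close>.\<close>

definition unit_group :: "'a set \<Rightarrow> ('a \<Rightarrow> 'a \<Rightarrow> 'a) \<Rightarrow> 'a \<Rightarrow> 'a set" where
  "unit_group A f e = {x \<in> A. f e x = x \<and> (\<exists>n>0. pw f x n = e)}"

text \<open>In the commutative case this is the union of the groups \<open>unit_group A f e\<close>:
  if \<open>x^(n+1) = x\<close>, then \<open>x^n\<close> is an idempotent acting as a unit on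
  \<open>x\<close>.\<close>

definition clifford_part :: "'a set \<Rightarrow> ('a \<Rightarrow> 'a \<Rightarrow> 'a) \<Rightarrow> 'a set" where
  "clifford_part A f = {x \<in> A. \<exists>n>0. pw f x (Suc n) = x}"

section \<open>Powers in a semigroup\<close>

locale sgrp =
  fixes X :: "'a set" and f :: "'a \<Rightarrow> 'a \<Rightarrow> 'a"  (infixl "\<cdot>" 70)
  assumes sg: "semigroup_on X f"
begin

lemma closed [simp, intro]: "x \<in> X \<Longrightarrow> y \<in> X \<Longrightarrow> x \<cdot> y \<in> X"
  using sg by (simp add: semigroup_on_def)

lemma assoc: "x \<in> X \<Longrightarrow> y \<in> X \<Longrightarrow> z \<in> X \<Longrightarrow> (x \<cdot> y) \<cdot> z = x \<cdot> (y \<cdot> z)"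
  using sg by (simp add: semigroup_on_def)

lemma pw_closed [simp, intro]: "x \<in> X \<Longrightarrow> pw f x n \<in> X"
proof -
  assume x: "x \<in> X"
  have "(f x ^^ k) x \<in> X" for k using x by (induction k) auto
  then show ?thesis by (simp add: pw_def)
qed

lemma pw_add:
  assumes "x \<in> X" "m > 0" "n > 0"
  shows "pw f x (m + n) = pw f x m \<cdot> pw f x n"
  using \<open>m > 0\<close>
proof (induction m rule: nat_induct_non_zero)
  case 1
  then show ?case using assms by (simp add: pw_Suc)
next
  case (Suc k)
  then show ?case using assms by (simp add: pw_Suc assoc)
qed

lemma pw_Suc': "x \<in> X \<Longrightarrow> n > 0 \<Longrightarrow> pw f x (Suc n) = pw f x n \<cdot> x"
  using pw_add[of x n 1] by simp

lemma pw_mult: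
  assumes "x \<in> X" "m > 0" "n > 0"
  shows "pw f (pw f x m) n = pw f x (m * n)"
  using \<open>n > 0\<close>
proof (induction n rule: nat_induct_non_zero)
  case 1
  then show ?case by simp
next
  case (Suc k)
  then show ?case using assms by (simp add: pw_Suc pw_add)
qed

lemma pw_comm:
  assumes "x \<in> X" "y \<in> X" "x \<cdot> y = y \<cdot> x"
  shows "pw f x n \<cdot> y = y \<cdot> pw f x n"
proof (cases "n = 0")
  case True
  then show ?thesis using assms by (simp add: pw_def)
next
  case False
  then have "n > 0" by simp
  then show ?thesis
  proof (induction n rule: nat_induct_non_zero)
    case 1
    then show ?case using assms by simp
  next
    case (Suc k)
    have "pw f x (Suc k) \<cdot> y = x \<cdot> (y \<cdot> pw f x k)"
      using Suc assms by (simp add: pw_Suc assoc)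
    also have "\<dots> = y \<cdot> pw f x (Suc k)"
      using Suc assms by (simp add: pw_Suc flip: assoc)
    finally show ?case .
  qed
qed

lemma pw_distrib:
  assumes "x \<in> X" "y \<in> X" "x \<cdot> y = y \<cdot> x" "n > 0"
  shows "pw f (x \<cdot> y) n = pw f x n \<cdot> pw f y n"
  using \<open>n > 0\<close>
proof (induction n rule: nat_induct_non_zero)
  case 1
  then show ?case by simp
next
  case (Suc k)
  have "pw f (x \<cdot> y) (Suc k) = x \<cdot> (y \<cdot> pw f x k) \<cdot> pw f y k"
    using Suc.IH \<open>k > 0\<close> assms(1,2) by (simp add: pw_Suc assoc)
  also have "\<dots> = x \<cdot> (pw f x k \<cdot> y) \<cdot> pw f y k"
    using pw_comm[OF assms(1-3)] by simp
  also have "\<dots> = pw f x (Suc k) \<cdot> pw f y (Suc k)"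
    using \<open>k > 0\<close> assms(1,2) by (simp add: pw_Suc assoc)
  finally show ?case .
qed

lemma pw_idem: "e \<in> X \<Longrightarrow> e \<cdot> e = e \<Longrightarrow> pw f e n = e"
proof -
  assume "e \<in> X" "e \<cdot> e = e"
  then have "(f e ^^ k) e = e" for k by (induction k) auto
  then show ?thesis by (simp add: pw_def)
qed

lemma pw_idems: "e \<in> idems X f \<Longrightarrow> pw f e n = e"
  by (simp add: idems_def pw_idem)

end

text \<open>Without a minimal element, dependent choice yields a strictly descending sequence, whose
  range is an infinite chain. The relation is a parameter so that it can be reversed for maximal
  elements.\<close>

lemma minimal_of_chain_finite:
  assumes "P \<noteq> {}"
    and refl: "\<And>x. x \<in> P \<Longrightarrow> R x x"
    and trans: "\<And>x y z. x \<in> P \<Longrightarrow> y \<in> P \<Longrightarrow> z \<in> P \<Longrightarrow> R x y \<Longrightarrow> R y z \<Longrightarrow> R x z"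
    and antisym: "\<And>x y. x \<in> P \<Longrightarrow> y \<in> P \<Longrightarrow> R x y \<Longrightarrow> R y x \<Longrightarrow> x = y"
    and cf: "\<And>E. E \<subseteq> P \<Longrightarrow> (\<forall>u\<in>E. \<forall>v\<in>E. R u v \<or> R v u) \<Longrightarrow> finite E"
  shows "\<exists>p\<in>P. \<forall>q\<in>P. R q p \<longrightarrow> q = p"
proof (rule ccontr)
  assume "\<not> ?thesis"
  then have nx: "\<And>p. p \<in> P \<Longrightarrow> \<exists>q\<in>P. R q p \<and> q \<noteq> p" by blast
  obtain s where s: "\<And>n::nat. s n \<in> P" "\<And>n. R (s (Suc n)) (s n) \<and> s (Suc n) \<noteq> s n"
    using dependent_nat_choice[of "\<lambda>_ x. x \<in> P" "\<lambda>_ x y. R y x \<and> y \<noteq> x"] nx assms(1)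
    by (metis all_not_in_conv)
  have le: "R (s j) (s i)" if "i \<le> j" for i j
    using that
  proof (induction j rule: dec_induct)
    case base
    then show ?case using s refl by blast
  next
    case (step n)
    then show ?case using s trans by blast
  qed
  have "inj s"
  proof (rule linorder_injI)
    fix i j :: nat assume "i < j"
    then have "R (s j) (s (Suc i))" by (simp add: le)
    then show "s i \<noteq> s j" using s antisym by metis
  qed
  then have "infinite (range s)" by (rule range_inj_infinite)
  moreover have "finite (range s)"
    by (rule cf) (use s le nat_le_linear in \<open>blast+\<close>)
  ultimately show False by blast
qed

section \<open>Idempotents and subgroups of commutative semigroups\<close>

locale comm_sgrp = sgrp +
  assumes comm: "x \<in> X \<Longrightarrow> y \<in> X \<Longrightarrow> x \<cdot> y = y \<cdot> x"
begin

lemma lcomm: "x \<in> X \<Longrightarrow> y \<in> X \<Longrightarrow> z \<in> X \<Longrightarrow> x \<cdot> (y \<cdot> z) = y \<cdot> (x \<cdot> z)"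
  by (metis assoc comm)

lemma idems_closed:
  assumes "e \<in> idems X f" "u \<in> idems X f"
  shows "e \<cdot> u \<in> idems X f"
proof -
  have X: "e \<in> X" "u \<in> X" "e \<cdot> e = e" "u \<cdot> u = u" using assms by (auto simp: idems_def)
  have "(e \<cdot> u) \<cdot> (e \<cdot> u) = e \<cdot> (e \<cdot> (u \<cdot> u))"
    using X lcomm[of u e u] by (simp add: assoc)
  also have "\<dots> = e \<cdot> u" using X assoc[of e e u] by simp
  finally show ?thesis using X by (simp add: idems_def)
qed

lemma idems_D: "e \<in> idems X f \<Longrightarrow> e \<in> X" "e \<in> idems X f \<Longrightarrow> e \<cdot> e = e"
  by (auto simp: idems_def)

text \<open>If \<open>x^k = e\<close> and \<open>x^l = u\<close>, then \<open>x^(k l)\<close> is a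
  power of both idempotents and hence equals both.\<close>

lemma unit_group_unique:
  assumes "x \<in> unit_group X f e" "x \<in> unit_group X f u" "e \<in> idems X f" "u \<in> idems X f"
  shows "e = u"
proof -
  obtain k l where k: "k > 0" "pw f x k = e" and l: "l > 0" "pw f x l = u"
    using assms by (auto simp: unit_group_def)
  have x: "x \<in> X" using assms by (auto simp: unit_group_def)
  have "e = pw f (pw f x k) l" using assms k pw_idems by metis
  also have "\<dots> = pw f (pw f x l) k" using k(1) l(1) x by (simp add: pw_mult mult.commute)
  also have "\<dots> = u" using assms l pw_idems by metis
  finally show ?thesis .
qed

lemma unit_group_clifford:
  assumes "x \<in> unit_group X f e"
  shows "x \<in> clifford_part X f"
  using assms by (auto simp: unit_group_def clifford_part_def pw_Suc')

lemma clifford_unit_group: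
  assumes "x \<in> clifford_part X f"
  obtains e where "e \<in> idems X f" "x \<in> unit_group X f e"
proof -
  obtain n where x: "x \<in> X" and n: "n > 0" "pw f x (Suc n) = x"
    using assms by (auto simp: clifford_part_def)
  define e where "e = pw f x n"
  have ex: "e \<cdot> x = x" using n x by (simp add: e_def pw_Suc')
  have eX: "e \<in> X" using x by (simp add: e_def)
  have "e \<cdot> pw f x k = pw f x k" if "k > 0" for k
    using that
  proof (induction k rule: nat_induct_non_zero)
    case 1
    then show ?case using ex by simp
  next
    case (Suc k)
    then show ?case using ex eX x by (simp add: pw_Suc flip: assoc)
  qed
  then have "e \<cdot> e = e" using n by (simp add: e_def)
  then have "e \<in> idems X f" using eX by (simp add: idems_def)
  moreover have "x \<in> unit_group X f e" using x ex n by (auto simp: unit_group_def e_def)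
  ultimately show ?thesis using that by blast
qed

lemma unit_group_mult:
  assumes "x \<in> unit_group X f e" "y \<in> unit_group X f u" "e \<in> idems X f" "u \<in> idems X f"
  shows "x \<cdot> y \<in> unit_group X f (e \<cdot> u)"
proof -
  obtain k l where k: "k > 0" "pw f x k = e" and l: "l > 0" "pw f y l = u"
    using assms by (auto simp: unit_group_def)
  have X: "x \<in> X" "y \<in> X" "e \<in> X" "u \<in> X" and ex: "e \<cdot> x = x" "u \<cdot> y = y"
    using assms by (auto simp: unit_group_def idems_def)
  have "pw f (x \<cdot> y) (k * l) = pw f (pw f x k) l \<cdot> pw f (pw f y l) k"
    using X k(1) l(1) pw_distrib[of x y "k * l"] comm[of x y]
    by (simp add: pw_mult mult.commute)
  also have "\<dots> = e \<cdot> u" using k l assms pw_idems by simp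
  finally have "pw f (x \<cdot> y) (k * l) = e \<cdot> u" .
  moreover have "e \<cdot> u \<cdot> (x \<cdot> y) = x \<cdot> y"
  proof -
    have "e \<cdot> u \<cdot> (x \<cdot> y) = (e \<cdot> x) \<cdot> (u \<cdot> y)" using X lcomm[of u x y] by (simp add: assoc)
    then show ?thesis using ex by simp
  qed
  ultimately show ?thesis using X k l
    by (auto simp: unit_group_def intro!: exI[of _ "k * l"])
qed

lemma clifford_closed:
  assumes "x \<in> clifford_part X f" "y \<in> clifford_part X f"
  shows "x \<cdot> y \<in> clifford_part X f"
  using assms by (meson clifford_unit_group unit_group_mult unit_group_clifford)

end

text \<open>The exponent in \<open>bounded\<close> may depend on \<open>e\<close>: each limit
  argument below ends in a single group.\<close>

locale tame_sgrp = comm_sgrp +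
  assumes periodic: "periodic_on X f"
    and chain_finite: "chain_finite_on X f"
    and bounded: "e \<in> idems X f \<Longrightarrow> \<exists>n>0. \<forall>x\<in>unit_group X f e. pw f x n = e"
    and almost_clifford: "finite (X - clifford_part X f)"
begin

lemma chain_finiteD:
  assumes "E \<subseteq> idems X f" "\<forall>u\<in>E. \<forall>v\<in>E. u \<cdot> v = u \<or> v \<cdot> u = v"
  shows "finite E"
proof -
  have "\<forall>u\<in>E. \<forall>v\<in>E. u \<cdot> v \<in> {u, v}"
    using assms comm idems_D(1) by (metis insertCI subsetD)
  then show ?thesis using chain_finite assms(1) unfolding chain_finite_on_def by blast
qed

text \<open>Idempotents carry the order in which \<open>q\<close> is below \<open>p\<close> iff
  \<open>q \<cdot> p = q\<close>.\<close>

lemma minimal_idem: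
  assumes "P \<noteq> {}" "P \<subseteq> idems X f"
  shows "\<exists>p\<in>P. \<forall>q\<in>P. q \<cdot> p = q \<longrightarrow> q = p"
proof -
  have P: "x \<in> X" "x \<cdot> x = x" if "x \<in> P" for x
    using that assms idems_D by auto
  show ?thesis
  proof (rule minimal_of_chain_finite[OF assms(1)])
    show "x \<cdot> z = x" if "x \<in> P" "y \<in> P" "z \<in> P" "x \<cdot> y = x" "y \<cdot> z = y" for x y z
      using that P assoc by metis
    show "x = y" if "x \<in> P" "y \<in> P" "x \<cdot> y = x" "y \<cdot> x = y" for x y
      using that P comm by metis
    show "finite E" if "E \<subseteq> P" "\<forall>u\<in>E. \<forall>v\<in>E. u \<cdot> v = u \<or> v \<cdot> u = v" for E
      using that assms chain_finiteD by (meson order_trans)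
  qed (use P in auto)
qed

lemma maximal_idem:
  assumes "P \<noteq> {}" "P \<subseteq> idems X f"
  shows "\<exists>p\<in>P. \<forall>q\<in>P. p \<cdot> q = p \<longrightarrow> q = p"
proof -
  have P: "x \<in> X" "x \<cdot> x = x" if "x \<in> P" for x
    using that assms idems_D by auto
  show ?thesis
  proof (rule minimal_of_chain_finite[OF assms(1), of "\<lambda>q p. p \<cdot> q = p"])
    show "z \<cdot> x = z" if "x \<in> P" "y \<in> P" "z \<in> P" "y \<cdot> x = y" "z \<cdot> y = z" for x y z
      using that P assoc by metis
    show "x = y" if "x \<in> P" "y \<in> P" "y \<cdot> x = y" "x \<cdot> y = x" for x y
      using that P comm by metis
    show "finite E" if "E \<subseteq> P" "\<forall>u\<in>E. \<forall>v\<in>E. v \<cdot> u = v \<or> u \<cdot> v = u" for E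
      using that assms chain_finiteD by (metis order_trans)
  qed (use P in auto)
qed

end

section \<open>Homomorphic images\<close>

lemma pw_hom:
  assumes "sgrp A f" "\<And>x y. x \<in> A \<Longrightarrow> y \<in> A \<Longrightarrow> \<phi> (f x y) = g (\<phi> x) (\<phi> y)" "x \<in> A"
  shows "\<phi> (pw f x n) = pw g (\<phi> x) n"
proof -
  interpret sgrp A f by fact
  have "(f x ^^ k) x \<in> A \<and> \<phi> ((f x ^^ k) x) = (g (\<phi> x) ^^ k) (\<phi> x)" for k
    using assms(2,3) by (induction k) auto
  then show ?thesis by (simp add: pw_def)
qed

text \<open>Every idempotent \<open>\<epsilon>\<close> of the image has a least idempotent preimage
  \<open>m \<epsilon>\<close>. The section \<open>m\<close> preserves the order, so chains lift to
  chains; leastness also lets the group at \<open>\<epsilon>\<close> be lifted into the group at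
  \<open>m \<epsilon>\<close>, which transfers the exponent.\<close>

lemma tame_sgrp_image:
  assumes "tame_sgrp A f"
    and hom: "\<And>x y. x \<in> A \<Longrightarrow> y \<in> A \<Longrightarrow> \<phi> (f x y) = g (\<phi> x) (\<phi> y)"
  shows "tame_sgrp (\<phi> ` A) g"
proof -
  interpret A: tame_sgrp A f by fact
  have pw: "\<phi> (pw f x n) = pw g (\<phi> x) n" if "x \<in> A" for x n
    by (rule pw_hom[where A = A and f = f]) (simp_all add: A.sgrp_axioms hom that)
  interpret B: comm_sgrp "\<phi> ` A" g
  proof unfold_locales
    show "semigroup_on (\<phi> ` A) g"
      unfolding semigroup_on_def
    proof (intro conjI ballI; clarify)
      fix x y assume "x \<in> A" "y \<in> A"
      then show "g (\<phi> x) (\<phi> y) \<in> \<phi> ` A" by (metis A.closed hom imageI)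
    next
      fix x y z assume "x \<in> A" "y \<in> A" "z \<in> A"
      then show "g (g (\<phi> x) (\<phi> y)) (\<phi> z) = g (\<phi> x) (g (\<phi> y) (\<phi> z))"
        by (metis A.closed A.assoc hom)
    qed
    show "g x y = g y x" if "x \<in> \<phi> ` A" "y \<in> \<phi> ` A" for x y
      using that by clarify (metis A.comm hom)
  qed
  have idem: "\<phi> e \<in> idems (\<phi> ` A) g" if "e \<in> idems A f" for e
    using that hom[of e e] by (simp add: idems_def)
  have lift: "\<exists>m\<in>idems A f. \<phi> m = \<epsilon> \<and> (\<forall>e\<in>idems A f. \<phi> e = \<epsilon> \<longrightarrow> f m e = m)"
    if \<epsilon>: "\<epsilon> \<in> idems (\<phi> ` A) g" for \<epsilon>
  proof -
    let ?P = "{e \<in> idems A f. \<phi> e = \<epsilon>}"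
    have "\<epsilon> \<in> \<phi> ` A" using that B.idems_D by simp
    then obtain z where z: "z \<in> A" "\<phi> z = \<epsilon>" by (elim imageE) simp
    obtain n where n: "n > 0" "pw f z n \<in> idems A f"
      using A.periodic z by (auto simp: periodic_on_def)
    have "\<phi> (pw f z n) = \<epsilon>" using pw z that B.pw_idems by metis
    then have "?P \<noteq> {}" using n by blast
    moreover have "?P \<subseteq> idems A f" by (rule Collect_restrict)
    ultimately obtain m where m: "m \<in> ?P" "\<forall>q\<in>?P. f q m = q \<longrightarrow> q = m"
      using A.minimal_idem by meson
    \<comment> \<open>A minimal preimage is least: \<open>f m e\<close> is again an idempotent over
      \<open>\<epsilon>\<close> and lies below \<open>m\<close>.\<close>
    have "f m e = m" if e: "e \<in> idems A f" "\<phi> e = \<epsilon>" for e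
    proof -
      have mA: "m \<in> A" "e \<in> A" "f m m = m" using m(1) e A.idems_D by simp_all
      have "\<phi> (f m e) = \<epsilon>" using m(1) e mA B.idems_D(2)[OF \<epsilon>] by (simp add: hom)
      then have "f m e \<in> ?P" using m(1) e(1) A.idems_closed by simp
      moreover have "f (f m e) m = f m e" using mA by (metis A.assoc A.closed A.comm)
      ultimately show ?thesis using m(2) by blast
    qed
    then show ?thesis using m(1) by blast
  qed
  then obtain m where m: "\<And>\<epsilon>. \<epsilon> \<in> idems (\<phi> ` A) g \<Longrightarrow> m \<epsilon> \<in> idems A f \<and> \<phi> (m \<epsilon>) = \<epsilon>"
    and least: "\<And>\<epsilon> e. \<epsilon> \<in> idems (\<phi> ` A) g \<Longrightarrow> e \<in> idems A f \<Longrightarrow> \<phi> e = \<epsilon> \<Longrightarrow> f (m \<epsilon>) e = m \<epsilon>"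
    by metis
  \<comment> \<open>The product \<open>f (m \<epsilon>) (m \<delta>)\<close> maps to
    \<open>g \<epsilon> \<delta> = \<epsilon>\<close>, so the least preimage
    \<open>m \<epsilon>\<close> lies below it.\<close>
  have mono: "f (m \<epsilon>) (m \<delta>) = m \<epsilon>"
    if "\<epsilon> \<in> idems (\<phi> ` A) g" "\<delta> \<in> idems (\<phi> ` A) g" "g \<epsilon> \<delta> = \<epsilon>" for \<epsilon> \<delta>
  proof -
    have mm: "m \<epsilon> \<in> A" "m \<delta> \<in> A" "f (m \<epsilon>) (m \<epsilon>) = m \<epsilon>"
      using m[OF that(1)] m[OF that(2)] A.idems_D by simp_all
    have "f (m \<epsilon>) (f (m \<epsilon>) (m \<delta>)) = m \<epsilon>"
      using that m[OF that(1)] m[OF that(2)] mm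
      by (intro least) (simp_all add: A.idems_closed hom)
    then show ?thesis using mm by (metis A.assoc)
  qed
  show ?thesis
  proof unfold_locales
    show "periodic_on (\<phi> ` A) g"
      unfolding periodic_on_def
    proof
      fix y assume "y \<in> \<phi> ` A"
      then obtain x where x: "x \<in> A" "y = \<phi> x" by blast
      obtain n where n: "n > 0" "pw f x n \<in> idems A f"
        using A.periodic x by (auto simp: periodic_on_def)
      have "\<phi> (pw f x n) \<in> idems (\<phi> ` A) g"
        using n(2) idem by blast
      then show "\<exists>n>0. pw g y n \<in> idems (\<phi> ` A) g" using n x pw by auto
    qed
    show "chain_finite_on (\<phi> ` A) g"
      unfolding chain_finite_on_def
    proof (intro allI impI)
      fix E assume E: "E \<subseteq> idems (\<phi> ` A) g" "\<forall>u\<in>E. \<forall>v\<in>E. g u v \<in> {u, v}"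
      have "finite (m ` E)"
      proof (rule A.chain_finiteD)
        show "m ` E \<subseteq> idems A f" using E m by blast
        show "\<forall>u\<in>m ` E. \<forall>v\<in>m ` E. f u v = u \<or> f v u = v"
        proof (clarify)
          fix u v assume uv: "u \<in> E" "v \<in> E" "f (m v) (m u) \<noteq> m v"
          then have "g v u \<noteq> v" using mono E by blast
          then have "g v u = u" using E uv by blast
          then have "g u v = u" using E uv B.comm B.idems_D(1) by (metis subsetD)
          then show "f (m u) (m v) = m u" using mono E uv by blast
        qed
      qed
      moreover have "inj_on m E" using E m by (metis inj_onI subsetD)
      ultimately show "finite E" by (rule finite_imageD)
    qed
    show "\<exists>n>0. \<forall>x\<in>unit_group (\<phi> ` A) g \<epsilon>. pw g x n = \<epsilon>"
      if \<epsilon>: "\<epsilon> \<in> idems (\<phi> ` A) g" for \<epsilon>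
    proof -
      have m\<epsilon>: "m \<epsilon> \<in> idems A f" "\<phi> (m \<epsilon>) = \<epsilon>" "m \<epsilon> \<in> A" "f (m \<epsilon>) (m \<epsilon>) = m \<epsilon>"
        using m[OF \<epsilon>] A.idems_D by auto
      obtain n where n: "n > 0" "\<forall>x\<in>unit_group A f (m \<epsilon>). pw f x n = m \<epsilon>"
        using A.bounded m\<epsilon> by blast
      have "pw g x n = \<epsilon>" if x: "x \<in> unit_group (\<phi> ` A) g \<epsilon>" for x
      proof -
        obtain z where z: "z \<in> A" "x = \<phi> z" using x by (auto simp: unit_group_def)
        obtain k where k: "k > 0" "pw g x k = \<epsilon>" using x by (auto simp: unit_group_def)
        \<comment> \<open>Multiplication by \<open>m \<epsilon>\<close> does not change the image
          \<open>x\<close>, but puts the idempotent power of the lift below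
          \<open>m \<epsilon>\<close>. That power maps to \<open>\<epsilon>\<close>, so leastness
          makes it equal to \<open>m \<epsilon>\<close>.\<close>
        define w where "w = f (m \<epsilon>) z"
        have w: "w \<in> A" "f (m \<epsilon>) w = w" using z m\<epsilon> by (auto simp: w_def simp flip: A.assoc)
        have xw: "\<phi> w = x" using z m\<epsilon> hom x by (auto simp: w_def unit_group_def)
        obtain j where j: "j > 0" "pw f w j \<in> idems A f"
          using A.periodic w by (auto simp: periodic_on_def)
        have xB: "x \<in> \<phi> ` A" using z by auto
        have xj: "pw g x j \<in> idems (\<phi> ` A) g"
          using idem[OF j(2)] pw[OF w(1)] xw by simp
        have "pw g x j = pw g (pw g x j) k" using xj B.pw_idems by metis
        also have "\<dots> = pw g (pw g x k) j" using j(1) k(1) xB by (simp add: B.pw_mult mult.commute)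
        also have "\<dots> = \<epsilon>" using k B.pw_idems \<epsilon> by metis
        finally have "\<phi> (pw f w j) = \<epsilon>" using pw w xw by auto
        then have "f (m \<epsilon>) (pw f w j) = m \<epsilon>" using least \<epsilon> j by blast
        moreover have "f (m \<epsilon>) (pw f w j) = pw f w j"
        proof -
          have "pw f w j = pw f (f (m \<epsilon>) w) j" using w by simp
          also have "\<dots> = f (m \<epsilon>) (pw f w j)"
            using w m\<epsilon> j A.pw_distrib[of "m \<epsilon>" w j] A.comm A.pw_idems by simp
          finally show ?thesis by simp
        qed
        ultimately have "w \<in> unit_group A f (m \<epsilon>)" using w j by (auto simp: unit_group_def)
        then have "pw f w n = m \<epsilon>" using n by blast
        then show ?thesis using pw w xw m\<epsilon> by metis
      qed
      then show ?thesis using n by blast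
    qed
    show "finite (\<phi> ` A - clifford_part (\<phi> ` A) g)"
    proof (rule finite_subset)
      have "\<phi> x \<in> clifford_part (\<phi> ` A) g" if "x \<in> clifford_part A f" for x
      proof -
        obtain n where "x \<in> A" "n > 0" "pw f x (Suc n) = x"
          using \<open>x \<in> clifford_part A f\<close> by (auto simp: clifford_part_def)
        then show ?thesis using pw[of x "Suc n"] by (auto simp: clifford_part_def)
      qed
      then show "\<phi> ` A - clifford_part (\<phi> ` A) g \<subseteq> \<phi> ` (A - clifford_part A f)"
        by blast
    qed (use A.almost_clifford in blast)
  qed
qed

section \<open>Closedness in T1 topological semigroups\<close>

lemma nbhd_diag:
  assumes "continuous_map (prod_topology T T) T (\<lambda>p. F (fst p) (snd p))"
    and "openin T U" "y \<in> topspace T" "F y y \<in> U"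
  obtains V where "openin T V" "y \<in> V" "\<And>u v. u \<in> V \<Longrightarrow> v \<in> V \<Longrightarrow> F u v \<in> U"
proof -
  let ?P = "{p \<in> topspace (prod_topology T T). F (fst p) (snd p) \<in> U}"
  have "openin (prod_topology T T) ?P"
    using openin_continuous_map_preimage assms(1,2) by blast
  moreover have "(y, y) \<in> ?P" using assms by simp
  ultimately obtain V W where V: "openin T V" "openin T W" "y \<in> V" "y \<in> W" "V \<times> W \<subseteq> ?P"
    unfolding openin_prod_topology_alt by meson
  show ?thesis
  proof (rule that)
    show "openin T (V \<inter> W)" using V by blast
    show "F u v \<in> U" if "u \<in> V \<inter> W" "v \<in> V \<inter> W" for u v
    proof -
      have "(u, v) \<in> ?P" using V(5) that by blast
      then show ?thesis by simp
    qed
  qed (use V in auto)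
qed

text \<open>The embedding is absorbed: \<open>X\<close> is a subset of the space and carries its
  multiplication; \<open>discrete\<close> says that the subspace topology on \<open>X\<close> is
  discrete.\<close>

locale tame_T1 = tame_sgrp X f for X and f (infixl "\<cdot>" 70) +
  fixes T :: "'a topology"
  assumes T1S: "T1S T f" and sub: "X \<subseteq> topspace T"
    and discrete: "s \<in> X \<Longrightarrow> \<exists>U. openin T U \<and> U \<inter> X = {s}"
begin

sublocale Y: sgrp "topspace T" f
  using T1S by unfold_locales (simp add: T1S_def topsemigroup_def)

lemma cont_mult:
  assumes "continuous_map S T h" "continuous_map S T k"
  shows "continuous_map S T (\<lambda>x. h x \<cdot> k x)"
proof -
  have "continuous_map (prod_topology T T) T (\<lambda>p. fst p \<cdot> snd p)"
    using T1S by (simp add: T1S_def topsemigroup_def)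
  moreover have "continuous_map S (prod_topology T T) (\<lambda>x. (h x, k x))"
    using assms by (simp add: continuous_map_pairedI)
  ultimately have "continuous_map S T ((\<lambda>p. fst p \<cdot> snd p) \<circ> (\<lambda>x. (h x, k x)))"
    by (rule continuous_map_compose[rotated])
  then show ?thesis by (simp add: o_def)
qed

lemma cont_pw: "continuous_map S T h \<Longrightarrow> continuous_map S T (\<lambda>x. pw f (h x) n)"
proof -
  assume h: "continuous_map S T h"
  have "continuous_map S T (\<lambda>x. (f (h x) ^^ k) (h x))" for k
    by (induction k) (simp_all add: h cont_mult)
  then show ?thesis by (simp add: pw_def)
qed

lemmas cont_fst_snd = continuous_map_fst[of T T] continuous_map_snd[of T T]

lemma T1: "x \<in> topspace T \<Longrightarrow> openin T (topspace T - {x})"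
  using T1S by (simp add: T1S_def t1_space_openin_delete_alt)

text \<open>Limits need not be unique in a \<open>T1\<close> space, but constants survive: the
  preimage of the closed point \<open>c\<close> is closed and contains \<open>D\<close>.\<close>

lemma closure_limit:
  assumes "continuous_map T T h" "y \<in> T closure_of D" "c \<in> topspace T" "\<And>x. x \<in> D \<Longrightarrow> h x = c"
  shows "h y = c"
proof (rule ccontr)
  assume "h y \<noteq> c"
  have y: "y \<in> topspace T" using assms(2) by (simp add: in_closure_of)
  let ?V = "{x \<in> topspace T. h x \<in> topspace T - {c}}"
  have "openin T ?V"
    using openin_continuous_map_preimage[OF assms(1) T1[OF assms(3)]] .
  moreover have "y \<in> ?V" using y \<open>h y \<noteq> c\<close> assms(1) by (auto simp: continuous_map_def)
  ultimately obtain x where "x \<in> D" "x \<in> ?V" using assms(2) unfolding in_closure_of by meson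
  then show False using assms(4) by simp
qed

text \<open>If \<open>x\<close> and \<open>v\<close> are group elements near \<open>y\<close>,
  discreteness at \<open>e\<close> forces \<open>x^m v = e = x^m x\<close>, hence
  \<open>v = x\<close>. So some neighbourhood of \<open>y\<close> contains a single group element,
  and that point can be removed.\<close>

lemma group_closed:
  assumes e: "e \<in> idems X f" and y: "y \<in> T closure_of (unit_group X f e)"
  shows "y \<in> unit_group X f e"
proof (rule ccontr)
  assume y': "y \<notin> unit_group X f e"
  let ?G = "unit_group X f e"
  have G: "x \<in> X" "e \<cdot> x = x" if "x \<in> ?G" for x using that by (auto simp: unit_group_def)
  have yT: "y \<in> topspace T" using y by (simp add: in_closure_of)
  have eX: "e \<in> X" "e \<in> topspace T" using e sub by (auto simp: idems_def)
  obtain n where n: "n > 0" "\<And>x. x \<in> ?G \<Longrightarrow> pw f x n = e" using bounded[OF e] by blast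
  \<comment> \<open>The doubled exponent keeps \<open>m = n + n - 1\<close> positive even for
    \<open>n = 1\<close>; \<open>pw\<close> at \<open>0\<close> is not a unit.\<close>
  have n2: "pw f x (n + n) = e" if "x \<in> ?G" for x
    using n that G e by (simp add: pw_add idems_def)
  have "pw f y (n + n) = e"
    using closure_limit[OF cont_pw[OF continuous_map_id[unfolded id_def]] y eX(2) n2] .
  define m where "m = n + n - 1"
  have m: "m > 0" "n + n = Suc m" using n by (auto simp: m_def)
  obtain U where U: "openin T U" "U \<inter> X = {e}" using discrete eX by blast
  have "pw f y m \<cdot> y \<in> U"
    using \<open>pw f y (n + n) = e\<close> m yT U by (auto simp: Y.pw_Suc')
  moreover have "continuous_map (prod_topology T T) T (\<lambda>p. pw f (fst p) m \<cdot> snd p)"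
    by (intro cont_mult cont_pw cont_fst_snd)
  ultimately obtain V where V: "openin T V" "y \<in> V" "\<And>u v. u \<in> V \<Longrightarrow> v \<in> V \<Longrightarrow> pw f u m \<cdot> v \<in> U"
    using nbhd_diag[of T "\<lambda>u v. pw f u m \<cdot> v" U y] U(1) yT by blast
  obtain x where x: "x \<in> ?G" "x \<in> V" using y V unfolding in_closure_of by meson
  have "v = x" if v: "v \<in> ?G" "v \<in> V" for v
  proof -
    have "pw f x m \<cdot> v \<in> U \<inter> X" using V x v G by auto
    then have "pw f x m \<cdot> v = e" using U by auto
    then have "pw f x m \<cdot> v \<cdot> x = x" using G x by simp
    moreover have "pw f x m \<cdot> v \<cdot> x = pw f x (Suc m) \<cdot> v"
      using G x v m comm[of v x] by (simp add: assoc pw_Suc')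
    moreover have "\<dots> = v" using n2 x m G v by simp
    ultimately show ?thesis by simp
  qed
  moreover have "openin T (V - {x})"
  proof -
    have "V - {x} = V \<inter> (topspace T - {x})" using openin_subset[OF V(1)] by blast
    then show ?thesis using V(1) T1[of x] G(1)[OF x(1)] sub by auto
  qed
  moreover have "y \<in> V - {x}" using V x y' by auto
  ultimately show False using y unfolding in_closure_of by (metis Diff_iff insertI1)
qed

text \<open>By discreteness \<open>x \<cdot> w\<close> is frozen at \<open>x \<cdot> y\<close> for
  \<open>w\<close> in \<open>D\<close> near \<open>y\<close>, on a neighbourhood depending on
  \<open>x\<close>. Choosing \<open>x\<close> first and then \<open>w\<close> fixes one idempotent
  \<open>e\<close> near \<open>y\<close>; the relation \<open>x^n w^n = e\<close> passes to
  \<open>y\<close> by \<open>T1\<close> and back to the diagonal by discreteness. Near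
  \<open>y\<close> the set \<open>D\<close> then lies in the single group at
  \<open>e\<close>.\<close>

lemma closure_mult_clifford:
  assumes D: "D \<subseteq> clifford_part X f" and y: "y \<in> T closure_of D"
    and Dy: "\<And>x. x \<in> D \<Longrightarrow> x \<cdot> y \<in> clifford_part X f"
  shows "y \<in> clifford_part X f"
proof -
  have yT: "y \<in> topspace T" using y by (simp add: in_closure_of)
  obtain \<pi> where \<pi>: "\<And>x. x \<in> clifford_part X f \<Longrightarrow> \<pi> x \<in> idems X f \<and> x \<in> unit_group X f (\<pi> x)"
    by (metis clifford_unit_group)
  have \<pi>_eq: "\<pi> x = e" if "e \<in> idems X f" "x \<in> unit_group X f e" for x e
    using that \<pi> unit_group_clifford unit_group_unique by meson
  have \<pi>_mult: "\<pi> (x \<cdot> z) = \<pi> x \<cdot> \<pi> z" if "x \<in> clifford_part X f" "z \<in> clifford_part X f" for x z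
    using that \<pi> by (meson \<pi>_eq idems_closed unit_group_mult)
  have CX: "x \<in> X" if "x \<in> clifford_part X f" for x using that by (simp add: clifford_part_def)
  have DX: "x \<in> X" "x \<in> topspace T" if "x \<in> D" for x using CX D that sub by auto
  have \<pi>X: "\<pi> x \<in> X" "\<pi> x \<cdot> \<pi> x = \<pi> x" if "x \<in> clifford_part X f" for x
    using \<pi>[OF that] idems_D by auto
  have "\<exists>W. openin T W \<and> y \<in> W \<and> (\<forall>w\<in>W \<inter> D. x \<cdot> w = x \<cdot> y)" if x: "x \<in> D" for x
  proof -
    obtain U where U: "openin T U" "U \<inter> X = {x \<cdot> y}" using discrete CX Dy x by metis
    let ?W = "{w \<in> topspace T. x \<cdot> w \<in> U}"
    have "continuous_map T T (\<lambda>w. x \<cdot> w)"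
      using DX x by (intro cont_mult) auto
    then have "openin T ?W" using U(1) openin_continuous_map_preimage by blast
    moreover have "y \<in> ?W" using yT U by auto
    moreover have "x \<cdot> w = x \<cdot> y" if "w \<in> ?W \<inter> D" for w
    proof -
      have "x \<cdot> w \<in> U \<inter> X" using that DX x by auto
      then show ?thesis using U by auto
    qed
    ultimately show ?thesis by blast
  qed
  then obtain W where W: "\<And>x. x \<in> D \<Longrightarrow> openin T (W x)" "\<And>x. x \<in> D \<Longrightarrow> y \<in> W x"
    "\<And>x w. x \<in> D \<Longrightarrow> w \<in> W x \<Longrightarrow> w \<in> D \<Longrightarrow> x \<cdot> w = x \<cdot> y"
    by (metis IntI)
  have meet: "\<exists>x. x \<in> D \<and> x \<in> V" if "openin T V" "y \<in> V" for V
    using y that unfolding in_closure_of by meson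
  have "D \<noteq> {}" using meet[of "topspace T"] yT by auto
  \<comment> \<open>A maximal idempotent is taken because for \<open>x\<close> in \<open>D\<close>
    near \<open>y\<close> the idempotent of \<open>x \<cdot> y\<close> turns out to be above
    \<open>e\<close>; maximality makes it locally constant.\<close>
  let ?P = "(\<lambda>x. \<pi> (x \<cdot> y)) ` D"
  have "?P \<subseteq> idems X f" using Dy \<pi> by blast
  then obtain e where e: "e \<in> ?P" "\<And>q. q \<in> ?P \<Longrightarrow> e \<cdot> q = e \<Longrightarrow> q = e"
    using maximal_idem[of ?P] \<open>D \<noteq> {}\<close> by blast
  then obtain x0 where x0: "x0 \<in> D" "e = \<pi> (x0 \<cdot> y)" by blast
  have e': "e \<in> idems X f" "e \<in> X" "e \<in> topspace T" "e \<cdot> e = e"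
    using e(1) \<open>?P \<subseteq> idems X f\<close> idems_D sub by auto
  have below: "e \<cdot> \<pi> x = e" if x: "x \<in> W x0" "x \<in> D" for x
  proof -
    have "e = \<pi> x0 \<cdot> \<pi> x" using W(3)[OF x0(1) x] x0 x D \<pi>_mult by (metis subsetD)
    then show ?thesis using \<pi>X x x0 D by (simp add: assoc subset_iff)
  qed
  have \<pi>_e: "\<pi> (x \<cdot> y) = e" if x: "x \<in> W x0" "x \<in> D" for x
  proof -
    \<comment> \<open>The neighbourhood \<open>W x\<close> depends on \<open>x\<close>, so
      \<open>w\<close> has to be chosen after \<open>x\<close>. It expresses
      \<open>x \<cdot> y\<close> as a product of two elements of \<open>D\<close>.\<close>
    obtain w where w: "w \<in> D" "w \<in> W x0 \<inter> W x" using meet[of "W x0 \<inter> W x"] W x x0 by blast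
    have "\<pi> (x \<cdot> y) = \<pi> x \<cdot> \<pi> w" using W(3)[of x w] x w D \<pi>_mult by (metis IntE subsetD)
    then have "e \<cdot> \<pi> (x \<cdot> y) = e \<cdot> \<pi> x \<cdot> \<pi> w"
      using \<pi>X x w D e' by (simp add: assoc subset_iff)
    also have "\<dots> = e" using below x w by auto
    finally show ?thesis using e(2) x by blast
  qed
  obtain n where n: "n > 0" "\<And>x. x \<in> unit_group X f e \<Longrightarrow> pw f x n = e"
    using bounded[OF e'(1)] by blast
  have pwn: "pw f x n \<cdot> pw f w n = e" if "x \<in> D" "x \<in> W x0" "w \<in> D" "w \<in> W x" for x w
  proof -
    have "x \<cdot> w \<in> unit_group X f e" using \<pi>_e[of x] W(3)[of x w] that \<pi> Dy by metis
    then have "pw f (x \<cdot> w) n = e" using n by blast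
    then show ?thesis using DX that n(1) pw_distrib[of x w n] comm by simp
  qed
  have cont: "continuous_map (prod_topology T T) T (\<lambda>p. pw f (fst p) n \<cdot> pw f (snd p) n)"
    by (intro cont_mult cont_pw cont_fst_snd)
  \<comment> \<open>The fact \<open>pwn\<close> covers only pairs with \<open>w\<close> in
    \<open>W x\<close>, but every neighbourhood of \<open>y\<close> contains such a pair, so it
    cannot map into the open set of points different from \<open>e\<close>.\<close>
  have yn: "pw f y n \<cdot> pw f y n = e"
  proof (rule ccontr)
    assume "pw f y n \<cdot> pw f y n \<noteq> e"
    then have "pw f y n \<cdot> pw f y n \<in> topspace T - {e}" using yT by auto
    then obtain V where V: "openin T V" "y \<in> V"
      "\<And>u v. u \<in> V \<Longrightarrow> v \<in> V \<Longrightarrow> pw f u n \<cdot> pw f v n \<in> topspace T - {e}"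
      using nbhd_diag[of T "\<lambda>u v. pw f u n \<cdot> pw f v n" "topspace T - {e}" y] cont T1 e' yT by blast
    obtain x where x: "x \<in> D" "x \<in> V \<inter> W x0" using meet[of "V \<inter> W x0"] V W x0 by blast
    obtain w where w: "w \<in> D" "w \<in> V \<inter> W x" using meet[of "V \<inter> W x"] V W x by blast
    show False using V(3)[of x w] pwn x w by auto
  qed
  \<comment> \<open>Now that the value at \<open>(y, y)\<close> is \<open>e\<close>, discreteness
    gives \<open>u^n v^n = e\<close> for all \<open>u\<close>, \<open>v\<close> of \<open>X\<close>
    in a neighbourhood, in particular for \<open>u = v\<close>, which \<open>pwn\<close> does not
    provide.\<close>
  obtain U where U: "openin T U" "U \<inter> X = {e}" using discrete e' by blast
  then obtain V where V: "openin T V" "y \<in> V"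
    "\<And>u v. u \<in> V \<Longrightarrow> v \<in> V \<Longrightarrow> pw f u n \<cdot> pw f v n \<in> U"
    using nbhd_diag[of T "\<lambda>u v. pw f u n \<cdot> pw f v n" U y] cont yn yT by blast
  have "x \<in> unit_group X f e" if x: "x \<in> D" "x \<in> V" for x
  proof -
    have "pw f x n \<cdot> pw f x n \<in> U \<inter> X" using V DX x by auto
    then have "pw f x (n + n) = e" using U DX x n by (auto simp: pw_add)
    moreover have xC: "x \<in> clifford_part X f" using x D by blast
    then obtain k where k: "k > 0" "pw f x k = \<pi> x" using \<pi> by (auto simp: unit_group_def)
    have "pw f (pw f x k) (n + n) = pw f (pw f x (n + n)) k"
      using k(1) n DX x by (simp add: pw_mult mult.commute)
    ultimately have "\<pi> x = e" using k pw_idems e'(1) \<pi> xC by metis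
    then show ?thesis using \<pi> xC by metis
  qed
  then have "y \<in> T closure_of (unit_group X f e)"
    using meet V yT unfolding in_closure_of by (metis IntE IntI openin_Int)
  then show ?thesis using group_closed e' unit_group_clifford by blast
qed

lemma clifford_closedin: "closedin T (clifford_part X f)"
proof -
  let ?C = "clifford_part X f"
  have CX: "x \<in> X" "x \<in> topspace T" if "x \<in> ?C" for x
    using that sub by (auto simp: clifford_part_def)
  have "y \<in> ?C" if y: "y \<in> T closure_of ?C" for y
  proof (rule ccontr)
    assume y': "y \<notin> ?C"
    have yT: "y \<in> topspace T" using y by (simp add: in_closure_of)
    have unit: "\<exists>e\<in>idems X f. x \<in> unit_group X f e" if "x \<in> ?C" for x
      using that clifford_unit_group by metis
    let ?P = "{p \<in> idems X f. p \<cdot> y \<notin> ?C}"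
    show False
    proof (cases "?P = {}")
      case True
      have "x \<cdot> y \<in> ?C" if x: "x \<in> ?C" for x
      proof -
        obtain e where e: "e \<in> idems X f" "x \<in> unit_group X f e" using unit x by blast
        then have "x \<cdot> y = x \<cdot> (e \<cdot> y)"
        proof -
          have eX: "e \<in> X" "e \<in> topspace T" using e idems_D sub by auto
          have "x \<cdot> e = x" using e CX x comm eX by (simp add: unit_group_def)
          then show ?thesis using Y.assoc[of x e y] CX x eX yT by simp
        qed
        moreover have "e \<cdot> y \<in> ?C" using True e by blast
        ultimately show ?thesis using clifford_closed x by simp
      qed
      then show False using closure_mult_clifford[of ?C y] y y' by blast
    next
      case False
      have "?P \<subseteq> idems X f" by blast
      then obtain p where p: "p \<in> ?P" "\<forall>q\<in>?P. q \<cdot> p = q \<longrightarrow> q = p"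
        using False minimal_idem by meson
      have pX: "p \<in> idems X f" "p \<in> X" "p \<in> topspace T" "p \<cdot> p = p" "p \<cdot> y \<notin> ?C"
        using p(1) sub idems_D by auto
      have pC: "p \<in> ?C" using pX by (auto simp: clifford_part_def pw_Suc intro!: exI[of _ 1])
      have cont: "continuous_map T T (\<lambda>x. p \<cdot> x)" using pX by (intro cont_mult) auto
      \<comment> \<open>These are the points of \<open>p C\<close> whose idempotent
        \<open>p \<cdot> e\<close> is strictly below \<open>p\<close>, so minimality of
        \<open>p\<close> gives \<open>(p \<cdot> e) \<cdot> y \<in> C\<close>. The group at
        \<open>p\<close> can be discarded, since it is closed and does not contain
        \<open>p \<cdot> y\<close>.\<close>
      let ?D = "(\<lambda>x. p \<cdot> x) ` ?C - unit_group X f p"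
      have "p \<cdot> y \<in> T closure_of ((\<lambda>x. p \<cdot> x) ` ?C)"
        using continuous_map_image_closure_subset[OF cont, of ?C] y by blast
      also have "(\<lambda>x. p \<cdot> x) ` ?C \<subseteq> unit_group X f p \<union> ?D" by blast
      then have "T closure_of ((\<lambda>x. p \<cdot> x) ` ?C) \<subseteq> T closure_of (unit_group X f p) \<union> T closure_of ?D"
        by (metis closure_of_mono closure_of_Un)
      finally have "p \<cdot> y \<in> T closure_of ?D"
        using group_closed[OF pX(1)] unit_group_clifford pX(5) by blast
      moreover have "?D \<subseteq> ?C" using clifford_closed pC by blast
      moreover have "x \<cdot> (p \<cdot> y) \<in> ?C" if x: "x \<in> ?D" for x
      proof -
        obtain c where c: "c \<in> ?C" "x = p \<cdot> c" using x by blast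
        have xC: "x \<in> ?C" using c pC clifford_closed by blast
        obtain e where e: "e \<in> idems X f" "c \<in> unit_group X f e" using unit c by blast
        have eX: "e \<in> X" "e \<in> topspace T" using e idems_D sub by auto
        have "p \<in> unit_group X f p" using pX by (auto simp: unit_group_def pw_idem)
        then have xe: "x \<in> unit_group X f (p \<cdot> e)" using unit_group_mult c e pX(1) by blast
        then have "p \<cdot> e \<noteq> p" using x by auto
        moreover have "(p \<cdot> e) \<cdot> p = p \<cdot> e" using pX eX by (metis assoc comm)
        moreover have "p \<cdot> e \<in> idems X f" using idems_closed pX e by blast
        ultimately have "(p \<cdot> e) \<cdot> y \<in> ?C" using p(2) by blast
        then have "x \<cdot> ((p \<cdot> e) \<cdot> y) \<in> ?C" using xC clifford_closed by blast
        moreover have "x \<cdot> ((p \<cdot> e) \<cdot> y) = x \<cdot> (p \<cdot> y)"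
        proof -
          have xp: "x \<cdot> (p \<cdot> e) = x" using xe CX[OF xC] comm pX eX by (simp add: unit_group_def)
          have "x \<cdot> p = x" using c CX[OF c(1)] pX by (metis assoc comm)
          then show ?thesis using xp yT CX[OF xC] pX eX
            by (metis Y.assoc Y.closed)
        qed
        ultimately show ?thesis by simp
      qed
      ultimately show False using closure_mult_clifford[of ?D "p \<cdot> y"] pX(5) by blast
    qed
  qed
  then have "T closure_of ?C \<subseteq> ?C" by blast
  then show ?thesis using closure_of_subset_eq CX by blast
qed

lemma closedin: "closedin T X"
proof -
  have "clifford_part X f \<subseteq> X" by (auto simp: clifford_part_def)
  then have "X = clifford_part X f \<union> (X - clifford_part X f)" by blast
  moreover have "closedin T (X - clifford_part X f)"
    using almost_clifford T1S sub by (auto simp: T1S_def t1_space_closedin_finite)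
  ultimately show ?thesis using clifford_closedin by (metis closedin_Un)
qed

end

section \<open>Quotients of tame semigroups\<close>

lemma tame_projectively_T1S_closed:
  assumes "tame_sgrp A f"
  shows "projectively_closed (T1S :: 'b topology \<Rightarrow> _ \<Rightarrow> bool) A f"
  unfolding projectively_closed_def C_closed_def
proof (intro allI impI, elim conjE)
  fix r and T :: "'b topology" and g h
  assume r: "congruence_on A f r" and T: "T1S T g"
    and emb: "embedding_map (discrete_topology (A // r)) T h"
    and hom: "\<forall>x\<in>A // r. \<forall>y\<in>A // r. h (quot_mult r f x y) = g (h x) (h y)"
  interpret A: tame_sgrp A f by fact
  have eq: "equiv A r" using r by (simp add: congruence_on_def)
  \<comment> \<open>Composed with the quotient map, the embedding exhibits the embedded quotient as
    a homomorphic image of \<open>A\<close> inside \<open>T\<close>.\<close>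
  define \<phi> where "\<phi> z = h (r `` {z})" for z
  have \<phi>_hom: "\<phi> (f a b) = g (\<phi> a) (\<phi> b)" if ab: "a \<in> A" "b \<in> A" for a b
  proof -
    \<comment> \<open>\<open>quot_mult\<close> multiplies representatives picked by
      \<open>SOME\<close>; the congruence absorbs the choice.\<close>
    define a' where "a' = (SOME x. x \<in> r `` {a})"
    define b' where "b' = (SOME x. x \<in> r `` {b})"
    have "a \<in> r `` {a}" "b \<in> r `` {b}" using eq ab equiv_class_self by fast+
    then have "a' \<in> r `` {a}" "b' \<in> r `` {b}"
      unfolding a'_def b'_def by (meson someI)+
    then have ar: "(a, a') \<in> r" "(b, b') \<in> r" by auto
    then have A': "a' \<in> A" "b' \<in> A" using eq equiv_type by blast+
    have "(f a b, f a' b) \<in> r" "(f a' b, f a' b') \<in> r"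
      using r ar A' ab by (auto simp: congruence_on_def)
    then have "(f a b, f a' b') \<in> r" using eq by (meson equivE transE)
    then have "r `` {f a' b'} = r `` {f a b}" using eq by (metis equiv_class_eq)
    then have "quot_mult r f (r `` {a}) (r `` {b}) = r `` {f a b}"
      by (simp add: quot_mult_def a'_def b'_def)
    moreover have "r `` {a} \<in> A // r" "r `` {b} \<in> A // r" using ab by (auto intro: quotientI)
    ultimately show ?thesis using hom by (metis \<phi>_def)
  qed
  have im: "\<phi> ` A = h ` (A // r)" by (auto simp: \<phi>_def quotient_def)
  interpret S: tame_sgrp "\<phi> ` A" g
    by (rule tame_sgrp_image[OF assms]) (rule \<phi>_hom)
  have emb': "homeomorphic_map (discrete_topology (A // r)) (subtopology T (h ` (A // r))) h"
    using emb by (simp add: embedding_map_def)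
  have sub: "h ` (A // r) \<subseteq> topspace T"
    using homeomorphic_imp_surjective_map[OF emb']
    unfolding topspace_discrete_topology topspace_subtopology by blast
  interpret S: tame_T1 "\<phi> ` A" g T
  proof unfold_locales
    show "\<exists>U. openin T U \<and> U \<inter> \<phi> ` A = {s}" if "s \<in> \<phi> ` A" for s
    proof -
      obtain x where x: "x \<in> A // r" "s = h x" using \<open>s \<in> \<phi> ` A\<close> im by blast
      have "openin (subtopology T (h ` (A // r))) (h ` {x})"
        using homeomorphic_imp_open_map[OF emb'] x
        unfolding open_map_def openin_discrete_topology by blast
      then show ?thesis using x im by (auto simp: openin_subtopology)
    qed
  qed (use T sub im in auto)
  show "closedin T (h ` (A // r))" using S.closedin im by simp
qed

section \<open>Extensions by filters\<close>

text \<open>Zorn's lemma for the reversed order. The infimum of a nonempty chain of proper filters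
  is proper, because what holds eventually for the infimum already does so for a member.\<close>

lemma ultrafilter_exists:
  fixes F0 :: "'a filter"
  assumes "F0 \<noteq> bot"
  obtains F where "F \<le> F0" "F \<noteq> bot" "\<And>P. eventually P F \<or> eventually (\<lambda>x. \<not> P x) F"
proof -
  let ?A = "{F. F \<noteq> bot \<and> F \<le> F0}"
  let ?R = "\<lambda>F G :: 'a filter. G \<le> F"
  have "\<exists>M\<in>?A. \<forall>G\<in>?A. ?R M G \<longrightarrow> G = M"
  proof (rule predicate_Zorn)
    show "partial_order_on ?A (relation_of ?R ?A)"
      by (rule partial_order_on_relation_ofI) auto
    show "\<exists>u\<in>?A. \<forall>a\<in>C. u \<le> a" if C: "C \<in> Chains (relation_of ?R ?A)" for C
    proof (cases "C = {}")
      case True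
      then show ?thesis using assms by auto
    next
      case False
      have C': "F \<in> ?A" "F \<le> G \<or> G \<le> F" if "F \<in> C" "G \<in> C" for F G
        using C that by (auto simp: Chains_def relation_of_def)
      have "\<not> eventually (\<lambda>_. False) (Inf C)"
      proof (subst eventually_Inf_base[OF False])
        show "\<exists>x\<in>C. x \<le> inf F G" if "F \<in> C" "G \<in> C" for F G
          using C'(2)[OF that] that by (metis inf.absorb1 inf.absorb2 order_refl)
        show "\<not> (\<exists>b\<in>C. eventually (\<lambda>_. False) b)"
          using C'(1) by (auto simp: trivial_limit_def)
      qed
      moreover have "Inf C \<le> F0" using C'(1) False by (metis (no_types, lifting) Inf_lower2 ex_in_conv mem_Collect_eq)
      ultimately show ?thesis by (intro bexI[of _ "Inf C"]) (auto simp: trivial_limit_def Inf_lower)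
    qed
  qed
  then obtain F where F: "F \<noteq> bot" "F \<le> F0"
    and max: "\<And>G. G \<noteq> bot \<Longrightarrow> G \<le> F \<Longrightarrow> G = F"
    by (smt (verit) mem_Collect_eq order_trans)
  have "eventually P F \<or> eventually (\<lambda>x. \<not> P x) F" for P
  proof (cases "inf F (principal {x. P x}) = bot")
    case True
    then have "eventually (\<lambda>_. False) (inf F (principal {x. P x}))" by simp
    then show ?thesis by (simp add: eventually_inf_principal)
  next
    case False
    then have "inf F (principal {x. P x}) = F" using max by simp
    then have "F \<le> principal {x. P x}" by (metis inf.cobounded2)
    then show ?thesis by (simp add: le_principal)
  qed
  then show ?thesis using that F by blast
qed

lemma filtermap_cong_eventually:
  assumes "eventually (\<lambda>u. f u = g u) F"
  shows "filtermap f F = filtermap g F"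
  unfolding filter_eq_iff eventually_filtermap
  by (intro allI eventually_subst) (use assms in eventually_elim, simp)

lemma filter_eq_principal_singleton:
  assumes "F \<noteq> bot" "eventually (\<lambda>x. x = s) F"
  shows "F = principal {s}"
  unfolding filter_eq_iff
proof
  fix P
  have "P s" if "eventually P F"
    using eventually_happens'[OF assms(1) eventually_conj[OF that assms(2)]] by auto
  moreover have "eventually P F" if "P s"
    using assms(2) that by (auto elim: eventually_mono)
  ultimately show "eventually P F = eventually P (principal {s})"
    by (auto simp: eventually_principal)
qed

text \<open>Decided sets are the traces on \<open>S\<close> of the clopen subsets forming a base of the extension.\<close>

definition decided :: "'s filter set \<Rightarrow> 's set \<Rightarrow> bool" where
  "decided \<Phi> W \<longleftrightarrow> (\<forall>F\<in>\<Phi>. eventually (\<lambda>x. x \<in> W) F \<or> eventually (\<lambda>x. x \<notin> W) F)"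

lemma decided_Int: "decided \<Phi> V \<Longrightarrow> decided \<Phi> W \<Longrightarrow> decided \<Phi> (V \<inter> W)"
  unfolding decided_def
proof
  fix F assume "\<forall>F\<in>\<Phi>. eventually (\<lambda>x. x \<in> V) F \<or> eventually (\<lambda>x. x \<notin> V) F"
    "\<forall>F\<in>\<Phi>. eventually (\<lambda>x. x \<in> W) F \<or> eventually (\<lambda>x. x \<notin> W) F" "F \<in> \<Phi>"
  then consider "eventually (\<lambda>x. x \<in> V) F" "eventually (\<lambda>x. x \<in> W) F"
    | "eventually (\<lambda>x. x \<notin> V) F" | "eventually (\<lambda>x. x \<notin> W) F" by blast
  then show "eventually (\<lambda>x. x \<in> V \<inter> W) F \<or> eventually (\<lambda>x. x \<notin> V \<inter> W) F"
  proof cases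
    case 1
    then have "eventually (\<lambda>x. x \<in> V \<inter> W) F" by eventually_elim simp
    then show ?thesis ..
  next
    case 2
    then have "eventually (\<lambda>x. x \<notin> V \<inter> W) F" by eventually_elim simp
    then show ?thesis ..
  next
    case 3
    then have "eventually (\<lambda>x. x \<notin> V \<inter> W) F" by eventually_elim simp
    then show ?thesis ..
  qed
qed

lemma decided_Compl: "decided \<Phi> W \<Longrightarrow> decided \<Phi> (- W)"
  unfolding decided_def by auto

text \<open>A point \<open>p\<close> of the extension is described by the filter
  \<open>\<phi> p\<close> that its neighbourhoods trace on \<open>S\<close>. \<open>products\<close>
  expresses joint continuity at \<open>(p, q)\<close>, \<open>point_decided\<close> makes the points
  of \<open>S\<close> isolated, and \<open>decided_base\<close> provides clopen neighbourhood bases.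
  The labelling \<open>\<phi>\<close> leaves the carrier type free.\<close>

locale filter_extension =
  fixes S :: "'s set" and m :: "'s \<Rightarrow> 's \<Rightarrow> 's" and Y :: "'y set" and \<phi> :: "'y \<Rightarrow> 's filter"
  assumes sg: "semigroup_on S m"
    and inj: "inj_on \<phi> Y"
    and ne: "p \<in> Y \<Longrightarrow> \<phi> p \<noteq> bot"
    and le_S: "p \<in> Y \<Longrightarrow> \<phi> p \<le> principal S"
    and points: "s \<in> S \<Longrightarrow> principal {s} \<in> \<phi> ` Y"
    and point_decided: "s \<in> S \<Longrightarrow> decided (\<phi> ` Y) {s}"
    and decided_base: "p \<in> Y \<Longrightarrow> eventually A (\<phi> p) \<Longrightarrow>
      \<exists>W. decided (\<phi> ` Y) W \<and> eventually (\<lambda>x. x \<in> W) (\<phi> p) \<and> (\<forall>x\<in>W. A x)"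
    and products: "p \<in> Y \<Longrightarrow> q \<in> Y \<Longrightarrow>
      \<exists>r\<in>Y. filtermap (\<lambda>(x, y). m x y) (\<phi> p \<times>\<^sub>F \<phi> q) \<le> \<phi> r"
begin

interpretation S: sgrp S m by unfold_locales (rule sg)

definition hat :: "'s set \<Rightarrow> 'y set" where
  "hat W = {p \<in> Y. eventually (\<lambda>x. x \<in> W) (\<phi> p)}"

abbreviation "dec \<equiv> decided (\<phi> ` Y)"

text \<open>Different filters disagree on some \<open>P\<close>. A decided set inside
  \<open>P\<close> that belongs to one filter cannot belong to the other, so its complement
  does.\<close>

lemma separated:
  assumes "p \<in> Y" "q \<in> Y" "p \<noteq> q"
  shows "\<exists>W. dec W \<and> eventually (\<lambda>x. x \<in> W) (\<phi> p) \<and> eventually (\<lambda>x. x \<notin> W) (\<phi> q)"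
proof -
  have sep: "\<exists>W. dec W \<and> eventually (\<lambda>x. x \<in> W) (\<phi> p) \<and> eventually (\<lambda>x. x \<notin> W) (\<phi> q)"
    if pq: "p \<in> Y" "q \<in> Y" "eventually P (\<phi> p)" "\<not> eventually P (\<phi> q)" for p q P
  proof -
    obtain W where W: "dec W" "eventually (\<lambda>x. x \<in> W) (\<phi> p)" "\<forall>x\<in>W. P x"
      using decided_base pq by blast
    then have "\<not> eventually (\<lambda>x. x \<in> W) (\<phi> q)" using pq(4) eventually_mono[of "\<lambda>x. x \<in> W" "\<phi> q" P] by blast
    then show ?thesis using W pq(2) unfolding decided_def by blast
  qed
  have "\<phi> p \<noteq> \<phi> q" using inj assms by (auto dest: inj_onD)
  then obtain P where "eventually P (\<phi> p) \<noteq> eventually P (\<phi> q)" by (auto simp: filter_eq_iff)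
  then consider "eventually P (\<phi> p)" "\<not> eventually P (\<phi> q)"
    | "eventually P (\<phi> q)" "\<not> eventually P (\<phi> p)" by blast
  then show ?thesis
  proof cases
    case 1
    then show ?thesis using sep assms by blast
  next
    case 2
    then obtain W where "dec W" "eventually (\<lambda>x. x \<in> W) (\<phi> q)" "eventually (\<lambda>x. x \<notin> W) (\<phi> p)"
      using sep assms by blast
    then show ?thesis using decided_Compl by (intro exI[of _ "- W"]) simp
  qed
qed

lemma hat_Compl: "dec W \<Longrightarrow> Y - hat W = hat (- W)"
proof -
  assume W: "dec W"
  have "\<not> (eventually (\<lambda>x. x \<in> W) (\<phi> p) \<and> eventually (\<lambda>x. x \<notin> W) (\<phi> p))" if "p \<in> Y" for p
    using ne[OF that] by (auto simp: trivial_limit_def simp flip: eventually_conj_iff)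
  then show ?thesis using W by (auto simp: hat_def decided_def)
qed

lemma hat_Int: "hat (V \<inter> W) = hat V \<inter> hat W"
  by (auto simp: hat_def eventually_conj_iff)

definition ext_topology :: "'y topology" where
  "ext_topology = topology (\<lambda>U. U \<subseteq> Y \<and> (\<forall>p\<in>U. \<exists>W. dec W \<and> p \<in> hat W \<and> hat W \<subseteq> U))"

lemma openin_ext_topology: "openin ext_topology U \<longleftrightarrow> U \<subseteq> Y \<and> (\<forall>p\<in>U. \<exists>W. dec W \<and> p \<in> hat W \<and> hat W \<subseteq> U)"
proof -
  have "istopology (\<lambda>U. U \<subseteq> Y \<and> (\<forall>p\<in>U. \<exists>W. dec W \<and> p \<in> hat W \<and> hat W \<subseteq> U))"
    unfolding istopology_def
  proof (intro conjI allI impI ballI; (elim conjE)?)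
    fix U V p
    assume "p \<in> U \<inter> V" and U: "U \<subseteq> Y" "\<forall>p\<in>U. \<exists>W. dec W \<and> p \<in> hat W \<and> hat W \<subseteq> U"
      and V: "V \<subseteq> Y" "\<forall>p\<in>V. \<exists>W. dec W \<and> p \<in> hat W \<and> hat W \<subseteq> V"
    then have "p \<in> U" "p \<in> V" by auto
    with U V obtain W W' where "dec W" "p \<in> hat W" "hat W \<subseteq> U" "dec W'" "p \<in> hat W'" "hat W' \<subseteq> V"
      by meson
    then show "\<exists>W. dec W \<and> p \<in> hat W \<and> hat W \<subseteq> U \<inter> V"
      using decided_Int hat_Int by (intro exI[of _ "W \<inter> W'"]) auto
  next
    fix K p
    assume K: "\<forall>U\<in>K. U \<subseteq> Y \<and> (\<forall>p\<in>U. \<exists>W. dec W \<and> p \<in> hat W \<and> hat W \<subseteq> U)" "p \<in> \<Union> K"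
    then obtain U where U: "U \<in> K" "p \<in> U" by blast
    then obtain W where "dec W" "p \<in> hat W" "hat W \<subseteq> U" using K(1) by meson
    then show "\<exists>W. dec W \<and> p \<in> hat W \<and> hat W \<subseteq> \<Union> K" using U by blast
  qed auto
  then show ?thesis unfolding ext_topology_def by (simp add: topology_inverse')
qed

lemma openin_hat: "dec W \<Longrightarrow> openin ext_topology (hat W)"
  unfolding openin_ext_topology by (auto simp: hat_def)

lemma topspace_ext_topology [simp]: "topspace ext_topology = Y"
proof -
  have "dec UNIV" "hat UNIV = Y" by (auto simp: decided_def hat_def)
  then have "openin ext_topology Y" using openin_hat by metis
  moreover have "topspace ext_topology \<subseteq> Y" using openin_ext_topology openin_topspace by blast
  ultimately show ?thesis using openin_subset by blast
qed

lemma closedin_hat: "dec W \<Longrightarrow> closedin ext_topology (hat W)"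
  using hat_Compl[of W] openin_hat[of "- W"] decided_Compl
  by (auto simp: closedin_def hat_def)

text \<open>There is only one candidate for \<open>SOME\<close>: the product filter is proper, so it
  cannot refine two filters that are separated by a decided set.\<close>

definition mul :: "'y \<Rightarrow> 'y \<Rightarrow> 'y" where
  "mul p q = (SOME r. r \<in> Y \<and> filtermap (\<lambda>(x, y). m x y) (\<phi> p \<times>\<^sub>F \<phi> q) \<le> \<phi> r)"

lemma mul:
  assumes "p \<in> Y" "q \<in> Y"
  shows "mul p q \<in> Y" "filtermap (\<lambda>(x, y). m x y) (\<phi> p \<times>\<^sub>F \<phi> q) \<le> \<phi> (mul p q)"
  unfolding mul_def using someI_ex[OF products[OF assms, unfolded Bex_def]] by blast+

lemma eventually_mul:
  assumes "p \<in> Y" "q \<in> Y" "eventually P (\<phi> (mul p q))"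
  obtains A B where "eventually A (\<phi> p)" "eventually B (\<phi> q)" "\<And>x y. A x \<Longrightarrow> B y \<Longrightarrow> P (m x y)"
proof -
  have "eventually P (filtermap (\<lambda>(x, y). m x y) (\<phi> p \<times>\<^sub>F \<phi> q))"
    by (rule filter_leD[OF mul(2)[OF assms(1,2)] assms(3)])
  then obtain A B where "eventually A (\<phi> p)" "eventually B (\<phi> q)"
    "\<forall>x y. A x \<longrightarrow> B y \<longrightarrow> P (case (x, y) of (x, y) \<Rightarrow> m x y)"
    unfolding eventually_filtermap eventually_prod_filter by blast
  then show ?thesis using that by simp
qed

lemma eventually_meet:
  assumes "p \<in> Y" "eventually A (\<phi> p)" "eventually B (\<phi> p)"
  obtains x where "A x" "B x" "x \<in> S"
proof -
  have "eventually (\<lambda>x. x \<in> S) (\<phi> p)" using le_S[OF assms(1)] by (simp add: le_principal)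
  then have "eventually (\<lambda>x. A x \<and> B x \<and> x \<in> S) (\<phi> p)" using assms(2,3) by eventually_elim simp
  then show ?thesis using eventually_happens' ne assms(1) that by blast
qed

text \<open>Two different values would be separated by a set \<open>W\<close>; unfolding both
  products then yields three points of \<open>S\<close> that violate associativity in
  \<open>S\<close>.\<close>

lemma mul_assoc:
  assumes "p \<in> Y" "q \<in> Y" "r \<in> Y"
  shows "mul (mul p q) r = mul p (mul q r)"
proof (rule ccontr)
  assume "\<not> ?thesis"
  then obtain W where W: "eventually (\<lambda>x. x \<in> W) (\<phi> (mul (mul p q) r))"
    "eventually (\<lambda>x. x \<notin> W) (\<phi> (mul p (mul q r)))"
    using separated[of "mul (mul p q) r" "mul p (mul q r)"] mul(1) assms by auto
  obtain A B where A: "eventually A (\<phi> (mul p q))" "eventually B (\<phi> r)"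
    "\<And>x y. A x \<Longrightarrow> B y \<Longrightarrow> m x y \<in> W"
    using eventually_mul[OF _ _ W(1)] mul(1) assms by blast
  obtain A1 A2 where A': "eventually A1 (\<phi> p)" "eventually A2 (\<phi> q)"
    "\<And>x y. A1 x \<Longrightarrow> A2 y \<Longrightarrow> A (m x y)"
    using eventually_mul[OF _ _ A(1)] assms by blast
  obtain C D where C: "eventually C (\<phi> p)" "eventually D (\<phi> (mul q r))"
    "\<And>x y. C x \<Longrightarrow> D y \<Longrightarrow> m x y \<notin> W"
    using eventually_mul[OF _ _ W(2)] mul(1) assms by blast
  obtain C1 C2 where C': "eventually C1 (\<phi> q)" "eventually C2 (\<phi> r)"
    "\<And>x y. C1 x \<Longrightarrow> C2 y \<Longrightarrow> D (m x y)"
    using eventually_mul[OF _ _ C(2)] assms by blast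
  obtain x where x: "A1 x" "C x" "x \<in> S" using eventually_meet[OF assms(1) A'(1) C(1)] by blast
  obtain y where y: "A2 y" "C1 y" "y \<in> S" using eventually_meet[OF assms(2) A'(2) C'(1)] by blast
  obtain z where z: "B z" "C2 z" "z \<in> S" using eventually_meet[OF assms(3) A(2) C'(2)] by blast
  have "m (m x y) z \<in> W" "m x (m y z) \<notin> W" using A A' C C' x y z by auto
  then show False using S.assoc x y z by simp
qed

lemma continuous_mul:
  "continuous_map (prod_topology ext_topology ext_topology) ext_topology (\<lambda>p. mul (fst p) (snd p))"
  unfolding continuous_map_def
proof (intro conjI allI impI)
  show "(\<lambda>p. mul (fst p) (snd p)) \<in> topspace (prod_topology ext_topology ext_topology) \<rightarrow> topspace ext_topology"
    using mul(1) by auto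
  fix U assume U: "openin ext_topology U"
  show "openin (prod_topology ext_topology ext_topology) {p \<in> topspace (prod_topology ext_topology ext_topology). mul (fst p) (snd p) \<in> U}"
    unfolding openin_prod_topology_alt
  proof (intro allI impI)
    fix p q assume "(p, q) \<in> {p \<in> topspace (prod_topology ext_topology ext_topology). mul (fst p) (snd p) \<in> U}"
    then have pq: "p \<in> Y" "q \<in> Y" "mul p q \<in> U" by auto
    obtain W where W: "dec W" "mul p q \<in> hat W" "hat W \<subseteq> U" using U pq openin_ext_topology by meson
    obtain A B where AB: "eventually A (\<phi> p)" "eventually B (\<phi> q)"
      "\<And>x y. A x \<Longrightarrow> B y \<Longrightarrow> m x y \<in> W"
      using eventually_mul[OF pq(1,2)] W(2) unfolding hat_def by blast
    obtain V where V: "dec V" "p \<in> hat V" "\<forall>x\<in>V. A x"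
      using decided_base[OF pq(1) AB(1)] pq by (auto simp: hat_def)
    obtain V' where V': "dec V'" "q \<in> hat V'" "\<forall>x\<in>V'. B x"
      using decided_base[OF pq(2) AB(2)] pq by (auto simp: hat_def)
    \<comment> \<open>Since \<open>W\<close> is decided, a product outside \<open>hat W\<close> lies
      in \<open>hat (- W)\<close>; points of \<open>V\<close> and \<open>V'\<close> in
      \<open>S\<close> would then have a product both in and outside \<open>W\<close>.\<close>
    have "mul p' q' \<in> hat W" if p': "p' \<in> hat V" "q' \<in> hat V'" for p' q'
    proof (rule ccontr)
      assume "mul p' q' \<notin> hat W"
      have Y: "p' \<in> Y" "q' \<in> Y" using p' by (auto simp: hat_def)
      then have "mul p' q' \<in> hat (- W)"
        using hat_Compl[OF W(1)] \<open>mul p' q' \<notin> hat W\<close> mul(1) by blast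
      then have "eventually (\<lambda>x. x \<notin> W) (\<phi> (mul p' q'))" by (simp add: hat_def)
      then obtain C D where CD: "eventually C (\<phi> p')" "eventually D (\<phi> q')"
        "\<And>x y. C x \<Longrightarrow> D y \<Longrightarrow> m x y \<notin> W"
        using eventually_mul[OF Y] by blast
      obtain x where x: "x \<in> V" "C x" using eventually_meet[OF Y(1) _ CD(1)] p' by (auto simp: hat_def)
      obtain y where y: "y \<in> V'" "D y" using eventually_meet[OF Y(2) _ CD(2)] p' by (auto simp: hat_def)
      show False using AB(3)[of x y] CD(3)[of x y] x y V(3) V'(3) by blast
    qed
    then have "hat V \<times> hat V' \<subseteq> {p \<in> topspace (prod_topology ext_topology ext_topology). mul (fst p) (snd p) \<in> U}"
      using W(3) by (auto simp: hat_def)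
    then show "\<exists>U' V'. openin ext_topology U' \<and> openin ext_topology V' \<and> p \<in> U' \<and> q \<in> V' \<and>
      U' \<times> V' \<subseteq> {p \<in> topspace (prod_topology ext_topology ext_topology). mul (fst p) (snd p) \<in> U}"
      using V V' openin_hat by meson
  qed
qed

lemma zero_dimensional_ext_topology: "zero_dimensional ext_topology"
  unfolding zero_dimensional_def
proof (intro allI impI, elim conjE)
  fix U p assume "openin ext_topology U" "p \<in> U"
  then obtain W where "dec W" "p \<in> hat W" "hat W \<subseteq> U" using openin_ext_topology by meson
  then show "\<exists>V. openin ext_topology V \<and> closedin ext_topology V \<and> p \<in> V \<and> V \<subseteq> U"
    using openin_hat closedin_hat by blast
qed

lemma TzS_ext_topology: "TzS ext_topology mul"
  unfolding TzS_def
proof (intro conjI)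
  show "topsemigroup ext_topology mul"
    unfolding topsemigroup_def
    using continuous_mul by (auto simp: semigroup_on_def mul(1) mul_assoc)
  show "t1_space ext_topology"
    unfolding t1_space_def
  proof (intro ballI impI)
    fix p q assume pq: "p \<in> topspace ext_topology" "q \<in> topspace ext_topology" "p \<noteq> q"
    then obtain W where W: "dec W" "eventually (\<lambda>x. x \<in> W) (\<phi> p)" "eventually (\<lambda>x. x \<notin> W) (\<phi> q)"
      using separated by auto
    then have "p \<in> hat W" "q \<in> hat (- W)" using pq by (auto simp: hat_def)
    then show "\<exists>U. openin ext_topology U \<and> p \<in> U \<and> q \<notin> U"
      using openin_hat[OF W(1)] hat_Compl[OF W(1)] by blast
  qed
  show "zero_dimensional ext_topology" by (rule zero_dimensional_ext_topology)
  show "completely_regular_space ext_topology"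
    unfolding completely_regular_space_def
  proof (intro allI impI, elim conjE)
    fix K p assume K: "closedin ext_topology K" "p \<in> topspace ext_topology - K"
    then have "openin ext_topology (topspace ext_topology - K)" by blast
    then obtain V where V: "openin ext_topology V" "closedin ext_topology V" "p \<in> V" "V \<subseteq> topspace ext_topology - K"
      using K(2) zero_dimensional_ext_topology unfolding zero_dimensional_def by meson
    let ?h = "\<lambda>x. if x \<in> V then 0 else 1 :: real"
    have "continuous_map ext_topology (top_of_set {0..1}) ?h"
      unfolding continuous_map_def
    proof (intro conjI allI impI)
      fix U :: "real set"
      have eq: "{x \<in> topspace ext_topology. ?h x \<in> U} =
        (if 0 \<in> U then V else {}) \<union> (if 1 \<in> U then topspace ext_topology - V else {})"
        using openin_subset[OF V(1)] by auto
      have "openin ext_topology (topspace ext_topology - V)" using V(2) by blast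
      then show "openin ext_topology {x \<in> topspace ext_topology. ?h x \<in> U}"
        unfolding eq using V(1) by (intro openin_Un) simp_all
    qed auto
    then show "\<exists>h. continuous_map ext_topology (top_of_set {0..1::real}) h \<and> h p = 0 \<and> h ` K \<subseteq> {1}"
      using V by (intro exI[of _ ?h]) auto
  qed
qed

text \<open>Every nonempty \<open>hat W\<close> meets the copy of \<open>S\<close>, so this copy is
  dense. Being closed as well, it leaves no room for new points.\<close>

theorem all_principal:
  assumes "C_closed (TzS :: 'y topology \<Rightarrow> _ \<Rightarrow> bool) S m" "p \<in> Y"
  shows "\<exists>s\<in>S. \<phi> p = principal {s}"
proof -
  have "\<exists>h. \<forall>s\<in>S. h s \<in> Y \<and> \<phi> (h s) = principal {s}"
    using points by (intro bchoice) (metis imageE)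
  then obtain h where h: "\<And>s. s \<in> S \<Longrightarrow> h s \<in> Y" "\<And>s. s \<in> S \<Longrightarrow> \<phi> (h s) = principal {s}" by blast
  have hat_s: "hat {s} = {h s}" if "s \<in> S" for s
  proof -
    have "q = h s" if "q \<in> hat {s}" for q
    proof -
      have "q \<in> Y" "\<phi> q = principal {s}"
        using that ne filter_eq_principal_singleton[of "\<phi> q" s] by (auto simp: hat_def)
      then show ?thesis using h \<open>s \<in> S\<close> inj by (metis inj_onD)
    qed
    moreover have "h s \<in> hat {s}" using h that by (simp add: hat_def eventually_principal)
    ultimately show ?thesis by blast
  qed
  have "openin ext_topology (h ` V)" if "V \<subseteq> S" for V
  proof -
    have "h ` V = (\<Union>s\<in>V. hat {s})" using hat_s that by auto
    moreover have "openin ext_topology (\<Union>s\<in>V. hat {s})"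
      using openin_hat point_decided that by (intro openin_Union) blast
    ultimately show ?thesis by simp
  qed
  moreover have "inj_on h S"
  proof (rule inj_onI)
    fix s t assume "s \<in> S" "t \<in> S" "h s = h t"
    then have "principal {s} = principal {t}" using h(2) by metis
    moreover have "eventually (\<lambda>x. x = s) (principal {s})" by (simp add: eventually_principal)
    ultimately have "eventually (\<lambda>x. x = s) (principal {t})" by (simp only:)
    then show "s = t" by (simp add: eventually_principal)
  qed
  ultimately have "embedding_map (discrete_topology S) ext_topology h"
    using h by (intro injective_open_imp_embedding_map) (auto simp: open_map_def)
  moreover have "h (m s t) = mul (h s) (h t)" if st: "s \<in> S" "t \<in> S" for s t
  proof (rule ccontr)
    assume "h (m s t) \<noteq> mul (h s) (h t)"
    then obtain W where W: "eventually (\<lambda>x. x \<in> W) (\<phi> (h (m s t)))"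
      "eventually (\<lambda>x. x \<notin> W) (\<phi> (mul (h s) (h t)))"
      using separated[of "h (m s t)" "mul (h s) (h t)"] h st mul(1) by auto
    obtain A B where "eventually A (\<phi> (h s))" "eventually B (\<phi> (h t))"
      "\<And>x y. A x \<Longrightarrow> B y \<Longrightarrow> m x y \<notin> W"
      using eventually_mul[OF _ _ W(2)] h st by blast
    then show False using W(1) h st by (simp add: eventually_principal)
  qed
  ultimately have "closedin ext_topology (h ` S)"
    using assms(1) TzS_ext_topology unfolding C_closed_def by blast
  have "p \<in> h ` S"
  proof (rule ccontr)
    assume "p \<notin> h ` S"
    moreover have "openin ext_topology (Y - h ` S)" using \<open>closedin ext_topology (h ` S)\<close> by (metis closedin_def topspace_ext_topology)
    ultimately obtain W where W: "p \<in> hat W" "hat W \<subseteq> Y - h ` S"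
      using assms(2) openin_ext_topology by (metis DiffI)
    obtain s where "s \<in> S" "s \<in> W"
      using eventually_meet[OF assms(2), of "\<lambda>x. x \<in> W" "\<lambda>x. x \<in> W"] W(1) by (auto simp: hat_def)
    then have "h s \<in> hat W" using h by (simp add: hat_def eventually_principal)
    then show False using W \<open>s \<in> S\<close> by blast
  qed
  then show ?thesis using h by blast
qed

end

text \<open>Left translation by an element of the semigroup with an adjoined unit \<open>None\<close>.\<close>

fun act :: "('s \<Rightarrow> 's \<Rightarrow> 's) \<Rightarrow> 's option \<Rightarrow> 's \<Rightarrow> 's" where
  "act m None u = u"
| "act m (Some x) u = m x u"

text \<open>\<open>F\<close> is adjoined together with all its translates \<open>k F\<close>.
  Centrality gives \<open>(k F)(l F) = (k l)(F F)\<close>, so the single hypothesis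
  \<open>square\<close> settles all products of new points; closedness then forces \<open>F\<close>
  to be an old point.\<close>

lemma central_filter_principal:
  fixes S :: "'s set" and F :: "'s filter"
  defines "K \<equiv> insert None (Some ` S)"
  assumes sg: "semigroup_on S m"
    and closed: "C_closed (TzS :: 's option list topology \<Rightarrow> _ \<Rightarrow> bool) S m"
    and "F \<noteq> bot" and central: "F \<le> principal (center S m)"
    and point: "\<And>k s. k \<in> K \<Longrightarrow> s \<in> S \<Longrightarrow>
      eventually (\<lambda>u. act m k u = s) F \<or> eventually (\<lambda>u. act m k u \<noteq> s) F"
    and base: "\<And>k P. k \<in> K \<Longrightarrow> eventually (\<lambda>u. P (act m k u)) F \<Longrightarrow>
      \<exists>W. eventually (\<lambda>u. act m k u \<in> W) F \<and> (\<forall>x\<in>W. P x) \<and>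
        (\<forall>l\<in>K. eventually (\<lambda>u. act m l u \<in> W) F \<or> eventually (\<lambda>u. act m l u \<notin> W) F)"
    and square: "filtermap (\<lambda>(u, v). m u v) (F \<times>\<^sub>F F) \<le> F \<or>
      (\<exists>b\<in>S. filtermap (\<lambda>(u, v). m u v) (F \<times>\<^sub>F F) \<le> principal {b})"
  shows "\<exists>s\<in>S. F = principal {s}"
proof -
  interpret S: sgrp S m by unfold_locales (rule sg)
  define G where "G k = filtermap (act m k) F" for k
  define \<Phi> where "\<Phi> = (\<lambda>s. principal {s}) ` S \<union> G ` K"
  \<comment> \<open>The code \<open>[Some s]\<close> names a point of \<open>S\<close> and
    \<open>[None, k]\<close> a translate; the remaining values are irrelevant. Different codes may
    name the same filter, so \<open>Y\<close> will keep one code for each.\<close>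
  define lab :: "'s option list \<Rightarrow> 's filter" where
    "lab xs = (case xs of [] \<Rightarrow> bot | k # ks \<Rightarrow> (case ks of [] \<Rightarrow> principal {the k} | l # _ \<Rightarrow> G l))" for xs
  have "\<Phi> \<subseteq> range lab"
  proof -
    have "principal {s} = lab [Some s]" "G k = lab [None, k]" for s k by (simp_all add: lab_def)
    then show ?thesis unfolding \<Phi>_def by blast
  qed
  then obtain Y where Y: "inj_on lab Y" "lab ` Y = \<Phi>"
    using subset_image_inj[of \<Phi> lab UNIV] by auto
  have cen: "eventually (\<lambda>u. u \<in> center S m) F" using central by (simp add: le_principal)
  have cenD: "u \<in> S" "\<And>x. x \<in> S \<Longrightarrow> m u x = m x u" if "u \<in> center S m" for u
    using that by (auto simp: center_def)
  have evG: "eventually P (G k) \<longleftrightarrow> eventually (\<lambda>u. P (act m k u)) F" for P k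
    by (simp add: G_def eventually_filtermap)
  have act_S: "act m k u \<in> S" if "k \<in> K" "u \<in> S" for k u
    using that by (auto simp: K_def)
  have dec_single: "decided \<Phi> {s}" if "s \<in> S" for s
  proof -
    have "\<forall>k\<in>K. eventually (\<lambda>u. act m k u = s) F \<or> eventually (\<lambda>u. act m k u \<noteq> s) F"
      using point that by blast
    then show ?thesis by (auto simp: decided_def \<Phi>_def evG eventually_principal)
  qed
  have prods: "\<exists>H\<in>\<Phi>. filtermap (\<lambda>(x, y). m x y) (A \<times>\<^sub>F B) \<le> H" if AB: "A \<in> \<Phi>" "B \<in> \<Phi>" for A B
  proof -
    have "(\<exists>s\<in>S. A = principal {s}) \<or> (\<exists>k\<in>K. A = G k)"
      "(\<exists>s\<in>S. B = principal {s}) \<or> (\<exists>k\<in>K. B = G k)"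
      using AB unfolding \<Phi>_def by blast+
    then show ?thesis
    proof (elim disjE bexE)
      fix s t assume 1: "s \<in> S" "t \<in> S" "A = principal {s}" "B = principal {t}"
      have "filtermap (\<lambda>(x, y). m x y) (A \<times>\<^sub>F B) = principal {m s t}"
        using 1 by (simp add: prod_filter_principal_singleton filtermap_filtermap)
      then show ?thesis using 1 by (intro bexI[of _ "principal {m s t}"]) (auto simp: \<Phi>_def)
    next
      fix s k assume 2: "s \<in> S" "k \<in> K" "A = principal {s}" "B = G k"
      define l where "l = (case k of None \<Rightarrow> Some s | Some x \<Rightarrow> Some (m s x))"
      have "filtermap (\<lambda>(x, y). m x y) (A \<times>\<^sub>F B) = filtermap (\<lambda>u. m s (act m k u)) F"
        using 2 by (simp add: prod_filter_principal_singleton filtermap_filtermap G_def)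
      also have "\<dots> = G l"
        unfolding G_def
        by (rule filtermap_cong_eventually, rule eventually_mono[OF cen])
           (use 2 cenD in \<open>auto simp: l_def K_def S.assoc split: option.split\<close>)
      finally show ?thesis using 2 by (intro bexI[of _ "G l"]) (auto simp: \<Phi>_def l_def K_def)
    next
      fix s k assume 3: "s \<in> S" "k \<in> K" "A = G k" "B = principal {s}"
      define l where "l = (case k of None \<Rightarrow> Some s | Some x \<Rightarrow> Some (m x s))"
      have "filtermap (\<lambda>(x, y). m x y) (A \<times>\<^sub>F B) = filtermap (\<lambda>u. m (act m k u) s) F"
        using 3 by (simp add: prod_filter_principal_singleton2 filtermap_filtermap G_def)
      also have "\<dots> = G l"
        unfolding G_def
      proof (rule filtermap_cong_eventually, rule eventually_mono[OF cen])
        fix u assume u: "u \<in> center S m"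
        show "m (act m k u) s = act m l u"
          using 3(1,2) cenD(1)[OF u] cenD(2)[OF u 3(1)]
          by (cases k) (auto simp: l_def K_def S.assoc)
      qed
      finally show ?thesis using 3 by (intro bexI[of _ "G l"]) (auto simp: \<Phi>_def l_def K_def)
    next
      fix k l assume 4: "k \<in> K" "l \<in> K" "A = G k" "B = G l"
      \<comment> \<open>The product of \<open>k\<close> and \<open>l\<close> in the semigroup with
        the adjoined unit \<open>None\<close>.\<close>
      define h where "h = (case k of None \<Rightarrow> l | Some x \<Rightarrow> (case l of None \<Rightarrow> k | Some y \<Rightarrow> Some (m x y)))"
      have hK: "h \<in> K" using 4 by (auto simp: h_def K_def split: option.split)
      have eq: "m (act m k u) (act m l v) = act m h (m u v)"
        if uv: "u \<in> center S m" "v \<in> center S m" for u v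
      proof (cases k)
        case None
        have "m u (m y v) = m y (m u v)" if "y \<in> S" for y
          using S.assoc[of u y v] S.assoc[of y u v] cenD(1)[OF uv(1)] cenD(2)[OF uv(1) that]
            cenD(1)[OF uv(2)] that by simp
        then show ?thesis using None 4 by (cases l) (auto simp: h_def K_def)
      next
        case (Some x)
        then have x: "x \<in> S" using 4 by (auto simp: K_def)
        show ?thesis
        proof (cases l)
          case None
          then show ?thesis
            using Some x cenD(1)[OF uv(1)] cenD(1)[OF uv(2)] by (simp add: h_def S.assoc)
        next
          case (Some y)
          then have y: "y \<in> S" using 4 by (auto simp: K_def)
          have "m (m x u) (m y v) = m x (m (m u y) v)"
            using x y cenD(1)[OF uv(1)] cenD(1)[OF uv(2)] by (simp add: S.assoc)
          also have "\<dots> = m (m x y) (m u v)"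
            using x y cenD(1)[OF uv(1)] cenD(2)[OF uv(1) y] cenD(1)[OF uv(2)] by (simp add: S.assoc)
          finally show ?thesis using \<open>k = Some x\<close> Some by (simp add: h_def)
        qed
      qed
      have "filtermap (\<lambda>(x, y). m x y) (A \<times>\<^sub>F B) =
          filtermap (\<lambda>(u, v). m (act m k u) (act m l v)) (F \<times>\<^sub>F F)"
        using 4 by (simp add: G_def prod_filtermap1 prod_filtermap2 filtermap_filtermap case_prod_unfold)
      also have "\<dots> = filtermap (\<lambda>(u, v). act m h (m u v)) (F \<times>\<^sub>F F)"
      proof (rule filtermap_cong_eventually)
        show "\<forall>\<^sub>F p in F \<times>\<^sub>F F. (case p of (u, v) \<Rightarrow> m (act m k u) (act m l v)) =
            (case p of (u, v) \<Rightarrow> act m h (m u v))"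
          unfolding eventually_prod_filter using cen eq by auto
      qed
      also have "\<dots> = filtermap (act m h) (filtermap (\<lambda>(u, v). m u v) (F \<times>\<^sub>F F))"
        by (simp add: filtermap_filtermap case_prod_unfold)
      finally have eqF: "filtermap (\<lambda>(x, y). m x y) (A \<times>\<^sub>F B) =
          filtermap (act m h) (filtermap (\<lambda>(u, v). m u v) (F \<times>\<^sub>F F))" .
      from square show ?thesis
      proof
        assume "filtermap (\<lambda>(u, v). m u v) (F \<times>\<^sub>F F) \<le> F"
        then have "filtermap (\<lambda>(x, y). m x y) (A \<times>\<^sub>F B) \<le> G h"
          unfolding eqF G_def by (rule filtermap_mono)
        then show ?thesis using hK by (auto simp: \<Phi>_def)
      next
        assume "\<exists>b\<in>S. filtermap (\<lambda>(u, v). m u v) (F \<times>\<^sub>F F) \<le> principal {b}"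
        then obtain b where b: "b \<in> S" "filtermap (\<lambda>(u, v). m u v) (F \<times>\<^sub>F F) \<le> principal {b}" by blast
        have "filtermap (\<lambda>(x, y). m x y) (A \<times>\<^sub>F B) \<le> filtermap (act m h) (principal {b})"
          unfolding eqF using b(2) by (rule filtermap_mono)
        then have "filtermap (\<lambda>(x, y). m x y) (A \<times>\<^sub>F B) \<le> principal {act m h b}" by simp
        then show ?thesis using act_S[OF hK b(1)] by (auto simp: \<Phi>_def)
      qed
    qed
  qed
  interpret filter_extension S m Y lab
  proof
    have inY: "lab p \<in> \<Phi>" if "p \<in> Y" for p using Y that by blast
    show "semigroup_on S m" "inj_on lab Y" by fact+
    show "lab p \<noteq> bot" if "p \<in> Y" for p
      using inY[OF that] \<open>F \<noteq> bot\<close> by (auto simp: \<Phi>_def G_def filtermap_bot_iff principal_eq_bot_iff)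
    show "lab p \<le> principal S" if "p \<in> Y" for p
    proof -
      have "G k \<le> principal S" if "k \<in> K" for k
        unfolding le_principal evG
        by (rule eventually_mono[OF cen]) (use act_S cenD that in auto)
      then show ?thesis using inY[OF that] by (auto simp: \<Phi>_def)
    qed
    show "principal {s} \<in> lab ` Y" if "s \<in> S" for s
      using that unfolding Y(2) by (simp add: \<Phi>_def)
    show "decided (lab ` Y) {s}" if "s \<in> S" for s
      using dec_single that unfolding Y(2) .
    show "\<exists>r\<in>Y. filtermap (\<lambda>(x, y). m x y) (lab p \<times>\<^sub>F lab q) \<le> lab r" if "p \<in> Y" "q \<in> Y" for p q
      using prods[OF inY[OF that(1)] inY[OF that(2)]] unfolding Y(2)[symmetric] by blast
    show "\<exists>W. decided (lab ` Y) W \<and> eventually (\<lambda>x. x \<in> W) (lab p) \<and> (\<forall>x\<in>W. A x)"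
      if pA: "p \<in> Y" "eventually A (lab p)" for p A
    proof -
      have "(\<exists>s\<in>S. lab p = principal {s}) \<or> (\<exists>k\<in>K. lab p = G k)"
        using inY[OF pA(1)] unfolding \<Phi>_def by blast
      then show ?thesis
      proof (elim disjE bexE)
        fix s assume s: "s \<in> S" "lab p = principal {s}"
        then show ?thesis
          using dec_single[OF s(1)] pA(2) unfolding Y(2)
          by (intro exI[of _ "{s}"]) (simp add: eventually_principal)
      next
        fix k assume k: "k \<in> K" "lab p = G k"
        then obtain W where W: "eventually (\<lambda>u. act m k u \<in> W) F" "\<forall>x\<in>W. A x"
          "\<forall>l\<in>K. eventually (\<lambda>u. act m l u \<in> W) F \<or> eventually (\<lambda>u. act m l u \<notin> W) F"
          using base[OF k(1), of A] pA(2) evG by auto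
        then have "decided \<Phi> W"
          by (auto simp: decided_def \<Phi>_def evG eventually_principal)
        then show ?thesis using k W unfolding Y(2) by (intro exI[of _ W]) (simp add: evG)
      qed
    qed
  qed
  have "act m None = (\<lambda>u. u)" by (rule ext) simp
  then have "G None = F" unfolding G_def by (simp only: filtermap_ident)
  then have "F \<in> \<Phi>" unfolding \<Phi>_def K_def by blast
  then obtain p where "p \<in> Y" "lab p = F" using Y(2) by blast
  then show ?thesis using all_principal[OF closed] by metis
qed

text \<open>A free ultrafilter \<open>F\<close> on an infinite \<open>E\<close> decides every set,
  which leaves only its square: on a chain each product is one of its factors, so the square refines
  \<open>F\<close>; in the other case it is concentrated at \<open>b\<close>.\<close>

lemma central_set_finite:
  fixes S :: "'s set"
  assumes sg: "semigroup_on S m"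
    and closed: "C_closed (TzS :: 's option list topology \<Rightarrow> _ \<Rightarrow> bool) S m"
    and E: "E \<subseteq> center S m"
    and mult: "(\<forall>u\<in>E. \<forall>v\<in>E. m u v \<in> {u, v}) \<or> (\<exists>b\<in>S. \<forall>u\<in>E. \<forall>v\<in>E. m u v = b)"
  shows "finite E"
proof (rule ccontr)
  assume inf: "infinite E"
  have "inf cofinite (principal E) \<noteq> bot"
    using inf by (auto simp: trivial_limit_def eventually_inf_principal eventually_cofinite)
  then obtain F where F: "F \<le> inf cofinite (principal E)" "F \<noteq> bot"
    "\<And>P. eventually P F \<or> eventually (\<lambda>x. \<not> P x) F"
    by (rule ultrafilter_exists) blast
  have evE: "eventually (\<lambda>x. x \<in> E) F" using F(1) by (simp add: le_principal)
  have ev: "\<forall>\<^sub>F p in F \<times>\<^sub>F F. P p" if "eventually Q F" "\<And>u v. Q u \<Longrightarrow> Q v \<Longrightarrow> P (u, v)" for P Q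
    using that unfolding eventually_prod_filter by blast
  have "\<exists>s\<in>S. F = principal {s}"
  proof (rule central_filter_principal[OF sg closed F(2)])
    show "F \<le> principal (center S m)"
      unfolding le_principal by (rule eventually_mono[OF evE]) (use E in auto)
    show "filtermap (\<lambda>(u, v). m u v) (F \<times>\<^sub>F F) \<le> F \<or>
      (\<exists>b\<in>S. filtermap (\<lambda>(u, v). m u v) (F \<times>\<^sub>F F) \<le> principal {b})"
      using mult
    proof
      assume m: "\<forall>u\<in>E. \<forall>v\<in>E. m u v \<in> {u, v}"
      have "filtermap (\<lambda>(u, v). m u v) (F \<times>\<^sub>F F) \<le> F"
      proof (rule filter_leI)
        fix P assume "eventually P F"
        then have "eventually (\<lambda>u. P u \<and> u \<in> E) F" using evE by eventually_elim simp
        then show "eventually P (filtermap (\<lambda>(u, v). m u v) (F \<times>\<^sub>F F))"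
          unfolding eventually_filtermap by (rule ev) (use m in fastforce)
      qed
      then show ?thesis ..
    next
      assume "\<exists>b\<in>S. \<forall>u\<in>E. \<forall>v\<in>E. m u v = b"
      then obtain b where b: "b \<in> S" "\<forall>u\<in>E. \<forall>v\<in>E. m u v = b" by blast
      have "filtermap (\<lambda>(u, v). m u v) (F \<times>\<^sub>F F) \<le> principal {b}"
        unfolding le_principal eventually_filtermap using b(2) by (intro ev[OF evE]) simp
      then show ?thesis using b(1) by blast
    qed
    show "\<exists>W. eventually (\<lambda>u. act m k u \<in> W) F \<and> (\<forall>x\<in>W. P x) \<and>
        (\<forall>l\<in>insert None (Some ` S).
          eventually (\<lambda>u. act m l u \<in> W) F \<or> eventually (\<lambda>u. act m l u \<notin> W) F)"
      if "eventually (\<lambda>u. P (act m k u)) F" for k P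
      using that F(3) by (intro exI[of _ "Collect P"]) auto
  qed (rule F(3))
  then obtain s where "F = principal {s}" by blast
  moreover have "eventually (\<lambda>x. x \<noteq> s) F"
    using F(1) filter_leD[of F cofinite] by (simp add: eventually_cofinite)
  ultimately show False by (simp add: eventually_principal)
qed

section \<open>Rees quotients\<close>

context sgrp
begin

lemma rees_mult_None [simp]: "rees_mult I f a None = None"
  by (cases a) simp_all

lemma rees_semigroup:
  assumes I: "ideal_of X f I"
  shows "semigroup_on (rees_carrier X I) (rees_mult I f)"
proof -
  have I1: "x \<cdot> y \<in> I" if "x \<in> I" "y \<in> X" for x y using I that by (simp add: ideal_of_def)
  have I2: "x \<cdot> y \<in> I" if "x \<in> X" "y \<in> I" for x y using I that by (simp add: ideal_of_def)
  have mem: "None \<in> rees_carrier X I \<longleftrightarrow> I \<noteq> {}" "Some x \<in> rees_carrier X I \<longleftrightarrow> x \<in> X - I" for x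
    by (auto simp: rees_carrier_def)
  show ?thesis
    unfolding semigroup_on_def
  proof (intro conjI ballI)
    fix a b assume "a \<in> rees_carrier X I" "b \<in> rees_carrier X I"
    then show "rees_mult I f a b \<in> rees_carrier X I"
      by (cases a; cases b) (auto simp: mem)
  next
    fix a b c assume "a \<in> rees_carrier X I" "b \<in> rees_carrier X I" "c \<in> rees_carrier X I"
    then show "rees_mult I f (rees_mult I f a b) c = rees_mult I f a (rees_mult I f b c)"
    proof (cases "a = None \<or> b = None \<or> c = None")
      case True
      then show ?thesis by (cases a; cases b; cases c) simp_all
    next
      case False
      then obtain x y z where abc: "a = Some x" "b = Some y" "c = Some z" by auto
      then have X: "x \<in> X" "y \<in> X" "z \<in> X"
        using \<open>a \<in> _\<close> \<open>b \<in> _\<close> \<open>c \<in> _\<close> by (simp_all add: mem)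
      then have "x \<cdot> y \<in> I \<Longrightarrow> x \<cdot> y \<cdot> z \<in> I" "y \<cdot> z \<in> I \<Longrightarrow> x \<cdot> (y \<cdot> z) \<in> I" using I1 I2 by blast+
      moreover have "x \<cdot> y \<cdot> z = x \<cdot> (y \<cdot> z)" using X assoc by blast
      ultimately show ?thesis unfolding abc by auto
    qed
  qed
qed

lemma rees_center:
  assumes "z \<in> center X f - I"
  shows "Some z \<in> center (rees_carrier X I) (rees_mult I f)"
proof -
  have z: "z \<in> X" "z \<notin> I" "\<And>x. x \<in> X \<Longrightarrow> z \<cdot> x = x \<cdot> z" using assms by (auto simp: center_def)
  have "rees_mult I f (Some z) a = rees_mult I f a (Some z)" if "a \<in> rees_carrier X I" for a
  proof (cases a)
    case (Some x)
    then have "x \<in> X" using that by (auto simp: rees_carrier_def split: if_splits)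
    then show ?thesis using Some z(3)[of x] by simp
  qed simp
  then show ?thesis using z by (auto simp: center_def rees_carrier_def)
qed

text \<open>In the Rees quotient all products of elements of \<open>A\<close> become the zero
  \<open>None\<close>, which is the constant case of the preceding finiteness result.\<close>

lemma center_nil_set_finite:
  assumes I: "ideal_of X f I"
    and closed: "C_closed (TzS :: 'a option option list topology \<Rightarrow> _ \<Rightarrow> bool)
      (rees_carrier X I) (rees_mult I f)"
    and A: "A \<subseteq> center X f - I" "\<And>u v. u \<in> A \<Longrightarrow> v \<in> A \<Longrightarrow> u \<cdot> v \<in> I"
  shows "finite A"
proof (cases "A = {}")
  case False
  then have "I \<noteq> {}" using A by blast
  then have None: "None \<in> rees_carrier X I" by (simp add: rees_carrier_def)
  have "finite (Some ` A)"
  proof (rule central_set_finite[OF rees_semigroup[OF I] closed])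
    show "Some ` A \<subseteq> center (rees_carrier X I) (rees_mult I f)" using A rees_center by blast
    have "\<exists>b\<in>rees_carrier X I. \<forall>u\<in>Some ` A. \<forall>v\<in>Some ` A. rees_mult I f u v = b"
      by (rule bexI[OF _ None]) (use A(2) in auto)
    then show "(\<forall>u\<in>Some ` A. \<forall>v\<in>Some ` A. rees_mult I f u v \<in> {u, v}) \<or>
      (\<exists>b\<in>rees_carrier X I. \<forall>u\<in>Some ` A. \<forall>v\<in>Some ` A. rees_mult I f u v = b)" ..
  qed
  then show ?thesis by (rule finite_imageD) simp
qed simp

text \<open>The filter generated by the sets \<open>U n\<close> is invariant under translations by elements of \<open>A\<close>,
  so its translates by elements of \<open>X - I\<close> are either equal or separated by cosets \<open>x A\<close>.\<close>

lemma rees_not_C_closed: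
  assumes I: "ideal_of X f I"
    and closed: "C_closed (TzS :: 'a option option list topology \<Rightarrow> _ \<Rightarrow> bool)
      (rees_carrier X I) (rees_mult I f)"
    and A: "A \<subseteq> center X f" "A \<inter> I = {}" "\<And>a b. a \<in> A \<Longrightarrow> b \<in> A \<Longrightarrow> a \<cdot> b \<in> A"
    and U: "\<And>n. U n \<noteq> {}" "\<And>n. U n \<subseteq> A" "\<And>n. U (Suc n) \<subseteq> U n"
    and square: "\<And>n. \<exists>k. \<forall>u\<in>U k. \<forall>v\<in>U k. u \<cdot> v \<in> U n"
    and shift: "\<And>a n. a \<in> A \<Longrightarrow> \<exists>k. (\<forall>u\<in>U k. a \<cdot> u \<in> U n) \<and> (\<forall>u\<in>U k. \<exists>v\<in>U n. u = a \<cdot> v)"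
    and noI: "\<And>x a. x \<in> X - I \<Longrightarrow> a \<in> A \<Longrightarrow> x \<cdot> a \<notin> I"
    and free: "\<And>x c. x \<in> X - I \<Longrightarrow> \<exists>n. \<forall>u\<in>U n. x \<cdot> u \<noteq> c"
  shows False
proof -
  let ?S = "rees_carrier X I" and ?m = "rees_mult I f"
  have AX: "a \<in> X" "a \<notin> I" "\<And>x. x \<in> X \<Longrightarrow> a \<cdot> x = x \<cdot> a" if "a \<in> A" for a
    using A that by (auto simp: center_def)
  have UA: "u \<in> A" if "u \<in> U n" for u n using U that by blast
  have anti: "U j \<subseteq> U i" if "i \<le> j" for i j
    using that U(3) by (rule lift_Suc_antimono_le[rotated])
  define F where "F = (INF n. principal (Some ` U n))"
  have evF: "eventually P F \<longleftrightarrow> (\<exists>n. \<forall>u\<in>U n. P (Some u))" for P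
    unfolding F_def
  proof (subst eventually_INF_base)
    show "\<exists>x\<in>UNIV. principal (Some ` U x) \<le> inf (principal (Some ` U a)) (principal (Some ` U b))" for a b
      using anti[of a "max a b"] anti[of b "max a b"] by (intro bexI[of _ "max a b"]) auto
  qed (auto simp: eventually_principal)
  define G where "G x = filtermap (\<lambda>u. ?m (Some x) u) F" for x
  have evG: "eventually P (G x) \<longleftrightarrow> (\<exists>n. \<forall>u\<in>U n. P (Some (x \<cdot> u)))" if x: "x \<in> X - I" for P x
  proof -
    have "?m (Some x) (Some u) = Some (x \<cdot> u)" if "u \<in> U n" for u n
      using noI[OF x UA[OF that]] by simp
    then show ?thesis unfolding G_def eventually_filtermap evF by (metis (no_types, lifting))
  qed
  obtain a0 where a0: "a0 \<in> A" using U by blast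
  \<comment> \<open>By \<open>shift\<close> the filter is itself one of its translates, so the
    adjoined unit needs no separate treatment.\<close>
  have F_eq: "F = G a0"
    unfolding filter_eq_iff
  proof
    fix P
    have a0': "a0 \<in> X - I" using AX a0 by blast
    show "eventually P F = eventually P (G a0)"
      unfolding evF evG[OF a0']
    proof safe
      fix n assume n: "\<forall>u\<in>U n. P (Some u)"
      obtain k where "\<forall>u\<in>U k. a0 \<cdot> u \<in> U n" using shift[OF a0] by blast
      then show "\<exists>n. \<forall>u\<in>U n. P (Some (a0 \<cdot> u))" using n by blast
    next
      fix n assume n: "\<forall>u\<in>U n. P (Some (a0 \<cdot> u))"
      obtain k where "\<forall>u\<in>U k. \<exists>v\<in>U n. u = a0 \<cdot> v" using shift[OF a0] by blast
      then show "\<exists>n. \<forall>u\<in>U n. P (Some u)" using n by metis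
    qed
  qed
  \<comment> \<open>A common point \<open>x \<cdot> a = y \<cdot> b\<close> of two cosets makes the
    translates agree, because \<open>a\<close> and \<open>b\<close> leave \<open>F\<close>
    invariant.\<close>
  have G_mono: "eventually P (G y)"
    if xy: "x \<in> X - I" "y \<in> X - I" "a \<in> A" "b \<in> A" "x \<cdot> a = y \<cdot> b" and P: "eventually P (G x)" for x y a b P
  proof -
    obtain n where n: "\<forall>u\<in>U n. P (Some (x \<cdot> u))" using P evG xy by blast
    obtain k where k: "\<forall>u\<in>U k. a \<cdot> u \<in> U n" using shift xy by blast
    obtain l where l: "\<forall>u\<in>U l. \<exists>v\<in>U k. u = b \<cdot> v" using shift xy by blast
    have "P (Some (y \<cdot> u))" if u: "u \<in> U l" for u
    proof -
      obtain v where v: "v \<in> U k" "u = b \<cdot> v" using l u by blast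
      have "y \<cdot> u = x \<cdot> (a \<cdot> v)"
        using v UA[OF v(1)] AX xy by (simp flip: assoc)
      then show ?thesis using n k v by simp
    qed
    then show ?thesis using evG xy by blast
  qed
  define coset where "coset x = Some ` {x \<cdot> a |a. a \<in> A}" for x
  have G_cases: "G x = G y \<or> coset x \<inter> coset y = {}" if "x \<in> X - I" "y \<in> X - I" for x y
  proof (cases "coset x \<inter> coset y = {}")
    case False
    then obtain a b where "a \<in> A" "b \<in> A" "x \<cdot> a = y \<cdot> b" by (auto simp: coset_def)
    then have "G x = G y" using G_mono that by (metis filter_eq_iff)
    then show ?thesis ..
  qed simp
  have ev_coset: "eventually (\<lambda>s. s \<in> coset x) (G x)" if "x \<in> X - I" for x
    unfolding evG[OF that] coset_def using UA[of _ 0] by blast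
  have G_decided: "eventually (\<lambda>s. s \<in> W) (G y) \<or> eventually (\<lambda>s. s \<notin> W) (G y)"
    if x: "x \<in> X - I" and y: "y \<in> X - I" and W: "W \<subseteq> coset x" "eventually (\<lambda>s. s \<in> W) (G x)" for x y W
    using G_cases[OF x y]
  proof
    assume "coset x \<inter> coset y = {}"
    then have "eventually (\<lambda>s. s \<notin> W) (G y)"
      by (intro eventually_mono[OF ev_coset[OF y]]) (use W in blast)
    then show ?thesis ..
  qed (use W in simp)
  \<comment> \<open>Besides the translates \<open>G x\<close> there is only the translation by the
    zero \<open>None\<close>, which is constant and gives back the point
    \<open>None\<close>.\<close>
  have actF: "(\<exists>x\<in>X - I. filtermap (act ?m k) F = G x) \<or> None \<in> ?S \<and> k = Some None"
    if k: "k \<in> insert None (Some ` ?S)" for k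
  proof -
    consider "k = None" | "k = Some None" "None \<in> ?S" | x where "k = Some (Some x)" "x \<in> X - I"
      using k by (auto simp: rees_carrier_def split: if_splits)
    then show ?thesis
    proof cases
      case 1
      have "act ?m None = (\<lambda>u. u)" by (rule ext) simp
      then have "filtermap (act ?m k) F = G a0" unfolding 1 by (simp only: filtermap_ident F_eq)
      then show ?thesis using AX a0 by blast
    next
      case 3
      have "act ?m (Some (Some x)) = ?m (Some x)" by (rule ext) simp
      then have "filtermap (act ?m k) F = G x" unfolding 3(1) G_def by (simp only:)
      then show ?thesis using 3 by blast
    qed simp
  qed
  have ev_act: "eventually (\<lambda>u. P (act ?m k u)) F \<longleftrightarrow> eventually P (filtermap (act ?m k) F)" for P k
    by (simp add: eventually_filtermap)
  have "\<exists>s\<in>?S. F = principal {s}"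
  proof (rule central_filter_principal[OF rees_semigroup[OF I] closed])
    show "F \<noteq> bot" using U(1) by (auto simp: trivial_limit_def evF)
    have "Some u \<in> center ?S ?m" if "u \<in> U 0" for u
      using UA[OF that] A rees_center by blast
    then show "F \<le> principal (center ?S ?m)" unfolding le_principal evF by blast
    show "eventually (\<lambda>u. act ?m k u = s) F \<or> eventually (\<lambda>u. act ?m k u \<noteq> s) F"
      if k: "k \<in> insert None (Some ` ?S)" and s: "s \<in> ?S" for k s
      using actF[OF k]
    proof (elim disjE bexE conjE)
      fix x assume x: "x \<in> X - I" "filtermap (act ?m k) F = G x"
      have "eventually (\<lambda>u. u \<noteq> s) (G x)"
        using free[OF x(1), of "the s"] by (cases s) (auto simp: evG[OF x(1)])
      then show ?thesis using ev_act[of "\<lambda>u. u \<noteq> s" k] x by simp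
    next
      assume "k = Some None"
      then show ?thesis by (cases s) (auto intro: always_eventually)
    qed
    show "\<exists>W. eventually (\<lambda>u. act ?m k u \<in> W) F \<and> (\<forall>x\<in>W. P x) \<and>
        (\<forall>l\<in>insert None (Some ` ?S). eventually (\<lambda>u. act ?m l u \<in> W) F \<or>
          eventually (\<lambda>u. act ?m l u \<notin> W) F)"
      if k: "k \<in> insert None (Some ` ?S)" and P: "eventually (\<lambda>u. P (act ?m k u)) F" for k P
      using actF[OF k]
    proof (elim disjE bexE conjE)
      fix x assume x: "x \<in> X - I" "filtermap (act ?m k) F = G x"
      then have "eventually P (G x)" using P ev_act by simp
      then obtain n where n: "\<forall>u\<in>U n. P (Some (x \<cdot> u))" using evG x by blast
      define W where "W = (\<lambda>u. Some (x \<cdot> u)) ` U n"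
      have W: "W \<subseteq> coset x" "eventually (\<lambda>s. s \<in> W) (G x)"
        unfolding W_def coset_def evG[OF x(1)] using UA[of _ n] by blast+
      have "eventually (\<lambda>u. act ?m l u \<in> W) F \<or> eventually (\<lambda>u. act ?m l u \<notin> W) F"
        if "l \<in> insert None (Some ` ?S)" for l
        using actF[OF that]
      proof (elim disjE bexE conjE)
        fix y assume "y \<in> X - I" "filtermap (act ?m l) F = G y"
        then show ?thesis
          using G_decided[OF x(1) _ W] ev_act[of "\<lambda>s. s \<in> W" l] ev_act[of "\<lambda>s. s \<notin> W" l] by simp
      next
        assume "l = Some None"
        moreover have "None \<notin> W" by (auto simp: W_def)
        ultimately show ?thesis by simp
      qed
      moreover have "eventually (\<lambda>u. act ?m k u \<in> W) F" using W x ev_act[of "\<lambda>s. s \<in> W" k] by simp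
      moreover have "\<forall>w\<in>W. P w" using n by (auto simp: W_def)
      ultimately show ?thesis by blast
    next
      assume k: "k = Some None"
      then have "P None" using P \<open>F \<noteq> bot\<close> by (simp add: eventually_const_iff)
      have "eventually (\<lambda>u. act ?m l u \<in> {None}) F \<or> eventually (\<lambda>u. act ?m l u \<notin> {None}) F"
        if "l \<in> insert None (Some ` ?S)" for l
        using actF[OF that]
      proof (elim disjE bexE conjE)
        fix y assume y: "y \<in> X - I" "filtermap (act ?m l) F = G y"
        have "eventually (\<lambda>s. s \<notin> {None}) (G y)" by (simp add: evG[OF y(1)])
        then show ?thesis using y ev_act[of "\<lambda>s. s \<notin> {None}" l] by simp
      qed simp
      then show ?thesis using k \<open>P None\<close> by (intro exI[of _ "{None}"]) simp
    qed
    have "filtermap (\<lambda>(u, v). ?m u v) (F \<times>\<^sub>F F) \<le> F"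
    proof (rule filter_leI)
      fix P assume "eventually P F"
      then obtain n where n: "\<forall>u\<in>U n. P (Some u)" using evF by blast
      obtain k where k: "\<forall>u\<in>U k. \<forall>v\<in>U k. u \<cdot> v \<in> U n" using square by blast
      have "eventually (\<lambda>s. s \<in> Some ` U k) F" unfolding evF by blast
      moreover have "P (?m s t)" if st: "s \<in> Some ` U k" "t \<in> Some ` U k" for s t
      proof -
        obtain u v where "u \<in> U k" "v \<in> U k" "s = Some u" "t = Some v" using st by blast
        moreover have "u \<cdot> v \<in> A" using calculation UA A(3) by blast
        ultimately show ?thesis using n k A(2) by auto
      qed
      ultimately show "eventually P (filtermap (\<lambda>(u, v). ?m u v) (F \<times>\<^sub>F F))"
        unfolding eventually_filtermap eventually_prod_filter prod.case by blast
    qed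
    then show "filtermap (\<lambda>(u, v). ?m u v) (F \<times>\<^sub>F F) \<le> F \<or>
      (\<exists>b\<in>?S. filtermap (\<lambda>(u, v). ?m u v) (F \<times>\<^sub>F F) \<le> principal {b})" ..
  qed
  then obtain s where s: "F = principal {s}" by blast
  have "eventually (\<lambda>u. u \<noteq> s) (G a0)"
    using free[of a0 "the s"] AX a0 by (cases s) (auto simp: evG)
  then have "eventually (\<lambda>u. u \<noteq> s) (principal {s})" unfolding F_eq[symmetric] s .
  then show False by (simp add: eventually_principal)
qed

end

section \<open>The center of an ideally closed semigroup\<close>

locale ideally_closed_sgrp = sgrp X f for X :: "'a set" and f (infixl "\<cdot>" 70) +
  assumes ideally_closed:
    "ideally_closed (TzS :: 'a option option list topology \<Rightarrow> _ \<Rightarrow> bool) X f"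
begin

abbreviation "Z \<equiv> center X f"

lemma rees_closed:
  "ideal_of X f I \<Longrightarrow> C_closed (TzS :: 'a option option list topology \<Rightarrow> _ \<Rightarrow> bool)
    (rees_carrier X I) (rees_mult I f)"
  using ideally_closed by (simp add: ideally_closed_def)

lemma nil_set_finite:
  assumes "ideal_of X f I" "A \<subseteq> Z - I" "\<And>u v. u \<in> A \<Longrightarrow> v \<in> A \<Longrightarrow> u \<cdot> v \<in> I"
  shows "finite A"
  using center_nil_set_finite[OF assms(1) rees_closed[OF assms(1)] assms(2,3)] .

lemma Z_X: "z \<in> Z \<Longrightarrow> z \<in> X" by (simp add: center_def)

lemma Z_comm: "z \<in> Z \<Longrightarrow> x \<in> X \<Longrightarrow> z \<cdot> x = x \<cdot> z" by (simp add: center_def)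

lemma Z_mult:
  assumes "a \<in> Z" "b \<in> Z"
  shows "a \<cdot> b \<in> Z"
proof -
  have "a \<cdot> b \<cdot> x = x \<cdot> (a \<cdot> b)" if x: "x \<in> X" for x
  proof -
    have "a \<cdot> b \<cdot> x = a \<cdot> (x \<cdot> b)" using assms x Z_X Z_comm[of b x] by (simp add: assoc)
    also have "\<dots> = x \<cdot> a \<cdot> b" using assms x Z_X Z_comm[of a x] by (simp flip: assoc)
    finally show ?thesis using assms x Z_X by (simp add: assoc)
  qed
  moreover have "a \<cdot> b \<in> X" using assms Z_X by blast
  ultimately show ?thesis unfolding center_def by blast
qed

sublocale Z: comm_sgrp Z f
proof
  show "semigroup_on Z f"
    unfolding semigroup_on_def by (intro conjI ballI) (simp_all add: Z_mult Z_X assoc)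
qed (simp add: Z_X Z_comm)

lemma ideal_mult:
  assumes "ideal_of X f I" "x \<in> I" "y \<in> X"
  shows "x \<cdot> y \<in> I" "y \<cdot> x \<in> I"
  using assms by (auto simp: ideal_of_def)

lemma ideal_sub: "ideal_of X f I \<Longrightarrow> x \<in> I \<Longrightarrow> x \<in> X"
  by (auto simp: ideal_of_def)

lemma idemsX: "e \<in> idems Z f \<Longrightarrow> e \<in> X" "e \<in> idems Z f \<Longrightarrow> e \<in> Z" "e \<in> idems Z f \<Longrightarrow> e \<cdot> e = e"
  by (auto simp: idems_def center_def)

section \<open>Periodicity of the center\<close>

lemma inj_powers:
  assumes z: "z \<in> Z" and np: "\<And>n. n > 0 \<Longrightarrow> pw f z n \<notin> idems Z f" and ij: "0 < i" "i < j"
  shows "pw f z i \<noteq> pw f z j"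
proof
  assume eq: "pw f z i = pw f z j"
  define d where "d = j - i"
  have d: "d > 0" "j = i + d" using ij by (auto simp: d_def)
  have zX: "z \<in> X" using z Z_X by blast
  have rep: "pw f z (i + k * d) = pw f z i" for k
  proof (induction k)
    case (Suc k)
    show ?case
    proof (cases "k = 0")
      case True
      then show ?thesis using eq d by simp
    next
      case False
      have "pw f z (i + Suc k * d) = pw f z (j + k * d)" using d by (simp add: algebra_simps)
      also have "\<dots> = pw f z i \<cdot> pw f z (k * d)" using False d ij zX eq by (simp add: pw_add)
      also have "\<dots> = pw f z (i + k * d)" using False d ij zX by (simp add: pw_add)
      finally show ?thesis using Suc by simp
    qed
  qed simp
  \<comment> \<open>The exponent \<open>i * d\<close> is a multiple of the period \<open>d\<close>
    and at least \<open>i\<close>, so this power lies in the cyclic part and is idempotent. The case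
    \<open>i * d = i\<close> is separate because \<open>pw\<close> at \<open>0\<close> is not a
    unit.\<close>
  have "i \<le> i * d" using d by simp
  have "pw f z (i * d + i * d) = pw f z (i * d)"
  proof (cases "i * d = i")
    case True
    then show ?thesis using rep[of i] by (simp only: True)
  next
    case False
    then have lt: "i < i * d" using \<open>i \<le> i * d\<close> by simp
    have "pw f z (i * d + i * d) = pw f z ((i + i * d) + (i * d - i))" using lt by simp
    also have "\<dots> = pw f z i \<cdot> pw f z (i * d - i)"
      using lt ij zX rep[of i] by (subst pw_add) auto
    also have "\<dots> = pw f z (i + (i * d - i))" using lt ij zX by (subst pw_add) auto
    finally show ?thesis using lt by simp
  qed
  then have "pw f z (i * d) \<in> idems Z f"
    using z ij d Z.pw_closed[OF z] zX by (simp add: idems_def pw_add)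
  then show False using np[of "i * d"] ij d by simp
qed

lemma periodic_center: "periodic_on Z f"
  unfolding periodic_on_def
proof (rule ballI, rule ccontr)
  fix z assume z: "z \<in> Z" and "\<not> (\<exists>n>0. pw f z n \<in> idems Z f)"
  then have inj: "\<And>i j. 0 < i \<Longrightarrow> i < j \<Longrightarrow> pw f z i \<noteq> pw f z j" using inj_powers by blast
  have zX: "z \<in> X" using z Z_X by blast
  have pZ: "pw f z k \<in> Z" "pw f z k \<in> X" for k using z zX Z.pw_closed by auto
  \<comment> \<open>The elements whose translation is not injective on the powers of
    \<open>z\<close>. Outside this ideal the translated tails are free, and the powers themselves
    lie outside since they are pairwise different.\<close>
  define I where "I = {x \<in> X. \<exists>i j. 0 < i \<and> i < j \<and> x \<cdot> pw f z i = x \<cdot> pw f z j}"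
  define A where "A = {pw f z k |k. k > 0}"
  define U where "U n = {pw f z k |k. k > n}" for n
  have I: "ideal_of X f I"
    unfolding ideal_of_def
  proof (intro conjI ballI)
    fix x a assume "x \<in> I" and a: "a \<in> X"
    then obtain i j where x: "x \<in> X" "0 < i" "i < j" "x \<cdot> pw f z i = x \<cdot> pw f z j"
      by (auto simp: I_def)
    have "x \<cdot> a \<cdot> pw f z k = x \<cdot> pw f z k \<cdot> a" for k
      using x a pZ Z_comm[OF pZ(1) a] by (simp add: assoc)
    then have "x \<cdot> a \<cdot> pw f z i = x \<cdot> a \<cdot> pw f z j" using x by simp
    then show "x \<cdot> a \<in> I" using x a unfolding I_def by blast
    have "a \<cdot> x \<cdot> pw f z i = a \<cdot> x \<cdot> pw f z j" using x a pZ by (simp add: assoc)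
    then show "a \<cdot> x \<in> I" using x a unfolding I_def by blast
  qed (auto simp: I_def)
  have notI: "x \<cdot> pw f z i \<noteq> x \<cdot> pw f z j" if "x \<in> X - I" "0 < i" "i < j" for x i j
    using that unfolding I_def by blast
  show False
  proof (rule rees_not_C_closed[OF I rees_closed[OF I], of A U])
    show "A \<subseteq> Z" using pZ by (auto simp: A_def)
    show "A \<inter> I = {}"
    proof -
      have "pw f z k \<notin> I" if k: "k > 0" for k
      proof
        assume "pw f z k \<in> I"
        then obtain i j where "0 < i" "i < j" "pw f z k \<cdot> pw f z i = pw f z k \<cdot> pw f z j"
          by (auto simp: I_def)
        then show False using inj[of "k + i" "k + j"] k zX by (simp add: pw_add)
      qed
      then show ?thesis by (auto simp: A_def)
    qed
    show "a \<cdot> b \<in> A" if ab: "a \<in> A" "b \<in> A" for a b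
    proof -
      obtain k l where kl: "a = pw f z k" "b = pw f z l" "k > 0" "l > 0" using ab by (auto simp: A_def)
      then have "a \<cdot> b = pw f z (k + l)" using zX by (simp add: pw_add)
      then show ?thesis using kl by (auto simp: A_def)
    qed
    show "U n \<noteq> {}" "U n \<subseteq> A" "U (Suc n) \<subseteq> U n" for n
      by (auto simp: U_def A_def intro: exI[of _ "Suc n"])
    show "\<exists>k. \<forall>u\<in>U k. \<forall>v\<in>U k. u \<cdot> v \<in> U n" for n
    proof (intro exI[of _ n] ballI)
      fix u v assume "u \<in> U n" "v \<in> U n"
      then obtain k l where kl: "u = pw f z k" "v = pw f z l" "k > n" "l > n" by (auto simp: U_def)
      then have "u \<cdot> v = pw f z (k + l)" using zX by (simp add: pw_add)
      then show "u \<cdot> v \<in> U n" using kl by (auto simp: U_def)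
    qed
    show "\<exists>k. (\<forall>u\<in>U k. a \<cdot> u \<in> U n) \<and> (\<forall>u\<in>U k. \<exists>v\<in>U n. u = a \<cdot> v)" if aA: "a \<in> A" for a n
    proof -
      obtain k where k: "a = pw f z k" "k > 0" using aA by (auto simp: A_def)
      \<comment> \<open>The shift by \<open>k\<close> in the index leaves an exponent above
        \<open>n\<close> after \<open>a = z^k\<close> has been divided off.\<close>
      have "a \<cdot> u \<in> U n \<and> (\<exists>v\<in>U n. u = a \<cdot> v)" if uU: "u \<in> U (n + k)" for u
      proof -
        obtain l where l: "u = pw f z l" "l > n + k" using uU by (auto simp: U_def)
        have "a \<cdot> u = pw f z (k + l)" using k l zX pw_add[of z k l] by simp
        moreover have "pw f z (k + l) \<in> U n" unfolding U_def using l(2) by (auto intro!: exI[of _ "k + l"])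
        moreover have "u = a \<cdot> pw f z (l - k)" using k l zX pw_add[of z k "l - k"] by simp
        moreover have "pw f z (l - k) \<in> U n" unfolding U_def using l(2) by (auto intro!: exI[of _ "l - k"])
        ultimately show ?thesis by (metis (no_types))
      qed
      then show ?thesis by blast
    qed
    show "x \<cdot> a \<notin> I" if xa: "x \<in> X - I" "a \<in> A" for x a
    proof
      assume "x \<cdot> a \<in> I"
      obtain k where k: "a = pw f z k" "k > 0" using xa by (auto simp: A_def)
      obtain i j where ij: "0 < i" "i < j" "x \<cdot> a \<cdot> pw f z i = x \<cdot> a \<cdot> pw f z j"
        using \<open>x \<cdot> a \<in> I\<close> by (auto simp: I_def)
      then have "x \<cdot> pw f z (k + i) = x \<cdot> pw f z (k + j)"
        using k xa pZ zX by (simp add: assoc pw_add)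
      then show False using notI[OF xa(1), of "k + i" "k + j"] k ij by simp
    qed
    show "\<exists>n. \<forall>u\<in>U n. x \<cdot> u \<noteq> c" if x: "x \<in> X - I" for x c
    proof (cases "\<exists>k>0. c = x \<cdot> pw f z k")
      case True
      then obtain k where k: "k > 0" "c = x \<cdot> pw f z k" by blast
      have "x \<cdot> u \<noteq> c" if "u \<in> U k" for u
        using that notI[OF x k(1)] k(2) by (auto simp: U_def) metis
      then show ?thesis by blast
    next
      case False
      then have "\<forall>u\<in>U 0. x \<cdot> u \<noteq> c" unfolding U_def by blast
      then show ?thesis ..
    qed
  qed
qed

section \<open>Chains of central idempotents\<close>

lemma chain_finite_center: "chain_finite_on Z f"
  unfolding chain_finite_on_def
proof (intro allI impI)
  fix E assume E: "E \<subseteq> idems Z f" "\<forall>u\<in>E. \<forall>v\<in>E. u \<cdot> v \<in> {u, v}"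
  \<comment> \<open>The quotient by the empty ideal is a copy of \<open>X\<close> without an added
    zero.\<close>
  have I: "ideal_of X f {}" by (simp add: ideal_of_def)
  have "finite (Some ` E)"
  proof (rule central_set_finite[OF rees_semigroup[OF I] rees_closed[OF I]])
    show "Some ` E \<subseteq> center (rees_carrier X {}) (rees_mult {} f)"
      using E(1) rees_center[of _ "{}"] idemsX(2) by blast
    have "\<forall>u\<in>Some ` E. \<forall>v\<in>Some ` E. rees_mult {} f u v \<in> {u, v}" using E(2) by auto
    then show "(\<forall>u\<in>Some ` E. \<forall>v\<in>Some ` E. rees_mult {} f u v \<in> {u, v}) \<or>
      (\<exists>b\<in>rees_carrier X {}. \<forall>u\<in>Some ` E. \<forall>v\<in>Some ` E. rees_mult {} f u v = b)" ..
  qed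
  then show "finite E" by (rule finite_imageD) simp
qed

section \<open>Principal ideals and elements nilpotent modulo an ideal\<close>

definition multiples :: "'a \<Rightarrow> 'a set" where
  "multiples a = insert a {y \<cdot> a |y. y \<in> X}"

text \<open>Centrality of \<open>a\<close> turns the left multiples \<open>X^1 a\<close> into a
  two-sided ideal.\<close>

lemma multiples_ideal:
  assumes a: "a \<in> Z"
  shows "ideal_of X f (multiples a)"
  unfolding ideal_of_def
proof (intro conjI ballI)
  show "multiples a \<subseteq> X" using a Z_X by (auto simp: multiples_def)
  fix x b assume "x \<in> multiples a" and b: "b \<in> X"
  then consider "x = a" | y where "y \<in> X" "x = y \<cdot> a" by (auto simp: multiples_def)
  then show "x \<cdot> b \<in> multiples a"
  proof cases
    case 1
    then show ?thesis using Z_comm[OF a b] b by (auto simp: multiples_def)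
  next
    case 2
    then have "x \<cdot> b = (y \<cdot> b) \<cdot> a" using Z_comm[OF a b] b Z_X[OF a] by (simp add: assoc)
    moreover have "y \<cdot> b \<in> X" using 2 b by blast
    ultimately show ?thesis unfolding multiples_def by blast
  qed
  from \<open>x \<in> multiples a\<close> consider "x = a" | y where "y \<in> X" "x = y \<cdot> a" by (auto simp: multiples_def)
  then show "b \<cdot> x \<in> multiples a"
  proof cases
    case 1
    then show ?thesis using b by (auto simp: multiples_def)
  next
    case 2
    then have "b \<cdot> x = (b \<cdot> y) \<cdot> a" using b Z_X[OF a] by (simp add: assoc)
    moreover have "b \<cdot> y \<in> X" using 2 b by blast
    ultimately show ?thesis unfolding multiples_def by blast
  qed
qed

lemma multiples_self [simp]: "a \<in> multiples a" by (simp add: multiples_def)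

lemma multiples_subset:
  assumes "ideal_of X f I" "a \<in> I"
  shows "multiples a \<subseteq> I"
  using assms ideal_mult by (auto simp: multiples_def)

lemma multiples_mult:
  assumes "u \<in> multiples a" "v \<in> multiples b" "a \<in> Z" "b \<in> Z"
  shows "u \<cdot> v \<in> multiples (a \<cdot> b)"
proof -
  note I = multiples_ideal[OF Z_mult[OF assms(3,4)]]
  have vX: "v \<in> X" using multiples_ideal[OF assms(4)] assms(2) ideal_sub by blast
  have av: "a \<cdot> v \<in> multiples (a \<cdot> b)"
  proof -
    consider "v = b" | y where "y \<in> X" "v = y \<cdot> b" using assms(2) by (auto simp: multiples_def)
    then show ?thesis
    proof cases
      case 2
      then have "a \<cdot> v = y \<cdot> (a \<cdot> b)"
        using assms Z_X Z_comm[of a y] by (simp flip: assoc)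
      then show ?thesis using 2 by (auto simp: multiples_def)
    qed simp
  qed
  consider "u = a" | y where "y \<in> X" "u = y \<cdot> a" using assms(1) by (auto simp: multiples_def)
  then show ?thesis
  proof cases
    case 2
    then have "u \<cdot> v = y \<cdot> (a \<cdot> v)" using assms(3) Z_X vX by (simp add: assoc)
    then show ?thesis using ideal_mult(2)[OF I av] 2 by simp
  qed (use av in simp)
qed

lemma multiples_pw:
  assumes "a \<in> Z" "0 < k" "k \<le> l"
  shows "pw f a l \<in> multiples (pw f a k)"
proof (cases "k = l")
  case False
  then have "pw f a l = pw f a (l - k) \<cdot> pw f a k"
    using assms Z_X pw_add[of a "l - k" k] by simp
  then show ?thesis using assms Z_X by (auto simp: multiples_def)
qed simp

lemma pw_ideal_mono:
  assumes "ideal_of X f I" "a \<in> Z" "0 < k" "k \<le> l" "pw f a k \<in> I"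
  shows "pw f a l \<in> I"
  using multiples_pw[OF assms(2-4)] multiples_subset[OF assms(1,5)] by blast

lemma last_power:
  assumes I: "ideal_of X f I" and a: "a \<in> Z" "a \<notin> I" and n: "n > 0" "pw f a n \<in> I"
  shows "\<exists>k>0. pw f a k \<notin> I \<and> pw f a (Suc k) \<in> I"
proof (rule ccontr)
  assume no: "\<not> ?thesis"
  have "pw f a k \<notin> I" if "k > 0" for k
    using that
  proof (induction k rule: nat_induct_non_zero)
    case 1
    then show ?case using a(2) by simp
  next
    case (Suc k)
    then show ?case using no by blast
  qed
  then show False using n by blast
qed

text \<open>\<open>nil_set_finite\<close> requires all products of two elements to fall into the
  ideal, whereas here the nilpotency index is arbitrary. The ideal is changed until a suitable
  infinite set with this property appears. Finiteness of \<open>N \<inter> multiples a\<close>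
  serves to control the enlargements.\<close>

lemma nil_part_finite:
  assumes I: "ideal_of X f I"
  shows "finite {z \<in> Z - I. \<exists>n>0. pw f z n \<in> I}" 
proof (rule ccontr)
  define N where "N = {z \<in> Z - I. \<exists>n>0. pw f z n \<in> I}"
  assume "infinite {z \<in> Z - I. \<exists>n>0. pw f z n \<in> I}"
  then have inf: "infinite N" by (simp add: N_def)
  have NZ: "a \<in> Z" "a \<in> X" "a \<notin> I" "\<exists>n>0. pw f a n \<in> I" if "a \<in> N" for a
    using that Z_X by (auto simp: N_def)
  have mult_N: "z \<in> N" if z: "z \<in> Z" "z \<notin> I" "z \<in> multiples a" and a: "a \<in> N" for z a
  proof (cases "z = a")
    case False
    then obtain y where y: "y \<in> X" "z = y \<cdot> a" using z by (auto simp: multiples_def)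
    obtain n where n: "n > 0" "pw f a n \<in> I" using NZ a by blast
    have "y \<cdot> a = a \<cdot> y" using Z_comm[OF NZ(1)[OF a] y(1)] by simp
    then have "pw f z n = pw f y n \<cdot> pw f a n"
      using pw_distrib[OF y(1) NZ(2)[OF a] _ n(1)] y(2) by simp
    then have "pw f z n \<in> I" using ideal_mult(2)[OF I n(2)] y by simp
    then show ?thesis using z n by (auto simp: N_def)
  qed (use a in simp)
  have fin_mult: "finite (N \<inter> multiples a)" if a: "a \<in> N" for a
  proof (rule ccontr)
    assume inf': "infinite (N \<inter> multiples a)"
    note aZ = NZ(1)[OF a]
    obtain n where n: "n > 0" "pw f a n \<in> I" using NZ a by blast
    \<comment> \<open>Take the last power of \<open>a\<close> with infinitely many multiples in
      \<open>N\<close>. The elements lost at the next stage have products in the ideal of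
      \<open>a^(k+k)\<close>, and \<open>k + k \<ge> k + 1\<close>.\<close>
    have "\<exists>k>0. infinite (N \<inter> multiples (pw f a k)) \<and> finite (N \<inter> multiples (pw f a (Suc k)))"
    proof (rule ccontr)
      assume no: "\<not> ?thesis"
      have "infinite (N \<inter> multiples (pw f a k))" if "k > 0" for k
        using that
      proof (induction k rule: nat_induct_non_zero)
        case 1
        then show ?case using inf' by simp
      next
        case (Suc k)
        then show ?case using no by blast
      qed
      then have "infinite (N \<inter> multiples (pw f a n))" using n by blast
      moreover have "N \<inter> multiples (pw f a n) = {}" using multiples_subset[OF I n(2)] NZ(3) by blast
      ultimately show False by simp
    qed
    then obtain k where k: "k > 0" "infinite (N \<inter> multiples (pw f a k))"
      "finite (N \<inter> multiples (pw f a (Suc k)))" by blast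
    let ?A = "N \<inter> multiples (pw f a k) - N \<inter> multiples (pw f a (Suc k))"
    let ?J = "I \<union> multiples (pw f a (Suc k))"
    have J: "ideal_of X f ?J"
      using I multiples_ideal[OF Z.pw_closed[OF aZ]] unfolding ideal_of_def by blast
    have "finite ?A"
    proof (rule nil_set_finite[OF J])
      show "?A \<subseteq> Z - ?J" using NZ(1,3) by blast
      fix u v assume "u \<in> ?A" "v \<in> ?A"
      then have "u \<cdot> v \<in> multiples (pw f a k \<cdot> pw f a k)"
        using multiples_mult[OF _ _ Z.pw_closed[OF aZ] Z.pw_closed[OF aZ]] by blast
      then have "u \<cdot> v \<in> multiples (pw f a (k + k))" using k(1) aZ Z_X by (simp add: pw_add)
      moreover have "pw f a (k + k) \<in> multiples (pw f a (Suc k))" using multiples_pw[OF aZ] k(1) by simp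
      then have "multiples (pw f a (k + k)) \<subseteq> multiples (pw f a (Suc k))"
        by (rule multiples_subset[OF multiples_ideal[OF Z.pw_closed[OF aZ]]])
      ultimately have "u \<cdot> v \<in> multiples (pw f a (Suc k))" by blast
      then show "u \<cdot> v \<in> ?J" by (rule UnI2)
    qed
    moreover have "infinite ?A" by (rule Diff_infinite_finite[OF k(3,2)])
    ultimately show False by contradiction
  qed
  have fin_ann: "finite {b \<in> N. b \<cdot> c \<notin> I}" if c: "c \<in> N" for c
  proof (rule ccontr)
    let ?B0 = "{b \<in> N. b \<cdot> c \<notin> I}"
    assume inf': "infinite ?B0"
    have "(\<lambda>b. b \<cdot> c) ` ?B0 \<subseteq> N \<inter> multiples c"
    proof (rule image_subsetI)
      fix b assume "b \<in> ?B0"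
      then have b: "b \<in> N" "b \<cdot> c \<notin> I" by simp_all
      have m: "b \<cdot> c \<in> multiples c" using NZ(2)[OF b(1)] by (auto simp: multiples_def)
      moreover have "b \<cdot> c \<in> N"
        by (rule mult_N[OF Z_mult[OF NZ(1)[OF b(1)] NZ(1)[OF c]] b(2) m c])
      ultimately show "b \<cdot> c \<in> N \<inter> multiples c" by (intro IntI)
    qed
    then have "finite ((\<lambda>b. b \<cdot> c) ` ?B0)" using fin_mult[OF c] finite_subset by blast
    \<comment> \<open>The products \<open>b \<cdot> c\<close> take only finitely many values, so
      infinitely many \<open>b\<close> act on \<open>c\<close> as \<open>b0\<close> does.\<close>
    then obtain b0 where b0: "b0 \<in> ?B0" "infinite {b \<in> ?B0. b \<cdot> c = b0 \<cdot> c}"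
      using pigeonhole_infinite[OF inf'] by blast
    let ?B = "{b \<in> ?B0. b \<cdot> c = b0 \<cdot> c}"
    \<comment> \<open>By commutativity every \<open>b\<close> in \<open>?B\<close> advances the
      sequence \<open>b0^j c\<close> by one step.\<close>
    define q where "q j = (f b0 ^^ j) c" for j
    have b0Z: "b0 \<in> Z" "b0 \<in> X" using b0 NZ by auto
    have cZ: "c \<in> Z" "c \<in> X" using NZ c by auto
    have qZ: "q j \<in> Z" "q j \<in> X" for j
    proof -
      show "q j \<in> Z" unfolding q_def using b0Z cZ by (induction j) (auto intro: Z_mult)
      then show "q j \<in> X" using Z_X by blast
    qed
    have qB: "b \<cdot> q j = q (Suc j)" if b: "b \<in> ?B" for b j
    proof (induction j)
      case 0
      then show ?case using b by (simp add: q_def)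
    next
      case (Suc j)
      have bZ: "b \<in> Z" using b NZ(1) by simp
      have "b \<cdot> q (Suc j) = b \<cdot> (b0 \<cdot> q j)" by (simp add: q_def)
      also have "\<dots> = b0 \<cdot> (b \<cdot> q j)" using Z.lcomm bZ b0Z qZ by blast
      also have "\<dots> = q (Suc (Suc j))" using Suc by (simp add: q_def)
      finally show ?case .
    qed
    obtain n where n: "n > 0" "pw f b0 n \<in> I" using NZ b0 by blast
    have "q j = pw f b0 j \<cdot> c" if "j > 0" for j
      using that
      by (induction j rule: nat_induct_non_zero) (use b0Z cZ in \<open>auto simp: q_def pw_Suc assoc\<close>)
    then have qn: "q n \<in> I" using n ideal_mult(1)[OF I] cZ by simp
    define k where "k = (LEAST k. q k \<in> I)"
    have k: "q k \<in> I" "\<And>j. j < k \<Longrightarrow> q j \<notin> I"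
      unfolding k_def using LeastI[of "\<lambda>k. q k \<in> I" n] qn not_less_Least by blast+
    have "q 0 \<notin> I" "q 1 \<notin> I" using b0 NZ(3)[OF c] by (auto simp: q_def)
    then have "k \<noteq> 0" "k \<noteq> 1" using k(1) by (metis, metis)
    then obtain l where l: "k = Suc (Suc l)" by (metis One_nat_def not0_implies_Suc)
    \<comment> \<open>Since \<open>l = k - 2\<close>, one factor from \<open>?B\<close> moves
      \<open>q l\<close> to \<open>q (k - 1)\<close>, still outside \<open>I\<close>, and two
      factors move it to \<open>q k\<close>, inside. Hence \<open>?B\<close> avoids
      \<open>?J\<close> while its products lie in it.\<close>
    let ?J = "{x \<in> X. x \<cdot> q l \<in> I}"
    have J: "ideal_of X f ?J"
      unfolding ideal_of_def
    proof (intro conjI ballI)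
      fix x a assume x: "x \<in> ?J" and a: "a \<in> X"
      have "x \<cdot> a \<cdot> q l = x \<cdot> q l \<cdot> a" using x a qZ Z_comm[OF qZ(1) a] by (simp add: assoc)
      then show "x \<cdot> a \<in> ?J" using ideal_mult(1)[OF I _ a, of "x \<cdot> q l"] x a by simp
      have "a \<cdot> x \<cdot> q l = a \<cdot> (x \<cdot> q l)" using x a qZ by (simp add: assoc)
      then show "a \<cdot> x \<in> ?J" using ideal_mult(2)[OF I _ a, of "x \<cdot> q l"] x a by simp
    qed simp
    have "finite ?B"
    proof (rule nil_set_finite[OF J])
      show "?B \<subseteq> Z - ?J" using qB k(2)[of "Suc l"] l NZ(1) by auto
      fix u v assume uv: "u \<in> ?B" "v \<in> ?B"
      then have "u \<cdot> v \<cdot> q l = q k" using qB[OF uv(2)] qB[OF uv(1)] l qZ NZ(2) by (simp add: assoc)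
      then show "u \<cdot> v \<in> ?J" using k(1) uv NZ(2) by simp
    qed
    then show False using b0 by blast
  qed
  \<comment> \<open>Each earlier element excludes only finitely many candidates, by
    \<open>fin_ann\<close>, so infinitely many elements with pairwise products in \<open>I\<close>
    can be picked.\<close>
  have "\<exists>a. \<forall>n::nat. a n \<in> N \<and> (\<forall>i<n. a n \<noteq> a i \<and> a n \<cdot> a i \<in> I)"
  proof (rule dependent_wellorder_choice)
    fix n and a :: "nat \<Rightarrow> 'a"
    assume "\<And>i. i < n \<Longrightarrow> a i \<in> N \<and> (\<forall>j<i. a i \<noteq> a j \<and> a i \<cdot> a j \<in> I)"
    then have "finite (\<Union>i<n. insert (a i) {b \<in> N. b \<cdot> a i \<notin> I})" using fin_ann by auto
    then have "infinite (N - (\<Union>i<n. insert (a i) {b \<in> N. b \<cdot> a i \<notin> I}))"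
      using inf Diff_infinite_finite by blast
    then obtain r where "r \<in> N - (\<Union>i<n. insert (a i) {b \<in> N. b \<cdot> a i \<notin> I})"
      using infinite_imp_nonempty by blast
    then show "\<exists>r. r \<in> N \<and> (\<forall>i<n. r \<noteq> a i \<and> r \<cdot> a i \<in> I)" by blast
  qed simp
  then obtain a where a: "\<And>n::nat. a n \<in> N" "\<And>n i. i < n \<Longrightarrow> a n \<noteq> a i \<and> a n \<cdot> a i \<in> I" by blast
  define A where "A = range a"
  have AN: "x \<in> N" if "x \<in> A" for x using a(1) that by (auto simp: A_def)
  have AZ: "x \<in> Z" "x \<in> X" if "x \<in> A" for x using NZ AN[OF that] by auto
  have "inj a" using a(2) by (metis injI linorder_neqE_nat)
  then have "infinite A" unfolding A_def by (rule range_inj_infinite)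
  have orth: "x \<cdot> y \<in> I" if xy: "x \<in> A" "y \<in> A" "x \<noteq> y" for x y
  proof -
    obtain i j where ij: "x = a i" "y = a j" using xy by (auto simp: A_def)
    then consider "i < j" | "j < i" using xy(3) by (metis linorder_neqE_nat)
    then show ?thesis
    proof cases
      case 1
      then show ?thesis using a(2) ij Z_comm AZ xy by metis
    next
      case 2
      then show ?thesis using a(2) ij by blast
    qed
  qed
  have orth_pw: "pw f x k \<cdot> pw f y l \<in> I" if xy: "x \<in> A" "y \<in> A" "x \<noteq> y" "k > 0" "l > 0" for x y k l
  proof -
    have "pw f x k \<in> multiples x" "pw f y l \<in> multiples y"
      using multiples_pw[of x 1 k] multiples_pw[of y 1 l] AZ xy by auto
    then have "pw f x k \<cdot> pw f y l \<in> multiples (x \<cdot> y)" using multiples_mult AZ xy by blast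
    then show ?thesis using multiples_subset[OF I orth[OF xy(1-3)]] by blast
  qed
  have "\<forall>x\<in>A. \<exists>k>0. pw f x k \<notin> I \<and> pw f x (Suc k) \<in> I"
  proof
    fix x assume x: "x \<in> A"
    obtain n where "n > 0" "pw f x n \<in> I" using NZ(4)[OF AN[OF x]] by blast
    then show "\<exists>k>0. pw f x k \<notin> I \<and> pw f x (Suc k) \<in> I"
      by (rule last_power[OF I NZ(1)[OF AN[OF x]] NZ(3)[OF AN[OF x]]])
  qed
  then obtain \<kappa> where \<kappa>: "\<And>x. x \<in> A \<Longrightarrow> \<kappa> x > 0 \<and> pw f x (\<kappa> x) \<notin> I \<and> pw f x (Suc (\<kappa> x)) \<in> I"
    by metis
  \<comment> \<open>The last powers outside \<open>I\<close>; their squares lie in \<open>I\<close>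
    because \<open>\<kappa> + \<kappa> \<ge> \<kappa> + 1\<close>. Finiteness of \<open>B\<close>
    alone is no contradiction, as many elements of \<open>A\<close> may share a last power.\<close>
  define B where "B = (\<lambda>x. pw f x (\<kappa> x)) ` A"
  have BN: "b \<in> N" if b: "b \<in> B" for b
  proof -
    obtain x where x: "x \<in> A" "b = pw f x (\<kappa> x)" using b by (auto simp: B_def)
    then show ?thesis
      using mult_N[of b x] multiples_pw[of x 1 "\<kappa> x"] \<kappa>[OF x(1)] AN[OF x(1)] AZ[OF x(1)]
      by (simp add: Z.pw_closed)
  qed
  have squareI: "pw f x k \<cdot> pw f x k \<in> J"
    if "ideal_of X f J" "x \<in> A" "k > 0" "pw f x (Suc k) \<in> J" for x k J
    using pw_ideal_mono[OF that(1) AZ(1)[OF that(2)], of "Suc k" "k + k"] that AZ by (simp add: pw_add)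
  have "finite B"
  proof (rule nil_set_finite[OF I])
    show "B \<subseteq> Z - I" using BN NZ(1,3) by blast
    fix u v assume "u \<in> B" "v \<in> B"
    then obtain x y where "x \<in> A" "y \<in> A" "u = pw f x (\<kappa> x)" "v = pw f y (\<kappa> y)" by (auto simp: B_def)
    then show "u \<cdot> v \<in> I" using \<kappa> orth_pw squareI[OF I] by (cases "x = y") auto
  qed
  \<comment> \<open>Adding the multiples of \<open>B\<close> to the ideal makes the last power
    \<open>l\<close> outside it strictly smaller than \<open>\<kappa>\<close>. This strict gap is
    what makes the new last powers distinct, and finiteness of \<open>N \<inter> J\<close> keeps
    \<open>A - J\<close> infinite.\<close>
  define J where "J = I \<union> (\<Union>b\<in>B. multiples b)"
  have J: "ideal_of X f J"
  proof -
    have "ideal_of X f (multiples b)" if "b \<in> B" for b using multiples_ideal NZ(1) BN[OF that] by blast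
    then show ?thesis using I unfolding J_def ideal_of_def by blast
  qed
  have "N \<inter> J = (\<Union>b\<in>B. N \<inter> multiples b)" unfolding J_def using NZ(3) by blast
  moreover have "finite (\<Union>b\<in>B. N \<inter> multiples b)"
    by (rule finite_UN_I[OF \<open>finite B\<close> fin_mult[OF BN]])
  ultimately have "finite (N \<inter> J)" by (simp only:)
  then have "finite (A \<inter> J)" by (rule rev_finite_subset) (use AN in blast)
  then have "infinite (A - A \<inter> J)" using \<open>infinite A\<close> by (rule Diff_infinite_finite)
  then have "infinite (A - J)" by (simp add: Diff_Int)
  have \<kappa>J: "pw f x (\<kappa> x) \<in> J" if "x \<in> A" for x
    using that multiples_self unfolding J_def B_def by blast
  have "\<forall>x\<in>A - J. \<exists>k>0. pw f x k \<notin> J \<and> pw f x (Suc k) \<in> J"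
  proof
    fix x assume x: "x \<in> A - J"
    then have xA: "x \<in> A" "x \<notin> J" by auto
    show "\<exists>k>0. pw f x k \<notin> J \<and> pw f x (Suc k) \<in> J"
      by (rule last_power[OF J AZ(1)[OF xA(1)] xA(2) _ \<kappa>J[OF xA(1)]]) (use \<kappa>[OF xA(1)] in simp)
  qed
  then obtain l where l: "\<And>x. x \<in> A - J \<Longrightarrow> l x > 0 \<and> pw f x (l x) \<notin> J \<and> pw f x (Suc (l x)) \<in> J"
    by metis
  have l\<kappa>: "l x < \<kappa> x" if x: "x \<in> A - J" for x
  proof (rule ccontr)
    assume "\<not> l x < \<kappa> x"
    then have "pw f x (l x) \<in> J"
      using pw_ideal_mono[OF J, of x "\<kappa> x" "l x"] \<kappa>J \<kappa> x AZ by auto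
    then show False using l x by blast
  qed
  \<comment> \<open>Equal powers would give \<open>x^(l x + 1) = x \<cdot> y^(l y)\<close>, which
    lies in \<open>I\<close> by orthogonality; as \<open>l x < \<kappa> x\<close>, also
    \<open>x^(\<kappa> x)\<close> would lie in \<open>I\<close>.\<close>
  have "inj_on (\<lambda>x. pw f x (l x)) (A - J)"
  proof (rule inj_onI, rule ccontr)
    fix x y assume xy: "x \<in> A - J" "y \<in> A - J" "pw f x (l x) = pw f y (l y)" "x \<noteq> y"
    have "x \<cdot> pw f y (l y) \<in> I" using orth_pw[of x y 1 "l y"] xy l by auto
    then have "pw f x (Suc (l x)) \<in> I" using xy l by (simp add: pw_Suc)
    then have "pw f x (\<kappa> x) \<in> I"
      using pw_ideal_mono[OF I, of x "Suc (l x)" "\<kappa> x"] l\<kappa>[OF xy(1)] xy AZ by auto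
    then show False using \<kappa> xy by blast
  qed
  then have "infinite ((\<lambda>x. pw f x (l x)) ` (A - J))"
    using \<open>infinite (A - J)\<close> finite_imageD by blast
  moreover have "finite ((\<lambda>x. pw f x (l x)) ` (A - J))"
  proof (rule nil_set_finite[OF J])
    show "(\<lambda>x. pw f x (l x)) ` (A - J) \<subseteq> Z - J" using l AZ by auto
    fix u v assume "u \<in> (\<lambda>x. pw f x (l x)) ` (A - J)" "v \<in> (\<lambda>x. pw f x (l x)) ` (A - J)"
    then obtain x y where xy: "x \<in> A - J" "y \<in> A - J" "u = pw f x (l x)" "v = pw f y (l y)" by blast
    show "u \<cdot> v \<in> J"
    proof (cases "x = y")
      case True
      then show ?thesis using squareI[OF J, of x "l x"] l[OF xy(1)] xy by auto
    next
      case False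
      then show ?thesis using orth_pw[of x y "l x" "l y"] l xy by (auto simp: J_def)
    qed
  qed
  ultimately show False by contradiction
qed

section \<open>Central elements outside the subgroups\<close>

lemma Union_multiples_ideal:
  assumes "B \<subseteq> Z"
  shows "ideal_of X f (\<Union>b\<in>B. multiples b)"
proof -
  have "ideal_of X f (multiples b)" if "b \<in> B" for b using multiples_ideal assms that by blast
  then show ?thesis unfolding ideal_of_def by blast
qed

lemma idem_multiples:
  assumes e: "e \<in> idems Z f" and z: "z \<in> multiples e"
  shows "e \<cdot> z = z"
proof -
  consider "z = e" | y where "y \<in> X" "z = y \<cdot> e" using z by (auto simp: multiples_def)
  then show ?thesis
  proof cases
    case 1
    then show ?thesis using idemsX(3)[OF e] by simp
  next
    case 2
    then have "e \<cdot> z = y \<cdot> (e \<cdot> e)"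
      using Z_comm[OF idemsX(2)[OF e], of "y \<cdot> e"] idemsX(1)[OF e] by (simp add: assoc)
    then show ?thesis using 2 idemsX(3)[OF e] by simp
  qed
qed

lemma idem_pw:
  assumes "e \<in> X" "z \<in> X" "e \<cdot> z = z" "n > 0"
  shows "e \<cdot> pw f z n = pw f z n"
  using \<open>n > 0\<close>
proof (induction n rule: nat_induct_non_zero)
  case 1
  then show ?case using assms by simp
next
  case (Suc n)
  then show ?case using assms by (simp add: pw_Suc flip: assoc)
qed

text \<open>\<open>nil_part_finite\<close> is used twice: for the principal ideal of
  \<open>e\<close>, it bounds the bad elements with idempotent power \<open>e\<close>; for the union
  of the principal ideals of an infinite antichain, it excludes infinitely many such
  \<open>e\<close>. The antichain comes from Ramsey's theorem, since infinite chains are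
  impossible.\<close>

lemma almost_clifford_center: "finite (Z - clifford_part Z f)"
proof (rule ccontr)
  assume inf: "infinite (Z - clifford_part Z f)"
  have "\<forall>z\<in>Z. \<exists>e\<in>idems Z f. \<exists>n>0. pw f z n = e"
    using periodic_center by (auto simp: periodic_on_def)
  then obtain \<epsilon> where \<epsilon>: "\<And>z. z \<in> Z \<Longrightarrow> \<epsilon> z \<in> idems Z f \<and> (\<exists>n>0. pw f z n = \<epsilon> z)" by metis
  let ?M = "Z - clifford_part Z f"
  have not_mult: "z \<notin> multiples (\<epsilon> z)" if z: "z \<in> ?M" for z
  proof
    assume "z \<in> multiples (\<epsilon> z)"
    then have "\<epsilon> z \<cdot> z = z" using \<epsilon> z idem_multiples by blast
    then have "z \<in> unit_group Z f (\<epsilon> z)" using \<epsilon> z by (auto simp: unit_group_def)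
    then show False using Z.unit_group_clifford z by blast
  qed
  have fibre: "finite {z \<in> ?M. \<epsilon> z = e}" if e: "e \<in> idems Z f" for e
  proof (rule finite_subset)
    show "finite {z \<in> Z - multiples e. \<exists>n>0. pw f z n \<in> multiples e}"
      using nil_part_finite multiples_ideal idemsX(2)[OF e] by blast
    show "{z \<in> ?M. \<epsilon> z = e} \<subseteq> {z \<in> Z - multiples e. \<exists>n>0. pw f z n \<in> multiples e}"
    proof
      fix z assume z: "z \<in> {z \<in> ?M. \<epsilon> z = e}"
      then obtain n where "n > 0" "pw f z n = e" using \<epsilon>[of z] by auto
      then show "z \<in> {z \<in> Z - multiples e. \<exists>n>0. pw f z n \<in> multiples e}"
        using z not_mult[of z] by auto
    qed
  qed
  have "infinite (\<epsilon> ` ?M)"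
  proof
    assume "finite (\<epsilon> ` ?M)"
    then have "finite (\<Union>e\<in>\<epsilon> ` ?M. {z \<in> ?M. \<epsilon> z = e})"
      by (rule finite_UN_I) (use fibre \<epsilon> in blast)
    moreover have "?M \<subseteq> (\<Union>e\<in>\<epsilon> ` ?M. {z \<in> ?M. \<epsilon> z = e})" by blast
    ultimately show False using inf finite_subset by blast
  qed
  \<comment> \<open>A colouring of unordered pairs, with colour \<open>1\<close> for comparability
    in either direction. The homogeneous colour \<open>1\<close> would produce an infinite
    chain.\<close>
  define comparable where "comparable S = (if \<exists>u\<in>S. \<exists>v\<in>S. u \<noteq> v \<and> u \<cdot> v = u then 1 else 0 :: nat)" for S
  have "\<forall>x\<in>\<epsilon> ` ?M. \<forall>y\<in>\<epsilon> ` ?M. x \<noteq> y \<longrightarrow> comparable {x, y} < 2" by (simp add: comparable_def)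
  from Ramsey2[OF \<open>infinite (\<epsilon> ` ?M)\<close> this]
  obtain E t where E: "E \<subseteq> \<epsilon> ` ?M" "infinite E"
    and t: "\<forall>x\<in>E. \<forall>y\<in>E. x \<noteq> y \<longrightarrow> comparable {x, y} = t" by blast
  have EI: "E \<subseteq> idems Z f" using E(1) \<epsilon> by blast
  have E1: "u \<in> Z" "u \<in> X" "u \<cdot> u = u" if "u \<in> E" for u using idemsX that EI by auto
  have anti: "u \<cdot> v \<noteq> u" if uv: "u \<in> E" "v \<in> E" "u \<noteq> v" for u v
  proof
    assume "u \<cdot> v = u"
    then have "comparable {u, v} = 1" using uv by (auto simp: comparable_def)
    then have "t = 1" using t uv by metis
    have "\<forall>u\<in>E. \<forall>v\<in>E. u \<cdot> v \<in> {u, v}"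
    proof (intro ballI)
      fix x y assume xy: "x \<in> E" "y \<in> E"
      show "x \<cdot> y \<in> {x, y}"
      proof (cases "x = y")
        case False
        then have "comparable {x, y} = 1" using t \<open>t = 1\<close> xy by metis
        then have "x \<cdot> y = x \<or> y \<cdot> x = y" by (auto simp: comparable_def split: if_splits)
        then show ?thesis using Z_comm[of x y] E1 xy by auto
      qed (use E1 xy in simp)
    qed
    then show False using chain_finite_center EI E(2) unfolding chain_finite_on_def by blast
  qed
  have "\<forall>e\<in>E. \<exists>z\<in>?M. \<epsilon> z = e" using E(1) by blast
  then obtain \<zeta> where \<zeta>: "\<And>e. e \<in> E \<Longrightarrow> \<zeta> e \<in> ?M \<and> \<epsilon> (\<zeta> e) = e" by metis
  let ?I = "\<Union>e\<in>E. multiples e"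
  have "inj_on \<zeta> E" using \<zeta> by (metis inj_onI)
  then have "infinite (\<zeta> ` E)" using E(2) finite_imageD by blast
  moreover have "\<zeta> ` E \<subseteq> {z \<in> Z - ?I. \<exists>n>0. pw f z n \<in> ?I}"
  proof (rule image_subsetI)
    fix e assume e: "e \<in> E"
    have z: "\<zeta> e \<in> ?M" "\<epsilon> (\<zeta> e) = e" using \<zeta>[OF e] by auto
    have zX: "\<zeta> e \<in> X" "\<zeta> e \<in> Z" using z Z_X by auto
    obtain n where n: "n > 0" "pw f (\<zeta> e) n = e" using \<epsilon>[OF zX(2)] z(2) by auto
    \<comment> \<open>Membership would make \<open>d\<close> a unit for \<open>\<zeta> e\<close> and
      for its power \<open>e\<close>, so \<open>e\<close> would be below \<open>d\<close>. The
      antichain then gives \<open>d = e\<close>, which \<open>not_mult\<close> excludes.\<close>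
    have "\<zeta> e \<notin> multiples d" if d: "d \<in> E" for d
    proof
      assume m: "\<zeta> e \<in> multiples d"
      have "d \<cdot> \<zeta> e = \<zeta> e" using idem_multiples[OF _ m] EI d by blast
      then have "d \<cdot> e = e" using idem_pw[OF E1(2)[OF d] zX(1) _ n(1)] n(2) by simp
      then have "e \<cdot> d = e" using Z_comm[OF E1(1)[OF d] E1(2)[OF e]] by simp
      then have "d = e" using anti[OF e d] by blast
      then show False using not_mult[OF z(1)] m z(2) by simp
    qed
    moreover have "pw f (\<zeta> e) n \<in> ?I" unfolding n(2) using e multiples_self by blast
    ultimately show "\<zeta> e \<in> {z \<in> Z - ?I. \<exists>n>0. pw f z n \<in> ?I}" using zX n(1) by blast
  qed
  ultimately have "infinite {z \<in> Z - ?I. \<exists>n>0. pw f z n \<in> ?I}" using finite_subset by blast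
  moreover have "ideal_of X f ?I" using Union_multiples_ideal E1(1) by blast
  ultimately show False using nil_part_finite by blast
qed

section \<open>Exponents of the central subgroups\<close>

text \<open>The unit of any subgroup containing the idempotent \<open>e\<close> is \<open>e\<close>
  itself, so the subgroups in the union share it and together form the group of units of
  \<open>e X e\<close>.\<close>

lemma max_subgroup_iff:
  assumes e: "e \<in> X" "e \<cdot> e = e"
  shows "x \<in> max_subgroup X f e \<longleftrightarrow> x \<in> X \<and> e \<cdot> x = x \<and> x \<cdot> e = x \<and>
    (\<exists>y\<in>X. e \<cdot> y = y \<and> y \<cdot> e = y \<and> x \<cdot> y = e \<and> y \<cdot> x = e)" (is "_ \<longleftrightarrow> x \<in> X \<and> ?P x")
proof
  assume "x \<in> max_subgroup X f e"
  then obtain G where "subgroup_of X f G" and xe: "e \<in> G" "x \<in> G" by (auto simp: max_subgroup_def)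
  then have "G \<subseteq> X" "\<exists>u\<in>G. \<forall>g\<in>G. u \<cdot> g = g \<and> g \<cdot> u = g \<and> (\<exists>k\<in>G. g \<cdot> k = u \<and> k \<cdot> g = u)"
    by (simp_all add: subgroup_of_def)
  then obtain u where u: "u \<in> G" "\<And>g. g \<in> G \<Longrightarrow> u \<cdot> g = g" "\<And>g. g \<in> G \<Longrightarrow> g \<cdot> u = g"
    "\<And>g. g \<in> G \<Longrightarrow> \<exists>k\<in>G. g \<cdot> k = u \<and> k \<cdot> g = u" by blast
  obtain k where k: "k \<in> G" "e \<cdot> k = u" using u(4)[OF xe(1)] by blast
  have "e \<cdot> u = u" using k \<open>G \<subseteq> X\<close> e xe assoc[of e e k] by auto
  then have "u = e" using u(3)[OF xe(1)] by simp
  moreover obtain y where "y \<in> G" "x \<cdot> y = u" "y \<cdot> x = u" using u(4)[OF xe(2)] by blast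
  ultimately show "x \<in> X \<and> ?P x" using u(2,3) xe \<open>G \<subseteq> X\<close> by (metis subsetD)
next
  assume x: "x \<in> X \<and> ?P x"
  let ?G = "{x \<in> X. ?P x}"
  have eG: "e \<in> ?G" using e by auto
  have "subgroup_of X f ?G"
    unfolding subgroup_of_def
  proof (intro conjI ballI)
    fix g h assume "g \<in> ?G" "h \<in> ?G"
    then obtain g' h' where g: "g \<in> X" "e \<cdot> g = g" "g \<cdot> e = g" "g' \<in> X" "e \<cdot> g' = g'" "g' \<cdot> e = g'"
      "g \<cdot> g' = e" "g' \<cdot> g = e"
      and h: "h \<in> X" "e \<cdot> h = h" "h \<cdot> e = h" "h' \<in> X" "e \<cdot> h' = h'" "h' \<cdot> e = h'"
      "h \<cdot> h' = e" "h' \<cdot> h = e" by blast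
    have "e \<cdot> (g \<cdot> h) = g \<cdot> h" "g \<cdot> h \<cdot> e = g \<cdot> h" "e \<cdot> (h' \<cdot> g') = h' \<cdot> g'" "h' \<cdot> g' \<cdot> e = h' \<cdot> g'"
      using g h e by (simp_all add: assoc, simp_all flip: assoc)
    moreover have "g \<cdot> h \<cdot> (h' \<cdot> g') = g \<cdot> ((h \<cdot> h') \<cdot> g')" "h' \<cdot> g' \<cdot> (g \<cdot> h) = h' \<cdot> ((g' \<cdot> g) \<cdot> h)"
      using g(1,4) h(1,4) by (simp_all add: assoc)
    ultimately show "g \<cdot> h \<in> ?G" using g h by auto
  next
    have "e \<cdot> g = g \<and> g \<cdot> e = g \<and> (\<exists>k\<in>?G. g \<cdot> k = e \<and> k \<cdot> g = e)" if gG: "g \<in> ?G" for g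
    proof -
      obtain g' where g: "g \<in> X" "e \<cdot> g = g" "g \<cdot> e = g" "g' \<in> X" "e \<cdot> g' = g'" "g' \<cdot> e = g'"
      "g \<cdot> g' = e" "g' \<cdot> g = e" using gG by blast
      have "g' \<in> ?G" using g by blast
      then show ?thesis using g by blast
    qed
    then show "\<exists>u\<in>?G. \<forall>g\<in>?G. u \<cdot> g = g \<and> g \<cdot> u = g \<and> (\<exists>k\<in>?G. g \<cdot> k = u \<and> k \<cdot> g = u)"
      using eG by (intro bexI[of _ e]) blast+
  qed auto
  then show "x \<in> max_subgroup X f e" unfolding max_subgroup_def using x eG by blast
qed

lemma unbounded_power_sequence:
  assumes e: "e \<in> idems Z f" and unb: "\<forall>n>0. \<exists>x\<in>unit_group Z f e. pw f x n \<noteq> e"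
  shows "\<exists>s a. \<forall>n. s n > 0 \<and> s n dvd s (Suc n) \<and> a n \<in> unit_group Z f e \<and>
    pw f (a n) (s (Suc n)) = e \<and> (\<forall>c. 0 < c \<and> c \<le> 2 ^ n \<longrightarrow> pw f (a n) (s n * c) \<noteq> e)"
proof -
  let ?G = "unit_group Z f e"
  let ?R = "\<lambda>n s s'. s dvd s' \<and> (\<exists>a\<in>?G. pw f a s' = e \<and> (\<forall>c. 0 < c \<and> c \<le> 2 ^ n \<longrightarrow> pw f a (s * c) \<noteq> e))"
  have pe: "pw f e n = e" for n using e Z.pw_idems by blast
  have "\<exists>s. \<forall>n. s n > 0 \<and> ?R n (s n) (s (Suc n))"
  proof (rule dependent_nat_choice)
    show "\<exists>s::nat. s > 0" by blast
    show "\<exists>s'. s' > 0 \<and> ?R n s s'" if s: "s > 0" for s n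
    proof -
      \<comment> \<open>Every positive \<open>c \<le> 2 ^ n\<close> divides the factorial, so
        \<open>a^(s c) = e\<close> would imply \<open>a^N = e\<close>. The next term is
        \<open>s * k\<close>, a multiple of \<open>s\<close> whose power kills
        \<open>a\<close>.\<close>
      let ?N = "s * fact (2 ^ n)"
      have "?N > 0" using s by simp
      then obtain a where a: "a \<in> ?G" "pw f a ?N \<noteq> e" using unb by blast
      then have aX: "a \<in> X" using Z_X by (auto simp: unit_group_def)
      obtain k where k: "k > 0" "pw f a k = e" using a by (auto simp: unit_group_def)
      have "pw f a (s * k) = pw f (pw f a k) s" using aX k(1) s by (simp add: pw_mult mult.commute)
      then have "pw f a (s * k) = e" using k(2) pe by simp
      moreover have "pw f a (s * c) \<noteq> e" if c: "0 < c" "c \<le> 2 ^ n" for c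
      proof
        assume sc: "pw f a (s * c) = e"
        obtain d where d: "fact (2 ^ n) = c * d" using dvd_fact[of c "2 ^ n"] c by (auto elim: dvdE)
        have "c * d > 0" unfolding d[symmetric] by (rule fact_gt_zero)
        then have "d > 0" by simp
        have "pw f a ?N = pw f (pw f a (s * c)) d"
          using aX s c(1) \<open>d > 0\<close> by (simp add: pw_mult d mult.assoc)
        then show False using sc pe a(2) by simp
      qed
      ultimately show ?thesis using a(1) s k(1) by (intro exI[of _ "s * k"]) auto
    qed
  qed
  then obtain s where s: "\<And>n. s n > 0" "\<And>n. s n dvd s (Suc n)"
    "\<And>n. \<exists>a\<in>?G. pw f a (s (Suc n)) = e \<and> (\<forall>c. 0 < c \<and> c \<le> 2 ^ n \<longrightarrow> pw f a (s n * c) \<noteq> e)" by blast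
  then obtain a where "\<And>n. a n \<in> ?G \<and> pw f (a n) (s (Suc n)) = e \<and>
      (\<forall>c. 0 < c \<and> c \<le> 2 ^ n \<longrightarrow> pw f (a n) (s n * c) \<noteq> e)" by metis
  then show ?thesis using s by blast
qed

lemma bounded_center:
  assumes e: "e \<in> idems Z f" and viable: "viable X f e"
  shows "\<exists>n>0. \<forall>x\<in>unit_group Z f e. pw f x n = e"
proof (rule ccontr)
  let ?G = "unit_group Z f e"
  assume "\<not> ?thesis"
  then have "\<forall>n>0. \<exists>x\<in>?G. pw f x n \<noteq> e" by blast
  from unbounded_power_sequence[OF e this] obtain s a where s: "\<And>n. s n > 0" "\<And>n. s n dvd s (Suc n)"
    and a: "\<And>n. a n \<in> ?G" "\<And>n. pw f (a n) (s (Suc n)) = e"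
      "\<And>n c. 0 < c \<Longrightarrow> c \<le> 2 ^ n \<Longrightarrow> pw f (a n) (s n * c) \<noteq> e" by blast
  note eX = idemsX[OF e]
  have pe: "pw f e n = e" for n using e Z.pw_idems by blast
  have GX: "x \<in> Z" "x \<in> X" "e \<cdot> x = x" "\<exists>n>0. pw f x n = e" if "x \<in> ?G" for x
    using that Z_X by (auto simp: unit_group_def)
  have G_mult: "x \<cdot> y \<in> ?G" if "x \<in> ?G" "y \<in> ?G" for x y
    using Z.unit_group_mult[OF that e e] eX(3) by simp
  have eG: "e \<in> ?G" using eX pe by (auto simp: unit_group_def)
  have G_pw: "pw f x k \<in> ?G" if "x \<in> ?G" "k > 0" for x k
    using \<open>k > 0\<close>
    by (induction k rule: nat_induct_non_zero) (use that(1) G_mult in \<open>auto simp: pw_Suc\<close>)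
  have pw_G: "pw f (x \<cdot> y) n = pw f x n \<cdot> pw f y n" if "x \<in> ?G" "y \<in> ?G" "n > 0" for x y n
    using pw_distrib[OF GX(2)[OF that(1)] GX(2)[OF that(2)] Z_comm[OF GX(1)[OF that(1)] GX(2)[OF that(2)]] that(3)] .
  have inverse: "\<exists>y\<in>?G. x \<cdot> y = e \<and> (\<forall>k>0. pw f x k = e \<longrightarrow> pw f y k = e)" if x: "x \<in> ?G" for x
  proof -
    obtain n where n: "n > 0" "pw f x n = e" using GX(4)[OF x] by blast
    have "x \<cdot> pw f x (n + n - 1) = pw f x (n + n)"
      using n(1) pw_Suc[of "n + n - 1" f x] by simp
    also have "\<dots> = e" using n GX[OF x] eX by (simp add: pw_add)
    finally have "x \<cdot> pw f x (n + n - 1) = e" .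
    moreover have "pw f (pw f x (n + n - 1)) k = e" if "k > 0" "pw f x k = e" for k
      using that n(1) GX[OF x] pe pw_mult[of x k "n + n - 1"]
      by (simp add: pw_mult mult.commute)
    moreover have "pw f x (n + n - 1) \<in> ?G" using G_pw[OF x] n(1) by simp
    ultimately show ?thesis by blast
  qed
  define T where "T m = {x \<in> ?G. pw f x (s m) = e}" for m
  have s_dvd: "s m dvd s k" if "m \<le> k" for m k
    using that by (induction k rule: dec_induct) (simp_all add: dvd_trans[OF _ s(2)])
  have T_mono: "T m \<subseteq> T k" if mk: "m \<le> k" for m k
  proof
    fix x assume x: "x \<in> T m"
    obtain d where d: "s k = s m * d" using s_dvd[OF mk] by (auto elim: dvdE)
    then have "d > 0" using s(1)[of k] by simp
    then have "pw f x (s k) = pw f (pw f x (s m)) d"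
      unfolding d by (intro pw_mult[symmetric] s(1)) (use x GX(2) in \<open>simp_all add: T_def\<close>)
    then show "x \<in> T k" using x pe by (simp add: T_def)
  qed
  have T_mult: "x \<cdot> y \<in> T m" if "x \<in> T m" "y \<in> T m" for x y m
    using that G_mult pw_G s(1) eX(3) by (simp add: T_def)
  have T_pw: "pw f x k \<in> T m" if "x \<in> T m" "k > 0" for x k m
    using \<open>k > 0\<close>
    by (induction k rule: nat_induct_non_zero) (use that(1) T_mult in \<open>auto simp: pw_Suc\<close>)
  have a_T: "a m \<in> T (Suc m)" for m using a by (simp add: T_def)
  have eT: "e \<in> T m" for m using eG pe by (simp add: T_def)
  have T_inv: "\<exists>y\<in>T m. x \<cdot> y = e" if "x \<in> T m" for x m
    using inverse[of x] that s(1)[of m] by (auto simp: T_def)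
  have T_G: "x \<in> ?G" if "x \<in> T m" for x m using that by (simp add: T_def)
  define A where "A = (\<Union>m. T m)"
  \<comment> \<open>Passing from \<open>n\<close> to \<open>Suc n\<close> halves the admissible
    exponents \<open>c\<close>, so two of them add up to one admissible for
    \<open>n\<close>.\<close>
  define U where "U n = {x \<cdot> pw f (a m) c |m x c. n \<le> m \<and> x \<in> T m \<and> 0 < c \<and> c * 2 ^ n \<le> 2 ^ m}" for n
  have U_T: "\<exists>m\<ge>n. u \<in> T (Suc m)" if "u \<in> U n" for u n
  proof -
    have "\<exists>m x c. u = x \<cdot> pw f (a m) c \<and> n \<le> m \<and> x \<in> T m \<and> 0 < c" using that unfolding U_def by blast
    then obtain m x c where u: "u = x \<cdot> pw f (a m) c" "n \<le> m" "x \<in> T m" "0 < c" by blast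
    have "x \<in> T (Suc m)" using T_mono[of m "Suc m"] u(3) by auto
    then have "u \<in> T (Suc m)" using T_mult T_pw[OF a_T u(4)] u(1) by simp
    then show ?thesis using u(2) by blast
  qed
  have UA: "U n \<subseteq> A" for n using U_T unfolding A_def by blast
  have AG: "x \<in> ?G" if "x \<in> A" for x using that T_G unfolding A_def by blast
  have T_U: "y \<cdot> u \<in> U n" if y: "y \<in> T k" and u: "u \<in> U (max n k)" for y u n k
  proof -
    have "\<exists>m x c. u = x \<cdot> pw f (a m) c \<and> max n k \<le> m \<and> x \<in> T m \<and> 0 < c \<and> c * 2 ^ max n k \<le> 2 ^ m"
      using u unfolding U_def by blast
    then obtain m x c where u: "u = x \<cdot> pw f (a m) c" "max n k \<le> m" "x \<in> T m" "0 < c"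
      "c * 2 ^ max n k \<le> (2::nat) ^ m" by blast
    have "y \<in> T m" using T_mono[of k m] u(2) y by auto
    then have "y \<cdot> x \<in> T m" using T_mult u(3) by blast
    moreover have "y \<cdot> u = y \<cdot> x \<cdot> pw f (a m) c"
      using GX(2) T_G[OF y] T_G[OF u(3)] a(1) u(1) by (simp add: assoc)
    moreover have "c * 2 ^ n \<le> (2::nat) ^ m"
    proof -
      have "c * 2 ^ n \<le> c * (2::nat) ^ max n k" by (intro mult_left_mono power_increasing) auto
      then show ?thesis using u(5) by linarith
    qed
    moreover have "n \<le> m" using u(2) by simp
    ultimately show ?thesis unfolding U_def using u(4) by blast
  qed
  \<comment> \<open>Raising \<open>u\<close> to the power \<open>s m\<close> kills the factor
    \<open>x\<close> and leaves \<open>a_m^(s_m c)\<close>, which is not \<open>e\<close> because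
    \<open>0 < c \<le> 2 ^ m\<close>.\<close>
  have disjoint: "u \<notin> T k" if u: "u \<in> U k" for u k
  proof
    assume "u \<in> T k"
    have "\<exists>m x c. u = x \<cdot> pw f (a m) c \<and> k \<le> m \<and> x \<in> T m \<and> 0 < c \<and> c * 2 ^ k \<le> 2 ^ m"
      using u unfolding U_def by blast
    then obtain m x c where u: "u = x \<cdot> pw f (a m) c" "k \<le> m" "x \<in> T m" "0 < c"
      "c * 2 ^ k \<le> (2::nat) ^ m" by blast
    have c: "c \<le> 2 ^ m"
    proof -
      have "c * 1 \<le> c * 2 ^ k" by (intro mult_left_mono) auto
      then show ?thesis using u(5) by linarith
    qed
    have aG: "pw f (a m) c \<in> ?G" using G_pw a(1) u(4) by blast
    have "u \<in> T m" using T_mono[OF u(2)] \<open>u \<in> T k\<close> by blast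
    then have "e = pw f u (s m)" by (simp add: T_def)
    also have "\<dots> = pw f x (s m) \<cdot> pw f (pw f (a m) c) (s m)"
      unfolding u(1) using pw_G[OF T_G[OF u(3)] aG s(1)] .
    also have "\<dots> = e \<cdot> pw f (pw f (a m) c) (s m)" using u(3) by (simp add: T_def)
    also have "\<dots> = pw f (pw f (a m) c) (s m)" using GX(3)[OF G_pw[OF aG s(1)]] .
    also have "\<dots> = pw f (a m) (s m * c)"
      using GX(2)[OF a(1)] u(4) s(1) by (simp add: pw_mult mult.commute)
    finally show False using a(3)[OF u(4) c] by simp
  qed
  let ?M = "{x \<in> X. x \<cdot> e = e \<cdot> x \<and> x \<cdot> e \<in> max_subgroup X f e}"
  define I where "I = X - ?M"
  have I: "ideal_of X f I" using viable by (simp add: viable_def I_def)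
  note H_iff = max_subgroup_iff[OF eX(1,3)]
  have G_H: "x \<in> max_subgroup X f e" if x: "x \<in> ?G" for x
  proof -
    obtain y where y: "y \<in> ?G" "x \<cdot> y = e" using inverse[OF x] by blast
    have "x \<cdot> e = x" "y \<cdot> e = y" "y \<cdot> x = e"
      using GX[OF x] GX[OF y(1)] Z_comm[OF GX(1)[OF x] eX(1)] Z_comm[OF GX(1)[OF y(1)] eX(1)]
        Z_comm[OF GX(1)[OF y(1)] GX(2)[OF x]] y(2) by auto
    then show ?thesis unfolding H_iff using GX[OF x] GX[OF y(1)] y(2) by blast
  qed
  have M_iff: "x \<in> X - I \<longleftrightarrow> x \<in> X \<and> x \<cdot> e \<in> max_subgroup X f e" for x
  proof -
    have "x \<in> X \<Longrightarrow> x \<cdot> e = e \<cdot> x" using Z_comm[OF eX(2)] by metis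
    then show ?thesis unfolding I_def by blast
  qed
  have M_mult: "x \<cdot> y \<in> X - I" if x: "x \<in> X - I" and y: "y \<in> ?G" for x y
  proof -
    obtain x' where x': "x' \<in> X" "e \<cdot> x' = x'" "x' \<cdot> e = x'" "(x \<cdot> e) \<cdot> x' = e" "x' \<cdot> (x \<cdot> e) = e"
      using x unfolding M_iff H_iff by blast
    obtain y' where y': "y' \<in> ?G" "y \<cdot> y' = e" using inverse[OF y] by blast
    have X: "x \<in> X" "y \<in> X" "y' \<in> X" using x y y' GX by auto
    have "x \<cdot> y \<cdot> e = x \<cdot> e \<cdot> y"
      using X eX Z_comm[OF eX(2), of y] by (simp add: assoc)
    have ee: "e \<cdot> (x \<cdot> e \<cdot> y) = x \<cdot> e \<cdot> y" "x \<cdot> e \<cdot> y \<cdot> e = x \<cdot> e \<cdot> y"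
    proof -
      have "e \<cdot> (x \<cdot> e) = x \<cdot> e" using X eX Z_comm[OF eX(2), of "x \<cdot> e"] by (simp add: assoc)
      then show "e \<cdot> (x \<cdot> e \<cdot> y) = x \<cdot> e \<cdot> y" using X eX by (simp flip: assoc)
      have "y \<cdot> e = y" using GX(3)[OF y] Z_comm[OF eX(2) X(2)] by simp
      then show "x \<cdot> e \<cdot> y \<cdot> e = x \<cdot> e \<cdot> y" using X eX by (simp add: assoc)
    qed
    \<comment> \<open>The inverse of \<open>x \<cdot> e \<cdot> y\<close>; as \<open>y\<close> and
      \<open>y'\<close> are central, the factors need not be reversed.\<close>
    let ?z = "x' \<cdot> y'"
    have y'e: "y' \<cdot> e = y'" using GX(3)[OF y'(1)] Z_comm[OF eX(2) X(3)] by simp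
    have z: "?z \<in> X" "e \<cdot> ?z = ?z" "?z \<cdot> e = ?z"
    proof -
      show "?z \<in> X" using x' X by blast
      show "e \<cdot> ?z = ?z" using x' X eX by (simp flip: assoc)
      show "?z \<cdot> e = ?z" using x' X eX y'e by (simp add: assoc)
    qed
    have "x \<cdot> e \<cdot> y \<cdot> ?z = x \<cdot> e \<cdot> (y \<cdot> x') \<cdot> y'" using x'(1) X eX by (simp add: assoc)
    also have "\<dots> = x \<cdot> e \<cdot> (x' \<cdot> y) \<cdot> y'" using Z_comm[OF GX(1)[OF y] x'(1)] by simp
    also have "\<dots> = (x \<cdot> e \<cdot> x') \<cdot> (y \<cdot> y')" using x'(1) X eX by (simp add: assoc)
    also have "\<dots> = e" using x'(4) y'(2) eX by simp
    finally have 1: "x \<cdot> e \<cdot> y \<cdot> ?z = e" .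
    have "?z \<cdot> (x \<cdot> e \<cdot> y) = x' \<cdot> (y' \<cdot> (x \<cdot> e)) \<cdot> y" using x'(1) X eX by (simp add: assoc)
    also have "\<dots> = x' \<cdot> (x \<cdot> e \<cdot> y') \<cdot> y"
      using Z_comm[OF GX(1)[OF y'(1)], of "x \<cdot> e"] X eX by simp
    also have "\<dots> = (x' \<cdot> (x \<cdot> e)) \<cdot> (y' \<cdot> y)" using x'(1) X eX by (simp add: assoc)
    also have "\<dots> = e" using x'(5) y'(2) Z_comm[OF GX(1)[OF y'(1)] X(2)] eX by simp
    finally have 2: "?z \<cdot> (x \<cdot> e \<cdot> y) = e" .
    have "x \<cdot> e \<cdot> y \<in> X" using X eX by blast
    then have "x \<cdot> e \<cdot> y \<in> max_subgroup X f e" unfolding H_iff using ee z 1 2 by blast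
    then show ?thesis unfolding M_iff \<open>x \<cdot> y \<cdot> e = x \<cdot> e \<cdot> y\<close> using X by blast
  qed
  have G_M: "x \<in> X - I" if x: "x \<in> ?G" for x
    unfolding M_iff using G_H[OF x] GX(2,3)[OF x] Z_comm[OF eX(2) GX(2)[OF x]] by simp
  show False
  proof (rule rees_not_C_closed[OF I rees_closed[OF I], of A U])
    show "A \<subseteq> Z" using AG GX(1) by blast
    show "A \<inter> I = {}" using AG G_M by blast
    show "x \<cdot> y \<in> A" if xy: "x \<in> A" "y \<in> A" for x y
    proof -
      obtain m k where "x \<in> T m" "y \<in> T k" using xy by (auto simp: A_def)
      then have "x \<in> T (max m k)" "y \<in> T (max m k)"
        using T_mono[of m "max m k"] T_mono[of k "max m k"] by auto
      then show ?thesis using T_mult unfolding A_def by blast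
    qed
    show "U n \<noteq> {}" for n
    proof -
      have "e \<cdot> pw f (a n) 1 \<in> U n"
        unfolding U_def using eT[of n] by (intro CollectI exI[of _ n] exI[of _ e] exI[of _ 1]) simp
      then show ?thesis by blast
    qed
    show "U n \<subseteq> A" for n by (rule UA)
    show "U (Suc n) \<subseteq> U n" for n
    proof
      fix u assume "u \<in> U (Suc n)"
      then have "\<exists>m x c. u = x \<cdot> pw f (a m) c \<and> Suc n \<le> m \<and> x \<in> T m \<and> 0 < c \<and> c * 2 ^ Suc n \<le> 2 ^ m"
        unfolding U_def by blast
      then obtain m x c where u: "u = x \<cdot> pw f (a m) c" "Suc n \<le> m" "x \<in> T m" "0 < c"
        "c * 2 ^ Suc n \<le> (2::nat) ^ m" by blast
      then have "n \<le> m" "c * 2 ^ n \<le> (2::nat) ^ m" by simp_all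
      then show "u \<in> U n" unfolding U_def using u by blast
    qed
    show "\<exists>k. \<forall>u\<in>U k. \<forall>v\<in>U k. u \<cdot> v \<in> U n" for n
    proof (intro exI[of _ "Suc n"] ballI)
      fix u v assume "u \<in> U (Suc n)" "v \<in> U (Suc n)"
      then have "\<exists>m x c. u = x \<cdot> pw f (a m) c \<and> Suc n \<le> m \<and> x \<in> T m \<and> 0 < c \<and> c * 2 ^ Suc n \<le> 2 ^ m"
        "\<exists>m x c. v = x \<cdot> pw f (a m) c \<and> Suc n \<le> m \<and> x \<in> T m \<and> 0 < c \<and> c * 2 ^ Suc n \<le> 2 ^ m"
        unfolding U_def by blast+
      then obtain m x c m' x' c' where u: "u = x \<cdot> pw f (a m) c" "Suc n \<le> m" "x \<in> T m" "0 < c"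
        "c * 2 ^ Suc n \<le> (2::nat) ^ m"
        and v: "v = x' \<cdot> pw f (a m') c'" "Suc n \<le> m'" "x' \<in> T m'" "0 < c'"
        "c' * 2 ^ Suc n \<le> (2::nat) ^ m'" by blast
      \<comment> \<open>If \<open>i < i'\<close>, the whole factor \<open>p\<close> has exponent
        \<open>s i'\<close> and is absorbed into the torsion part of \<open>q\<close>, so the
        exponent \<open>d'\<close> stays as it is.\<close>
      have lt: "p \<cdot> q \<in> U n"
        if pq: "p = y \<cdot> pw f (a i) d" "y \<in> T i" "0 < d"
          "q = y' \<cdot> pw f (a i') d'" "Suc n \<le> i'" "y' \<in> T i'" "0 < d'" "d' * 2 ^ Suc n \<le> (2::nat) ^ i'"
          "i < i'" for p q y i d y' i' d'
      proof -
        have "y \<in> T (Suc i)" using T_mono[of i "Suc i"] pq(2) by auto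
        then have "p \<in> T (Suc i)" using T_mult T_pw[OF a_T pq(3)] pq(1) by simp
        then have "p \<in> T i'" using T_mono[of "Suc i" i'] pq(9) by auto
        then have "p \<cdot> y' \<in> T i'" using T_mult pq(6) by blast
        moreover have "p \<cdot> q = p \<cdot> y' \<cdot> pw f (a i') d'"
          using GX(2) T_G[OF \<open>p \<in> T i'\<close>] T_G[OF pq(6)] a(1) pq(4) by (simp add: assoc)
        moreover have "d' * 2 ^ n \<le> (2::nat) ^ i'" using pq(8) by simp
        moreover have "n \<le> i'" using pq(5) by simp
        ultimately show ?thesis unfolding U_def using pq(7) by blast
      qed
      consider "m < m'" | "m' < m" | "m = m'" by linarith
      then show "u \<cdot> v \<in> U n"
      proof cases
        case 1
        then show ?thesis by (rule lt[OF u(1,3,4) v])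
      next
        case 2
        then have "v \<cdot> u \<in> U n" by (rule lt[OF v(1,3,4) u])
        moreover have "u \<in> ?G" "v \<in> ?G"
          using UA AG \<open>u \<in> U (Suc n)\<close> \<open>v \<in> U (Suc n)\<close> by blast+
        then have "u \<cdot> v = v \<cdot> u" using Z_comm GX(1,2) by blast
        ultimately show ?thesis by simp
      next
        case 3
        have X: "x \<in> X" "x' \<in> X" "a m \<in> X" using GX(2) T_G u(3) v(3) a(1) by blast+
        have "u \<cdot> v = x \<cdot> (pw f (a m) c \<cdot> x') \<cdot> pw f (a m) c'"
          using X u(1) v(1) 3 by (simp add: assoc)
        also have "\<dots> = x \<cdot> (x' \<cdot> pw f (a m) c) \<cdot> pw f (a m) c'"
          using Z_comm[of x' "pw f (a m) c"] X GX(1)[OF T_G[OF v(3)]] by simp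
        also have "\<dots> = x \<cdot> x' \<cdot> pw f (a m) (c + c')"
          using X u(4) v(4) by (simp add: assoc pw_add)
        finally have "u \<cdot> v = x \<cdot> x' \<cdot> pw f (a m) (c + c')" .
        moreover have "x \<cdot> x' \<in> T m" using T_mult u(3) v(3) 3 by blast
        moreover have "(c + c') * 2 ^ n \<le> (2::nat) ^ m" using u(5) v(5) 3 by (simp add: algebra_simps)
        moreover have "n \<le> m" "0 < c + c'" using u(2,4) by simp_all
        ultimately show ?thesis unfolding U_def by blast
      qed
    qed
    show "\<exists>k. (\<forall>u\<in>U k. x \<cdot> u \<in> U n) \<and> (\<forall>u\<in>U k. \<exists>v\<in>U n. u = x \<cdot> v)" if x: "x \<in> A" for x n
    proof -
      obtain k where k: "x \<in> T k" using x by (auto simp: A_def)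
      obtain y where y: "y \<in> T k" "x \<cdot> y = e" using T_inv[OF k] by blast
      have "u = x \<cdot> (y \<cdot> u)" if u: "u \<in> U (max n k)" for u
      proof -
        have uG: "u \<in> ?G" using UA AG u by blast
        have "x \<cdot> (y \<cdot> u) = x \<cdot> y \<cdot> u" using GX(2) T_G[OF k] T_G[OF y(1)] uG by (simp add: assoc)
        then show ?thesis using y(2) GX(3)[OF uG] by simp
      qed
      then show ?thesis using T_U[OF k] T_U[OF y(1)] by blast
    qed
    show "x \<cdot> y \<notin> I" if "x \<in> X - I" "y \<in> A" for x y
      using M_mult[OF that(1) AG[OF that(2)]] by blast
    show "\<exists>n. \<forall>u\<in>U n. x \<cdot> u \<noteq> c" if x: "x \<in> X - I" for x c
    proof (rule ccontr)
      assume "\<not> ?thesis"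
      then have ex: "\<exists>u\<in>U n. x \<cdot> u = c" for n by blast
      \<comment> \<open>Multiplication by the inverse of \<open>x \<cdot> e\<close> recovers
        \<open>u\<close> from \<open>x \<cdot> u = c\<close>. Thus \<open>y \<cdot> c\<close> would
        lie in every \<open>U n\<close>, but it lies in some \<open>T k\<close>, which is disjoint
        from \<open>U k\<close>.\<close>
      obtain y where y: "y \<in> X" "y \<cdot> (x \<cdot> e) = e" using x unfolding M_iff H_iff by blast
      have yc: "y \<cdot> c \<in> U n" for n
      proof -
        obtain u where u: "u \<in> U n" "x \<cdot> u = c" using ex by blast
        have uG: "u \<in> ?G" using UA AG u(1) by blast
        have "y \<cdot> c = y \<cdot> (x \<cdot> (e \<cdot> u))" using u(2) GX(3)[OF uG] by simp
        also have "\<dots> = y \<cdot> (x \<cdot> e) \<cdot> u" using y(1) x eX GX(2)[OF uG] by (simp add: assoc)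
        also have "\<dots> = u" using y(2) GX(3)[OF uG] by simp
        finally show ?thesis using u(1) by simp
      qed
      then obtain k where "y \<cdot> c \<in> T k" using UA[of 0] unfolding A_def by blast
      then show False using disjoint[OF yc] by blast
    qed
  qed
qed

lemma tame_center:
  assumes "Z_viable X f"
  shows "tame_sgrp Z f"
proof
  show "periodic_on Z f" by (rule periodic_center)
  show "chain_finite_on Z f" by (rule chain_finite_center)
  show "\<exists>n>0. \<forall>x\<in>unit_group Z f e. pw f x n = e" if "e \<in> idems Z f" for e
    using bounded_center[OF that] assms idemsX[OF that] by (simp add: Z_viable_def)
  show "finite (Z - clifford_part Z f)" by (rule almost_clifford_center)
qed

end

theorem theorem1p13:
  fixes X :: "'a set" and f :: "'a \<Rightarrow> 'a \<Rightarrow> 'a"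
  assumes "semigroup_on X f"
    and "Z_viable X f"
    and "ideally_closed (TzS :: 'a option option list topology \<Rightarrow> _ \<Rightarrow> bool) X f"
  shows "projectively_closed (T1S :: 'b topology \<Rightarrow> _ \<Rightarrow> bool) (center X f) f"
proof -
  interpret ideally_closed_sgrp X f by unfold_locales (fact assms)+
  show ?thesis using tame_projectively_T1S_closed[OF tame_center[OF assms(2)]] .
qed

end
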